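(* Let $n\geq 3$, let $A^{(i)}=\mathbb{C}^{m_i}$ for $1\leq i\leq n$, and let $T\in A^{(1)}\otimes\cdots\otimes A^{(n)}$. Then $\mathrm{GR}(T)$ is invariant under any permutation of the factors $A^{(1)*},\dots,A^{(n)*}$. Moreover, for any $1\leq i\leq n$, $$\mathrm{GR}(T)=\min\{\mathrm{codim}(A^{(i)*}_{j})+j\mid 0\leq j\leq \min\{m_1,\dots,\widehat{m_i},\dots,m_n\}\},$$ where $\widehat{m_i}$ indicates that $m_i$ is omitted.
   Context: For $k\geq 2$ and a tensor $S\in V_1\otimes\cdots\otimes V_k$ (finite-dimensional complex vector spaces), regarded as a multilinear function on $V_1^*\times\cdots\times V_k^*$, the geometric rank is $$\mathrm{GR}(S):=\mathrm{codim}\{(x_1,\dots,x_{k-1})\in V_1^*\times\cdots\times V_{k-1}^*\mid S(x_1,\dots,x_{k-1},x_k)=0\ \forall x_k\in V_k^*\}.$$ $T$ is regarded as a linear map $A^{(i)*}\to\bigotimes_{l\neq i}A^{(l)}$, $x_i\mapsto T(x_i)$ (contraction in the $i$-th factor), so that $T(x_i)$ is an $(n-1)$-part tensor, and $$A^{(i)*}_j:=\{x_i\in A^{(i)*}\mid \mathrm{GR}(T(x_i))\leq j\},$$ with codimension taken in $A^{(i)*}$. *)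

theory Defs
  imports "HOL-Analysis.Abstract_Topology" "HOL-Library.Extended_Nat"
    "HOL-Library.FuncSet" "HOL-Combinatorics.Permutations"
begin

section \<open>Zariski topology, dimension and codimension\<close>

definition affine_space :: "'i set \<Rightarrow> ('i \<Rightarrow> complex) set" where
  "affine_space I = I \<rightarrow>\<^sub>E UNIV"

inductive_set poly_functions :: "'i set \<Rightarrow> (('i \<Rightarrow> complex) \<Rightarrow> complex) set"
  for I :: "'i set" where
  const: "(\<lambda>_. c) \<in> poly_functions I"
| coord: "i \<in> I \<Longrightarrow> (\<lambda>x. x i) \<in> poly_functions I"
| add: "\<lbrakk>p \<in> poly_functions I; q \<in> poly_functions I\<rbrakk> \<Longrightarrow> (\<lambda>x. p x + q x) \<in> poly_functions I"
| mult: "\<lbrakk>p \<in> poly_functions I; q \<in> poly_functions I\<rbrakk> \<Longrightarrow> (\<lambda>x. p x * q x) \<in> poly_functions I"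

definition zero_locus :: "'i set \<Rightarrow> (('i \<Rightarrow> complex) \<Rightarrow> complex) set \<Rightarrow> ('i \<Rightarrow> complex) set" where
  "zero_locus I P = {x \<in> affine_space I. \<forall>p\<in>P. p x = 0}"

definition zariski :: "'i set \<Rightarrow> ('i \<Rightarrow> complex) topology" where
  "zariski I = topology (\<lambda>U. \<exists>P \<subseteq> poly_functions I. U = affine_space I - zero_locus I P)"

lemma zero_locus_Un:
  assumes "P \<subseteq> poly_functions I" "Q \<subseteq> poly_functions I"
  shows "zero_locus I P \<union> zero_locus I Q = zero_locus I {\<lambda>x. p x * q x |p q. p \<in> P \<and> q \<in> Q}"
  unfolding zero_locus_def by (auto; metis mult_eq_0_iff)

lemma istopology_zariski:
  "istopology (\<lambda>U. \<exists>P \<subseteq> poly_functions I. U = affine_space I - zero_locus I P)"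
  unfolding istopology_def
proof (intro conjI allI impI)
  fix S T
  assume "\<exists>P \<subseteq> poly_functions I. S = affine_space I - zero_locus I P"
    and "\<exists>P \<subseteq> poly_functions I. T = affine_space I - zero_locus I P"
  then obtain P Q where P: "P \<subseteq> poly_functions I" "S = affine_space I - zero_locus I P"
    and Q: "Q \<subseteq> poly_functions I" "T = affine_space I - zero_locus I Q" by blast
  have "S \<inter> T = affine_space I - zero_locus I {\<lambda>x. p x * q x |p q. p \<in> P \<and> q \<in> Q}"
    using zero_locus_Un[OF P(1) Q(1)] P(2) Q(2) by blast
  moreover have "{\<lambda>x. p x * q x |p q. p \<in> P \<and> q \<in> Q} \<subseteq> poly_functions I"
    using P(1) Q(1) by (auto intro: poly_functions.mult)
  ultimately show "\<exists>P \<subseteq> poly_functions I. S \<inter> T = affine_space I - zero_locus I P"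
    by blast
next
  fix \<K>
  assume "\<forall>K\<in>\<K>. \<exists>P \<subseteq> poly_functions I. K = affine_space I - zero_locus I P"
  then obtain P where P: "\<And>K. K \<in> \<K> \<Longrightarrow> P K \<subseteq> poly_functions I"
    "\<And>K. K \<in> \<K> \<Longrightarrow> K = affine_space I - zero_locus I (P K)" by metis
  have "x \<in> \<Union>\<K> \<longleftrightarrow> x \<in> affine_space I - zero_locus I (\<Union>K\<in>\<K>. P K)" for x
  proof -
    have "x \<in> \<Union>\<K> \<longleftrightarrow> (\<exists>K\<in>\<K>. x \<in> affine_space I - zero_locus I (P K))"
      using P(2) by auto
    then show ?thesis unfolding zero_locus_def by auto
  qed
  then have "\<Union>\<K> = affine_space I - zero_locus I (\<Union>K\<in>\<K>. P K)" by blast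
  then show "\<exists>P \<subseteq> poly_functions I. \<Union>\<K> = affine_space I - zero_locus I P"
    using P(1) by (metis UN_least)
qed

lemma openin_zariski:
  "openin (zariski I) U \<longleftrightarrow> (\<exists>P \<subseteq> poly_functions I. U = affine_space I - zero_locus I P)"
  by (simp add: zariski_def topology_inverse'[OF istopology_zariski])

lemma topspace_zariski: "topspace (zariski I) = affine_space I"
proof
  show "topspace (zariski I) \<subseteq> affine_space I"
    by (auto simp: topspace_def openin_zariski)
  have "affine_space I = affine_space I - zero_locus I {\<lambda>_. 1}"
    by (auto simp: zero_locus_def)
  then have "openin (zariski I) (affine_space I)"
    unfolding openin_zariski by (metis empty_subsetI insert_subset poly_functions.const)
  then show "affine_space I \<subseteq> topspace (zariski I)"
    by (rule openin_subset)
qed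

lemma closedin_zariski:
  "closedin (zariski I) Z \<longleftrightarrow> (\<exists>P \<subseteq> poly_functions I. Z = zero_locus I P)"
proof -
  have "zero_locus I P \<subseteq> affine_space I" for P
    by (auto simp: zero_locus_def)
  then show ?thesis
    unfolding closedin_def topspace_zariski openin_zariski
    by (metis Diff_Diff_Int inf.absorb_iff2 Diff_subset double_diff subset_refl)
qed

definition irreducible_in :: "'a topology \<Rightarrow> 'a set \<Rightarrow> bool" where
  "irreducible_in X Z \<longleftrightarrow> Z \<noteq> {} \<and> Z \<subseteq> topspace X \<and>
     (\<forall>A B. closedin X A \<and> closedin X B \<and> Z \<subseteq> A \<union> B \<longrightarrow> Z \<subseteq> A \<or> Z \<subseteq> B)"

text \<open>The supremum of the lengths of strict chains of irreducible closed subsets. The empty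
  space gets dimension 0 instead of minus infinity; all sets measured below contain the
  origin.\<close>

definition krull_dim :: "'a topology \<Rightarrow> enat" where
  "krull_dim X = Sup {enat d |d. \<exists>Z :: nat \<Rightarrow> 'a set.
     (\<forall>k\<le>d. closedin X (Z k) \<and> irreducible_in X (Z k)) \<and> (\<forall>k<d. Z k \<subset> Z (Suc k))}"

text \<open>For finite \<open>I\<close> the dimension of a subset is at most \<open>card I\<close>, so the subtraction
  is never truncated.\<close>

definition codim :: "'i set \<Rightarrow> ('i \<Rightarrow> complex) set \<Rightarrow> enat" where
  "codim I S = enat (card I) - krull_dim (subtopology (zariski I) S)"

section \<open>Tensors and geometric rank\<close>

text \<open>The factors are labelled by a finite set \<open>F\<close> of natural numbers and taken in increasing
  order, the factor with label \<open>l\<close> being \<open>\<complex>\<close> to the power \<open>m l\<close>. Contracting factor \<open>i\<close> then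
  leaves a tensor with label set \<open>F - {i}\<close>, without renumbering. A tensor is given by its
  coordinates, a covector in the dual of a factor by its coordinates in the dual basis.\<close>

definition multi_indices :: "nat set \<Rightarrow> (nat \<Rightarrow> nat) \<Rightarrow> (nat \<Rightarrow> nat) set" where
  "multi_indices F m = (\<Pi>\<^sub>E l\<in>F. {..<m l})"

definition tensors :: "nat set \<Rightarrow> (nat \<Rightarrow> nat) \<Rightarrow> ((nat \<Rightarrow> nat) \<Rightarrow> complex) set" where
  "tensors F m = multi_indices F m \<rightarrow>\<^sub>E UNIV"

definition tensor_eval ::
  "nat set \<Rightarrow> (nat \<Rightarrow> nat) \<Rightarrow> ((nat \<Rightarrow> nat) \<Rightarrow> complex) \<Rightarrow> (nat \<Rightarrow> nat \<Rightarrow> complex) \<Rightarrow> complex" where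
  "tensor_eval F m S x = (\<Sum>j\<in>multi_indices F m. S j * (\<Prod>l\<in>F. x l (j l)))"

definition contract ::
  "nat set \<Rightarrow> (nat \<Rightarrow> nat) \<Rightarrow> nat \<Rightarrow> ((nat \<Rightarrow> nat) \<Rightarrow> complex) \<Rightarrow> (nat \<Rightarrow> complex)
    \<Rightarrow> (nat \<Rightarrow> nat) \<Rightarrow> complex" where
  "contract F m i T x = (\<lambda>j\<in>multi_indices (F - {i}) m. \<Sum>a<m i. x a * T (j(i := a)))"

text \<open>The factor in position \<open>l\<close> of the permuted tensor is the factor \<open>\<pi> l\<close> of \<open>T\<close>.\<close>

definition permute_factors ::
  "nat set \<Rightarrow> (nat \<Rightarrow> nat) \<Rightarrow> (nat \<Rightarrow> nat) \<Rightarrow> ((nat \<Rightarrow> nat) \<Rightarrow> complex)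
    \<Rightarrow> (nat \<Rightarrow> nat) \<Rightarrow> complex" where
  "permute_factors F m \<pi> T = (\<lambda>j\<in>multi_indices F (m \<circ> \<pi>). T (j \<circ> inv \<pi>))"

text \<open>A tuple of covectors, one for each label in \<open>F\<close>, is a point of the affine space with
  coordinates indexed by the pairs of a label \<open>l\<close> and a number below \<open>m l\<close>.\<close>

definition coords :: "nat set \<Rightarrow> (nat \<Rightarrow> nat) \<Rightarrow> (nat \<times> nat) set" where
  "coords F m = (SIGMA l:F. {..<m l})"

definition GR :: "nat set \<Rightarrow> (nat \<Rightarrow> nat) \<Rightarrow> ((nat \<Rightarrow> nat) \<Rightarrow> complex) \<Rightarrow> enat" where
  "GR F m S = (let k = Max F in
     codim (coords (F - {k}) m)
       {x \<in> affine_space (coords (F - {k}) m).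
          \<forall>y \<in> affine_space {..<m k}. tensor_eval F m S ((curry x)(k := y)) = 0})"

definition GR_sublevel ::
  "nat set \<Rightarrow> (nat \<Rightarrow> nat) \<Rightarrow> ((nat \<Rightarrow> nat) \<Rightarrow> complex) \<Rightarrow> nat \<Rightarrow> nat \<Rightarrow> (nat \<Rightarrow> complex) set" where
  "GR_sublevel F m T i j =
     {x \<in> affine_space {..<m i}. GR (F - {i}) m (contract F m i T x) \<le> enat j}"

end

theory Submission
  imports Defs "HOL-Computational_Algebra.Fundamental_Theorem_Algebra"
begin

text \<open>Both claims follow from one statement on the fibres of a closed set \<open>X \<subseteq> \<complex>\<^sup>A \<times> \<complex>\<^sup>B\<close>: the
  codimension of \<open>X\<close> is the minimum over \<open>j\<close> of \<open>j\<close> plus the codimension of the set of points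
  of \<open>\<complex>\<^sup>A\<close> over which the fibre has codimension at most \<open>j\<close>. Applied to the projection to one
  factor it is the formula. Applied to the projection which forgets one factor it shows that the
  omitted factor is irrelevant, since the fibres for two choices of it are the left and right
  kernels of the same matrix.

  Dimension is controlled from above by sets of coordinates that are algebraically independent on
  the given set, and from below by trees that branch infinitely in prescribed coordinates. The
  latter bound holds for arbitrary subsets, so that the sublevel sets of the fibre codimension
  need not be shown to be closed.\<close>

section \<open>Polynomial functions\<close>

text \<open>The two bounds have different ranges. The largest number of independent coordinates
  bounds the dimension of every nonempty subset from above, but only for closed sets also from
  below: the points (k, 2^(2^k)) with k natural are Zariski dense in the plane, yet each plane curve
  contains finitely many of them, so they form a space of Krull dimension 1. Semicontinuity of the
  fibre dimension would make the sublevel sets closed. Trees replace it, since in any subset each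
  level of a tree yields a strict inclusion of irreducible closed sets.

  One half of the fibre statement puts independent coordinates of the base and of the fibres
  together on \<open>X\<close>, which is closed. The other takes a tree of generic points of
  \<open>X\<close>, cuts it where the coordinates of the base end, and reads off trees in the base
  and in a fibre.

  The irrelevance of the omitted factor also enters the formula. \<open>GR\<close> omits the last
  factor, so for \<open>i = n\<close> the variety of \<open>T\<close> has no coordinates for factor
  \<open>i\<close> to project to; it is replaced by the variety which omits the last of the
  remaining factors.\<close>

lemma poly_functions_mono: "p \<in> poly_functions I \<Longrightarrow> I \<subseteq> I' \<Longrightarrow> p \<in> poly_functions I'"
  by (induction rule: poly_functions.induct) (auto intro: poly_functions.intros)

lemma poly_functions_cong:
  assumes "p \<in> poly_functions I" "\<And>i. i \<in> I \<Longrightarrow> x i = y i"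
  shows "p x = p y"
  using assms by (induction rule: poly_functions.induct) auto

lemma poly_functions_subst:
  assumes "p \<in> poly_functions L" "\<And>l. l \<in> L \<Longrightarrow> (\<lambda>x. f l x) \<in> poly_functions I"
  shows "(\<lambda>x. p (\<lambda>l. f l x)) \<in> poly_functions I"
  using assms by (induction rule: poly_functions.induct) (auto intro: poly_functions.intros)

lemma poly_functions_uminus: "p \<in> poly_functions I \<Longrightarrow> (\<lambda>x. - p x) \<in> poly_functions I"
  using poly_functions.mult[OF poly_functions.const[of "-1"]] by fastforce

lemma poly_functions_diff:
  "p \<in> poly_functions I \<Longrightarrow> q \<in> poly_functions I \<Longrightarrow> (\<lambda>x. p x - q x) \<in> poly_functions I"
  using poly_functions.add[OF _ poly_functions_uminus] by fastforce

lemma poly_functions_sum: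
  "(\<And>k. k \<in> K \<Longrightarrow> f k \<in> poly_functions I) \<Longrightarrow> (\<lambda>x. \<Sum>k\<in>K. f k x) \<in> poly_functions I"
  by (induction K rule: infinite_finite_induct) (auto intro: poly_functions.intros)

lemma poly_functions_prod:
  "(\<And>k. k \<in> K \<Longrightarrow> f k \<in> poly_functions I) \<Longrightarrow> (\<lambda>x. \<Prod>k\<in>K. f k x) \<in> poly_functions I"
  by (induction K rule: infinite_finite_induct) (auto intro: poly_functions.intros)

lemma poly_functions_power: "p \<in> poly_functions I \<Longrightarrow> (\<lambda>x. p x ^ n) \<in> poly_functions I"
  by (induction n) (auto intro: poly_functions.intros)

lemmas poly_functions_intros =
  poly_functions.intros poly_functions_uminus poly_functions_diff poly_functions_sum
  poly_functions_prod poly_functions_power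

lemma poly_functions_upd:
  assumes "p \<in> poly_functions (insert i I)"
  shows "(\<lambda>x. p (x(i := t))) \<in> poly_functions I"
proof -
  have "(\<lambda>x. if l = i then t else x l) \<in> poly_functions I" if "l \<in> insert i I" for l
    using that by (cases "l = i") (simp_all add: poly_functions.const poly_functions.coord)
  from poly_functions_subst[OF assms this] show ?thesis by (simp add: fun_upd_def)
qed

text \<open>Polynomials are bare functions, so this expansion stands in for reading \<open>p\<close>
  as a univariate polynomial in the coordinate \<open>i\<close>. The number \<open>n\<close> is only
  a degree bound: the top coefficient may be the zero function, and beyond \<open>n\<close> the
  values of \<open>P\<close> carry no information.\<close>

lemma poly_functions_expand:
  assumes "p \<in> poly_functions (insert i I)"
  shows "\<exists>P::nat \<Rightarrow> ('i \<Rightarrow> complex) \<Rightarrow> complex. \<exists>n.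
    (\<forall>k. P k \<in> poly_functions I) \<and> (\<forall>x. p x = (\<Sum>k\<le>n. P k x * x i ^ k))"
  using assms
proof (induction rule: poly_functions.induct)
  case (const c)
  then show ?case
    by (intro exI[of _ "\<lambda>_ _. c"] exI[of _ 0]) (auto intro: poly_functions.intros)
next
  case (coord j)
  show ?case
  proof (cases "j = i")
    case True
    then show ?thesis
      by (intro exI[of _ "\<lambda>k _. if k = 0 then 0 else 1"] exI[of _ 1])
        (auto intro: poly_functions.intros)
  next
    case False
    then show ?thesis using coord
      by (intro exI[of _ "\<lambda>k x. x j"] exI[of _ 0]) (auto intro: poly_functions.intros)
  qed
next
  case (add p q)
  then obtain P n Q l where P: "\<forall>k. P k \<in> poly_functions I" "\<forall>x. p x = (\<Sum>k\<le>n. P k x * x i ^ k)"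
    and Q: "\<forall>k. Q k \<in> poly_functions I" "\<forall>x. q x = (\<Sum>k\<le>l. Q k x * x i ^ k)" by blast
  let ?R = "\<lambda>k x. (if k \<le> n then P k x else 0) + (if k \<le> l then Q k x else 0)"
  have "p x + q x = (\<Sum>k\<le>n + l. ?R k x * x i ^ k)" for x
  proof -
    have "p x = (\<Sum>k\<le>n + l. (if k \<le> n then P k x else 0) * x i ^ k)"
      unfolding P(2)[rule_format] by (rule sum.mono_neutral_cong_left) auto
    moreover have "q x = (\<Sum>k\<le>n + l. (if k \<le> l then Q k x else 0) * x i ^ k)"
      unfolding Q(2)[rule_format] by (rule sum.mono_neutral_cong_left) auto
    ultimately show ?thesis by (simp add: distrib_right sum.distrib)
  qed
  moreover have "?R k \<in> poly_functions I" for k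
    using P(1) Q(1) poly_functions.const[of 0 I]
    by (cases "k \<le> n"; cases "k \<le> l") (auto intro!: poly_functions.intros)
  ultimately show ?case by (intro exI[of _ ?R] exI[of _ "n + l"]) blast
next
  case (mult p q)
  then obtain P n Q l where P: "\<forall>k. P k \<in> poly_functions I" "\<forall>x. p x = (\<Sum>k\<le>n. P k x * x i ^ k)"
    and Q: "\<forall>k. Q k \<in> poly_functions I" "\<forall>x. q x = (\<Sum>k\<le>l. Q k x * x i ^ k)" by blast
  let ?R = "\<lambda>k x. \<Sum>(a,b)\<in>{(a,b). a \<le> n \<and> b \<le> l \<and> a + b = k}. P a x * Q b x"
  have fin: "finite {(a,b). a \<le> n \<and> b \<le> l \<and> R a b}" for R
    by (rule finite_subset[of _ "{..n} \<times> {..l}"]) auto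
  have "p x * q x = (\<Sum>k\<le>n + l. ?R k x * x i ^ k)" for x
  proof -
    have "p x * q x = (\<Sum>(a,b)\<in>{..n} \<times> {..l}. P a x * Q b x * x i ^ (a + b))"
      unfolding P(2)[rule_format] Q(2)[rule_format]
      by (simp add: sum_product sum.cartesian_product power_add algebra_simps)
    also have "\<dots> = (\<Sum>k\<le>n + l. \<Sum>(a,b)\<in>{ab \<in> {..n} \<times> {..l}. fst ab + snd ab = k}.
         P a x * Q b x * x i ^ (a + b))"
      by (rule sum.group[symmetric]) auto
    also have "\<dots> = (\<Sum>k\<le>n + l. ?R k x * x i ^ k)"
      unfolding sum_distrib_right
      by (intro sum.cong) auto
    finally show ?thesis .
  qed
  moreover have "?R k \<in> poly_functions I" for k
    using P(1) Q(1) by (auto intro!: poly_functions_intros simp: case_prod_beta)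
  ultimately show ?case by (intro exI[of _ ?R] exI[of _ "n + l"]) blast
qed

lemma poly_functions_line:
  assumes "p \<in> poly_functions I"
  shows "\<exists>P. \<forall>t. poly P t = p (\<lambda>i. u i + t * w i)"
  using assms
proof (induction rule: poly_functions.induct)
  case (const c)
  show ?case by (intro exI[of _ "[:c:]"]) simp
next
  case (coord i)
  show ?case by (intro exI[of _ "[:u i, w i:]"]) simp
next
  case (add p q)
  then obtain P Q where "\<forall>t. poly P t = p (\<lambda>i. u i + t * w i)" "\<forall>t. poly Q t = q (\<lambda>i. u i + t * w i)"
    by (elim exE)
  then show ?case by (intro exI[of _ "P + Q"]) simp
next
  case (mult p q)
  then obtain P Q where "\<forall>t. poly P t = p (\<lambda>i. u i + t * w i)" "\<forall>t. poly Q t = q (\<lambda>i. u i + t * w i)"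
    by (elim exE)
  then show ?case by (intro exI[of _ "P * Q"]) simp
qed

lemma poly_functions_line_finite:
  assumes "p \<in> poly_functions I" "p (\<lambda>i. u i + s * w i) \<noteq> 0"
  shows "finite {t. p (\<lambda>i. u i + t * w i) = 0}"
proof -
  obtain P where P: "\<forall>t. poly P t = p (\<lambda>i. u i + t * w i)"
    using poly_functions_line[OF assms(1)] by (rule exE)
  have "P \<noteq> 0" using assms(2) P[rule_format, of s] by auto
  then show ?thesis using poly_roots_finite[of P] by (simp add: P)
qed

text \<open>Neither function is identically zero on the line through \<open>u\<close> and
  \<open>v\<close>, so each has finitely many roots there and some point of the line avoids both. In
  other words, polynomial functions form an integral domain.\<close>

lemma poly_functions_mult_nonzero:
  assumes "p \<in> poly_functions I" "q \<in> poly_functions I" "p u \<noteq> 0" "q v \<noteq> 0"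
  shows "\<exists>x. p x \<noteq> 0 \<and> q x \<noteq> 0"
proof -
  let ?l = "\<lambda>t i. u i + t * (v i - u i)"
  have "finite {t. p (?l t) = 0}" "finite {t. q (?l t) = 0}"
    using poly_functions_line_finite[OF assms(1), of u 0 "\<lambda>i. v i - u i"]
      poly_functions_line_finite[OF assms(2), of u 1 "\<lambda>i. v i - u i"] assms(3,4) by auto
  then have "finite ({t. p (?l t) = 0} \<union> {t. q (?l t) = 0})" by blast
  from ex_new_if_finite[OF infinite_UNIV_char_0 this]
  obtain t where "t \<notin> {t. p (?l t) = 0} \<union> {t. q (?l t) = 0}" by (rule exE)
  then have "p (?l t) \<noteq> 0 \<and> q (?l t) \<noteq> 0" by simp
  then show ?thesis by (rule exI[of _ "?l t"])
qed

text \<open>The line in direction \<open>i\<close> is based at \<open>u(i := 0)\<close>, which makes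
  its parameter the value of the coordinate itself. These values supply the branches of the trees of
  generic points in \<open>branchingI_generic\<close>.\<close>

lemma poly_functions_upd_infinite:
  assumes "p \<in> poly_functions I" "p u \<noteq> 0"
  shows "infinite {t. p (u(i := t)) \<noteq> 0}"
proof -
  define w :: "'a \<Rightarrow> complex" where "w j = (if j = i then 1 else 0)" for j
  have l: "(\<lambda>j. (u(i := 0)) j + t * w j) = u(i := t)" for t by (auto simp: w_def)
  have "finite {t. p (u(i := t)) = 0}"
    using poly_functions_line_finite[OF assms(1), of "u(i := 0)" "u i" w] assms(2) unfolding l by simp
  then have "infinite (- {t. p (u(i := t)) = 0})"
    by (simp add: Compl_eq_Diff_UNIV infinite_UNIV_char_0)
  then show ?thesis by (simp add: Collect_neg_eq)
qed

section \<open>Algebraic independence and the transcendence degree\<close>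

text \<open>Geometrically, the projection of \<open>Z\<close> to the coordinates in \<open>J\<close>
  is Zariski dense. The point \<open>x\<close> may be any function, since \<open>p\<close> depends
  only on its values on \<open>J\<close>.\<close>

definition alg_indep :: "'i set \<Rightarrow> ('i \<Rightarrow> complex) set \<Rightarrow> bool" where
  "alg_indep J Z \<longleftrightarrow> (\<forall>p\<in>poly_functions J. (\<forall>z\<in>Z. p z = 0) \<longrightarrow> (\<forall>x. p x = 0))"

text \<open>The vanishing ideal of \<open>Z\<close> is prime. This is the form in which
  irreducibility is used, namely as cancellation in the ring of functions on
  \<open>Z\<close>.\<close>

definition poly_irreducible :: "'i set \<Rightarrow> ('i \<Rightarrow> complex) set \<Rightarrow> bool" where
  "poly_irreducible I Z \<longleftrightarrow> Z \<noteq> {} \<and> (\<forall>p\<in>poly_functions I. \<forall>q\<in>poly_functions I.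
     (\<forall>z\<in>Z. p z * q z = 0) \<longrightarrow> (\<forall>z\<in>Z. p z = 0) \<or> (\<forall>z\<in>Z. q z = 0))"

lemma alg_indepI:
  "(\<And>p x. p \<in> poly_functions J \<Longrightarrow> (\<And>z. z \<in> Z \<Longrightarrow> p z = 0) \<Longrightarrow> p x = 0) \<Longrightarrow> alg_indep J Z"
  by (simp add: alg_indep_def)

lemma alg_indepD:
  "alg_indep J Z \<Longrightarrow> p \<in> poly_functions J \<Longrightarrow> (\<And>z. z \<in> Z \<Longrightarrow> p z = 0) \<Longrightarrow> p x = 0"
  by (simp add: alg_indep_def)

lemma not_alg_indepE:
  assumes "\<not> alg_indep J Z"
  obtains p x where "p \<in> poly_functions J" "\<forall>z\<in>Z. p z = 0" "p x \<noteq> 0"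
proof -
  have "\<exists>p\<in>poly_functions J. (\<forall>z\<in>Z. p z = 0) \<and> (\<exists>x. p x \<noteq> 0)"
    using assms by (simp add: alg_indep_def)
  then show thesis using that by (elim bexE conjE exE) simp
qed

lemma alg_indep_mono:
  assumes "alg_indep J Z" "J' \<subseteq> J" "Z \<subseteq> Z'"
  shows "alg_indep J' Z'"
proof (rule alg_indepI)
  fix p x assume p: "p \<in> poly_functions J'" "\<And>z. z \<in> Z' \<Longrightarrow> p z = 0"
  show "p x = 0"
    using alg_indepD[OF assms(1) poly_functions_mono[OF p(1) assms(2)]] p(2) assms(3) by (meson subsetD)
qed

text \<open>Relations on the two parts multiply to a relation on the union, which is nonzero because
  polynomial functions form a domain. This serves to pass from a set to one member of a finite
  cover, or to an irreducible closed subset.\<close>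

lemma alg_indep_Un:
  assumes "alg_indep J (Z1 \<union> Z2)" shows "alg_indep J Z1 \<or> alg_indep J Z2"
proof (rule ccontr)
  assume "\<not> ?thesis"
  then have n: "\<not> alg_indep J Z1" "\<not> alg_indep J Z2" by simp_all
  obtain p u where p: "p \<in> poly_functions J" "\<forall>z\<in>Z1. p z = 0" "p u \<noteq> 0"
    using n(1) by (rule not_alg_indepE)
  obtain q v where q: "q \<in> poly_functions J" "\<forall>z\<in>Z2. q z = 0" "q v \<noteq> 0"
    using n(2) by (rule not_alg_indepE)
  obtain x where x: "p x \<noteq> 0" "q x \<noteq> 0"
    using poly_functions_mult_nonzero[OF p(1) q(1), OF p(3) q(3)] by (elim exE conjE)
  have "p z * q z = 0" if "z \<in> Z1 \<union> Z2" for z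
    using that p(2) q(2) by auto
  with alg_indepD[OF assms poly_functions.mult[OF p(1) q(1)], of x] have "p x * q x = 0" by simp
  then show False using x by simp
qed

lemma poly_irreducible_nonempty: "poly_irreducible I Z \<Longrightarrow> Z \<noteq> {}"
  by (simp add: poly_irreducible_def)

lemma poly_irreducibleD:
  "poly_irreducible I Z \<Longrightarrow> p \<in> poly_functions I \<Longrightarrow> q \<in> poly_functions I \<Longrightarrow>
    (\<And>z. z \<in> Z \<Longrightarrow> p z * q z = 0) \<Longrightarrow> (\<forall>z\<in>Z. p z = 0) \<or> (\<forall>z\<in>Z. q z = 0)"
  by (simp add: poly_irreducible_def)

lemma poly_irreducibleI:
  "Z \<noteq> {} \<Longrightarrow> (\<And>p q. p \<in> poly_functions I \<Longrightarrow> q \<in> poly_functions I \<Longrightarrow>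
    (\<And>z. z \<in> Z \<Longrightarrow> p z * q z = 0) \<Longrightarrow> (\<forall>z\<in>Z. p z = 0) \<or> (\<forall>z\<in>Z. q z = 0)) \<Longrightarrow> poly_irreducible I Z"
  by (simp add: poly_irreducible_def)

lemma poly_irreducible_mono:
  assumes "poly_irreducible I Z" "I' \<subseteq> I" shows "poly_irreducible I' Z"
proof (rule poly_irreducibleI)
  show "Z \<noteq> {}" using assms(1) by (rule poly_irreducible_nonempty)
  fix p q assume pq: "p \<in> poly_functions I'" "q \<in> poly_functions I'" "\<And>z. z \<in> Z \<Longrightarrow> p z * q z = 0"
  then show "(\<forall>z\<in>Z. p z = 0) \<or> (\<forall>z\<in>Z. q z = 0)"
    using poly_irreducibleD[OF assms(1), of p q] poly_functions_mono[OF _ assms(2)] by simp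
qed

lemma poly_irreducible_cancel:
  assumes "poly_irreducible I Z" "p \<in> poly_functions I" "q \<in> poly_functions I"
    "\<not> (\<forall>z\<in>Z. p z = 0)" "\<And>z. z \<in> Z \<Longrightarrow> p z * q z = 0"
  shows "\<forall>z\<in>Z. q z = 0"
  using poly_irreducibleD[OF assms(1) assms(2) assms(3)] assms(4,5) by simp

lemma poly_irreducible_prod:
  assumes Z: "poly_irreducible I Z" and K: "finite K"
    and "\<And>k. k \<in> K \<Longrightarrow> f k \<in> poly_functions I" "\<And>k. k \<in> K \<Longrightarrow> \<not> (\<forall>z\<in>Z. f k z = 0)"
  shows "\<not> (\<forall>z\<in>Z. (\<Prod>k\<in>K. f k z) = 0)"
  using K assms(3,4)
proof (induction K rule: finite_induct)
  case empty
  have "Z \<noteq> {}" using Z unfolding poly_irreducible_def by (rule conjunct1)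
  then show ?case by auto
next
  case (insert k K)
  show ?case
  proof
    assume *: "\<forall>z\<in>Z. (\<Prod>k\<in>insert k K. f k z) = 0"
    have "\<forall>z\<in>Z. (\<Prod>k\<in>K. f k z) = 0"
    proof (rule poly_irreducible_cancel[OF Z, of "f k"])
      show "(\<lambda>z. \<Prod>k\<in>K. f k z) \<in> poly_functions I"
        by (rule poly_functions_prod) (simp add: insert.prems)
      show "f k z * (\<Prod>k\<in>K. f k z) = 0" if "z \<in> Z" for z
        using * that insert(1,2) by simp
    qed (use insert.prems in simp_all)
    then show False using insert.IH insert.prems by simp
  qed
qed

lemma poly_irreducible_power:
  assumes "poly_irreducible I Z" "f \<in> poly_functions I" "\<not> (\<forall>z\<in>Z. f z = 0)"
  shows "\<not> (\<forall>z\<in>Z. f z ^ n = 0)"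
proof -
  have "\<not> (\<forall>z\<in>Z. (\<Prod>k<n. f z) = 0)"
    by (rule poly_irreducible_prod[OF assms(1)]) (use assms(2,3) in simp_all)
  then show ?thesis by simp
qed

text \<open>Gaussian elimination: the pivot row \<open>a0\<close> clears column \<open>b\<close> in
  the other rows, and its own coefficient is then determined by that column.\<close>

lemma linear_dependence:
  fixes M :: "'a \<Rightarrow> 'b \<Rightarrow> complex"
  assumes "finite B" "finite A" "card B < card A"
  shows "\<exists>c. (\<exists>a\<in>A. c a \<noteq> 0) \<and> (\<forall>b\<in>B. (\<Sum>a\<in>A. c a * M a b) = 0)"
  using assms
proof (induction B arbitrary: A M rule: finite_induct)
  case empty
  then have "A \<noteq> {}" by auto
  then show ?case by (intro exI[of _ "\<lambda>_. 1"]) auto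
next
  case (insert b B)
  show ?case
  proof (cases "\<forall>a\<in>A. M a b = 0")
    case True
    obtain c where "\<exists>a\<in>A. c a \<noteq> 0" "\<forall>b\<in>B. (\<Sum>a\<in>A. c a * M a b) = 0"
      using insert.IH[of A M] insert.prems insert.hyps by auto
    then show ?thesis using True by (intro exI[of _ c]) simp
  next
    case False
    then obtain a0 where a0: "a0 \<in> A" "M a0 b \<noteq> 0" by blast
    let ?A = "A - {a0}"
    let ?M = "\<lambda>a b'. M a b' - M a b / M a0 b * M a0 b'"
    obtain c where c: "\<exists>a\<in>?A. c a \<noteq> 0" "\<forall>b\<in>B. (\<Sum>a\<in>?A. c a * ?M a b) = 0"
    proof -
      have "card B < card ?A" using insert.prems insert.hyps a0(1) by simp
      from insert.IH[of ?A ?M, OF _ this] insert.prems(1)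
      have "\<exists>c. (\<exists>a\<in>?A. c a \<noteq> 0) \<and> (\<forall>b\<in>B. (\<Sum>a\<in>?A. c a * ?M a b) = 0)" by blast
      then show thesis using that by (elim exE conjE)
    qed
    let ?s = "\<Sum>a\<in>?A. c a * M a b / M a0 b"
    let ?c = "c(a0 := - ?s)"
    have eq: "(\<Sum>a\<in>A. ?c a * M a b') = (\<Sum>a\<in>?A. c a * ?M a b')" for b'
    proof -
      have "(\<Sum>a\<in>A. ?c a * M a b') = - ?s * M a0 b' + (\<Sum>a\<in>?A. ?c a * M a b')"
        using sum.remove[OF insert.prems(1) a0(1), of "\<lambda>a. ?c a * M a b'"] by simp
      also have "(\<Sum>a\<in>?A. ?c a * M a b') = (\<Sum>a\<in>?A. c a * M a b')"
        by (intro sum.cong) auto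
      also have "- ?s * M a0 b' = - (\<Sum>a\<in>?A. c a * (M a b / M a0 b * M a0 b'))"
        by (simp add: sum_distrib_right mult.assoc)
      finally show ?thesis by (simp add: right_diff_distrib sum_subtractf)
    qed
    have "\<exists>a\<in>A. ?c a \<noteq> 0" using c(1) by auto
    moreover have "(\<Sum>a\<in>A. ?c a * M a b) = 0" unfolding eq using a0(2) by simp
    ultimately show ?thesis using c(2) eq by (intro exI[of _ ?c]) auto
  qed
qed

text \<open>The degree is cut down until the top coefficient is a nonzero polynomial. It stays
  positive, because a relation of degree 0 would be a relation among the coordinates in
  \<open>J\<close> alone.\<close>

lemma algebraic_relation:
  assumes J: "alg_indep J Z" and i: "\<not> alg_indep (insert i J) Z"
  shows "\<exists>c n u. n > (0::nat) \<and> (\<forall>k. c k \<in> poly_functions J) \<and> c n u \<noteq> 0 \<and>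
    (\<forall>z\<in>Z. (\<Sum>k\<le>n. c k z * z i ^ k) = 0)"
proof -
  obtain p x where p: "p \<in> poly_functions (insert i J)" "\<forall>z\<in>Z. p z = 0" "p x \<noteq> 0"
    using i by (rule not_alg_indepE)
  obtain c n where c: "\<forall>k. c k \<in> poly_functions J" "\<forall>x. p x = (\<Sum>k\<le>n. c k x * x i ^ k)"
    using poly_functions_expand[OF p(1)] by (elim exE conjE)
  define m where "m = Max {k. k \<le> n \<and> (\<exists>u. c k u \<noteq> 0)}"
  have "\<exists>k\<le>n. c k x \<noteq> 0"
  proof (rule ccontr)
    assume "\<not> ?thesis"
    then have "p x = 0" using c(2) by simp
    then show False using p(3) by simp
  qed
  then have ne: "{k. k \<le> n \<and> (\<exists>u. c k u \<noteq> 0)} \<noteq> {}" by auto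
  have fin: "finite {k. k \<le> n \<and> (\<exists>u. c k u \<noteq> 0)}" by simp
  have "m \<in> {k. k \<le> n \<and> (\<exists>u. c k u \<noteq> 0)}" unfolding m_def by (rule Max_in[OF fin ne])
  then obtain u where u: "c m u \<noteq> 0" and m: "m \<le> n" by auto
  have above: "c k v = 0" if "k \<le> n" "m < k" for k v
  proof (rule ccontr)
    assume "c k v \<noteq> 0"
    then have "k \<le> m" unfolding m_def using that(1) by (intro Max_ge[OF fin]) auto
    then show False using that(2) by simp
  qed
  have rel: "(\<Sum>k\<le>m. c k z * z i ^ k) = 0" if "z \<in> Z" for z
  proof -
    have "(\<Sum>k\<le>m. c k z * z i ^ k) = (\<Sum>k\<le>n. c k z * z i ^ k)"
      by (rule sum.mono_neutral_left) (use m above in auto)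
    then show ?thesis using p(2) c(2) that by simp
  qed
  have "m > 0"
  proof (rule ccontr)
    assume "\<not> m > 0"
    then have "c m z = 0" if "z \<in> Z" for z using rel[OF that] by simp
    then have "c m u = 0" using alg_indepD[OF J, of "c m" u] c(1) by simp
    then show False using u by simp
  qed
  then show ?thesis using c(1) u rel by (intro exI[of _ c] exI[of _ m] exI[of _ u]) simp
qed

text \<open>\<open>J\<close> is a transcendence basis of the function field of \<open>Z\<close>, chosen among the
  coordinates.\<close>

locale coord_basis =
  fixes I J :: "'i set" and Z :: "('i \<Rightarrow> complex) set"
  assumes fin: "finite I" and sub: "J \<subseteq> I" and irr: "poly_irreducible I Z"
    and indep: "alg_indep J Z"
    and max: "\<And>i. i \<in> I - J \<Longrightarrow> \<not> alg_indep (insert i J) Z"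
begin

lemma finJ: "finite J"
  using fin sub by (rule finite_subset[rotated])

lemma indep_not_vanishing:
  assumes "p \<in> poly_functions J" "p u \<noteq> 0" shows "\<not> (\<forall>z\<in>Z. p z = 0)"
  using alg_indepD[OF indep assms(1), of u] assms(2) by auto

text \<open>One polynomial \<open>p\<close> and one degree \<open>n\<close> serve for all
  coordinates outside \<open>J\<close>: once \<open>p\<close> is inverted, these are integral over
  the coordinates in \<open>J\<close>. Here \<open>p\<close> is the product of all leading
  coefficients; each relation is multiplied by the missing ones and shifted up to degree
  \<open>n\<close>.\<close>

lemma common_relation:
  "\<exists>p u n c. p \<in> poly_functions J \<and> p u \<noteq> 0 \<and> n > (0::nat) \<and>
    (\<forall>i\<in>I - J. \<forall>k. c i k \<in> poly_functions J) \<and>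
    (\<forall>i\<in>I - J. \<forall>z\<in>Z. p z * z i ^ n = (\<Sum>k<n. c i k z * z i ^ k))"
proof -
  have "\<exists>c n u. n > 0 \<and> (\<forall>k. c k \<in> poly_functions J) \<and> c n u \<noteq> 0 \<and>
      (\<forall>z\<in>Z. (\<Sum>k\<le>n. c k z * z i ^ k) = 0)" if i: "i \<in> I - J" for i
    using algebraic_relation[OF indep max[OF i]] .
  then have "\<forall>i\<in>I - J. \<exists>c n u. n > 0 \<and> (\<forall>k. c k \<in> poly_functions J) \<and> c n u \<noteq> 0 \<and>
      (\<forall>z\<in>Z. (\<Sum>k\<le>n. c k z * z i ^ k) = 0)" by simp
  then obtain c where "\<forall>i\<in>I - J. \<exists>n u. n > 0 \<and> (\<forall>k. c i k \<in> poly_functions J) \<and> c i n u \<noteq> 0 \<and>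
      (\<forall>z\<in>Z. (\<Sum>k\<le>n. c i k z * z i ^ k) = 0)" by (rule bchoice[THEN exE])
  then obtain m where "\<forall>i\<in>I - J. \<exists>u. m i > 0 \<and> (\<forall>k. c i k \<in> poly_functions J) \<and> c i (m i) u \<noteq> 0 \<and>
      (\<forall>z\<in>Z. (\<Sum>k\<le>m i. c i k z * z i ^ k) = 0)" by (rule bchoice[THEN exE])
  then obtain v where "\<forall>i\<in>I - J. m i > 0 \<and> (\<forall>k. c i k \<in> poly_functions J) \<and> c i (m i) (v i) \<noteq> 0 \<and>
      (\<forall>z\<in>Z. (\<Sum>k\<le>m i. c i k z * z i ^ k) = 0)" by (rule bchoice[THEN exE])
  then have c: "c i k \<in> poly_functions J" "c i (m i) (v i) \<noteq> 0"
      "z \<in> Z \<Longrightarrow> (\<Sum>k\<le>m i. c i k z * z i ^ k) = 0" if "i \<in> I - J" for i k z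
    using that by simp_all
  define n where "n = Suc (\<Sum>i\<in>I - J. m i)"
  have finIJ: "finite (I - J)" using fin by simp
  have mn: "m i \<le> n" if "i \<in> I - J" for i
    unfolding n_def using member_le_sum[OF that _ finIJ, of m] by simp
  define p where "p = (\<lambda>z. \<Prod>i\<in>I - J. c i (m i) z)"
  define q where "q i = (\<lambda>z. \<Prod>j\<in>I - J - {i}. c j (m j) z)" for i
  \<comment> \<open>The relation for \<open>i\<close>, solved for its top term, times
    \<open>q i\<close> and the power \<open>n - m i\<close> of the coordinate; the shift makes the
    coefficients below \<open>n - m i\<close> zero.\<close>
  define d where "d i k = (\<lambda>z. if k < n - m i then 0 else - q i z * c i (k - (n - m i)) z)" for i k
  have "\<not> (\<forall>z\<in>Z. p z = 0)" unfolding p_def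
  proof (rule poly_irreducible_prod[OF irr finIJ])
    fix i assume i: "i \<in> I - J"
    show "c i (m i) \<in> poly_functions I" using c(1)[OF i] sub by (rule poly_functions_mono)
    show "\<not> (\<forall>z\<in>Z. c i (m i) z = 0)" using c(1)[OF i] c(2)[OF i] by (rule indep_not_vanishing)
  qed
  then obtain u where u: "p u \<noteq> 0" by blast
  have p: "p \<in> poly_functions J" unfolding p_def by (rule poly_functions_prod) (rule c(1))
  have q: "q i \<in> poly_functions J" for i unfolding q_def by (rule poly_functions_prod) (simp add: c(1))
  have d: "d i k \<in> poly_functions J" if "i \<in> I - J" for i k
  proof (cases "k < n - m i")
    case True
    then show ?thesis by (simp add: d_def poly_functions.const)
  next
    case False
    then show ?thesis using q[of i] c(1)[OF that]
      by (simp add: d_def) (intro poly_functions_intros)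
  qed
  have rel: "p z * z i ^ n = (\<Sum>k<n. d i k z * z i ^ k)" if i: "i \<in> I - J" and z: "z \<in> Z" for i z
  proof -
    have "(\<Sum>k\<le>m i. c i k z * z i ^ k) = (\<Sum>k<m i. c i k z * z i ^ k) + c i (m i) z * z i ^ m i"
      by (simp add: lessThan_Suc_atMost[symmetric])
    then have e: "c i (m i) z * z i ^ m i = - (\<Sum>k<m i. c i k z * z i ^ k)"
      using c(3)[OF i z] by (simp add: eq_neg_iff_add_eq_0 add.commute)
    have "p z = c i (m i) z * q i z"
      unfolding p_def q_def using prod.remove[OF finIJ i] by simp
    moreover have "z i ^ n = z i ^ m i * z i ^ (n - m i)"
      using mn[OF i] by (simp add: power_add[symmetric])
    ultimately have "p z * z i ^ n = q i z * z i ^ (n - m i) * (c i (m i) z * z i ^ m i)" by simp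
    also have "\<dots> = (\<Sum>k<m i. - q i z * c i k z * z i ^ (k + (n - m i)))"
      unfolding e by (simp add: sum_distrib_left sum_negf power_add algebra_simps)
    also have "\<dots> = (\<Sum>k\<in>{n - m i..<n}. d i k z * z i ^ k)"
      by (rule sum.reindex_bij_witness[of _ "\<lambda>k. k - (n - m i)" "\<lambda>k. k + (n - m i)"])
        (use mn[OF i] in \<open>auto simp: d_def\<close>)
    also have "\<dots> = (\<Sum>k<n. d i k z * z i ^ k)"
      by (rule sum.mono_neutral_left) (auto simp: d_def)
    finally show ?thesis .
  qed
  have n: "n > 0" by (simp add: n_def)
  have d': "\<forall>i\<in>I - J. \<forall>k. d i k \<in> poly_functions J"
    by (intro ballI allI d)
  have rel': "\<forall>i\<in>I - J. \<forall>z\<in>Z. p z * z i ^ n = (\<Sum>k<n. d i k z * z i ^ k)"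
    by (intro ballI rel)
  show ?thesis
    by (rule exI[of _ p], rule exI[of _ u], rule exI[of _ n], rule exI[of _ d], intro conjI p u n d' rel')
qed

text \<open>After multiplication by a power of a fixed polynomial in the basis coordinates, every
  polynomial function on \<open>Z\<close> lies in one of finitely generated spaces whose dimension grows
  like the \<open>card J\<close>-th power of the degree. Products of more than \<open>card J\<close> polynomials are too
  many to be linearly independent in them.\<close>

lemma poly_functions_dependent:
  fixes f :: "'l \<Rightarrow> ('i \<Rightarrow> complex) \<Rightarrow> complex"
  assumes L: "finite L" "card J < card L" and f: "\<And>l. l \<in> L \<Longrightarrow> f l \<in> poly_functions I"
  shows "\<exists>q\<in>poly_functions L. (\<exists>v. q v \<noteq> 0) \<and> (\<forall>z\<in>Z. q (\<lambda>l. f l z) = 0)"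
proof -
  obtain p u n c where p: "p \<in> poly_functions J" "p u \<noteq> 0" and n: "n > 0"
    and c': "\<forall>i\<in>I - J. \<forall>k. c i k \<in> poly_functions J"
    and rel': "\<forall>i\<in>I - J. \<forall>z\<in>Z. p z * z i ^ n = (\<Sum>k<n. c i k z * z i ^ k)"
    using common_relation by (elim exE conjE)
  note c = c'[rule_format] and rel = rel'[rule_format]
  \<comment> \<open>Exponents of reduced monomials: at most \<open>M\<close> for the free
    coordinates in \<open>J\<close>, and below \<open>n\<close> for the others, whose
    \<open>n\<close>-th powers can be rewritten once a factor \<open>p\<close> is available.
    \<open>W M\<close> is the span of these monomials as functions on \<open>Z\<close>.\<close>
  define G where "G M = (J \<rightarrow>\<^sub>E {..M}) \<times> (I - J \<rightarrow>\<^sub>E {..<n})" for M :: nat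
  define mon where "mon g z = (\<Prod>j\<in>J. z j ^ fst g j) * (\<Prod>i\<in>I - J. z i ^ snd g i)"
    for g :: "('i \<Rightarrow> nat) \<times> ('i \<Rightarrow> nat)" and z :: "'i \<Rightarrow> complex"
  define W where "W M = {F. \<exists>d. \<forall>z\<in>Z. F z = (\<Sum>g\<in>G M. d g * mon g z)}" for M
  have finIJ: "finite (I - J)" using fin by simp
  have finG: "finite (G M)" for M
    unfolding G_def using finJ finIJ by (intro finite_cartesian_product finite_PiE) auto
  have WE: "\<exists>d. \<forall>z\<in>Z. F z = (\<Sum>g\<in>G M. d g * mon g z)" if "F \<in> W M" for F M
    using that by (simp add: W_def)
  have W_cong: "F' \<in> W M" if "F \<in> W M" "\<And>z. z \<in> Z \<Longrightarrow> F' z = F z" for F F' M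
    using that unfolding W_def by simp
  have W_zero: "(\<lambda>_. 0) \<in> W M" for M
    unfolding W_def by (auto intro!: exI[of _ "\<lambda>_. 0"])
  have W_add: "(\<lambda>z. F z + F' z) \<in> W M" if F: "F \<in> W M" "F' \<in> W M" for F F' M
  proof -
    obtain d d' where "\<forall>z\<in>Z. F z = (\<Sum>g\<in>G M. d g * mon g z)" "\<forall>z\<in>Z. F' z = (\<Sum>g\<in>G M. d' g * mon g z)"
      using WE[OF F(1)] WE[OF F(2)] by (elim exE)
    then show ?thesis unfolding W_def
      by (auto intro!: exI[of _ "\<lambda>g. d g + d' g"] simp: distrib_right sum.distrib)
  qed
  have W_scale: "(\<lambda>z. a * F z) \<in> W M" if F: "F \<in> W M" for F M a
  proof -
    obtain d where "\<forall>z\<in>Z. F z = (\<Sum>g\<in>G M. d g * mon g z)"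
      using WE[OF F] by (rule exE)
    then show ?thesis unfolding W_def
      by (auto intro!: exI[of _ "\<lambda>g. a * d g"] simp: sum_distrib_left mult.assoc)
  qed
  have W_sum: "(\<lambda>z. \<Sum>k\<in>K. F k z) \<in> W M" if "\<And>k. k \<in> K \<Longrightarrow> F k \<in> W M" for F M and K :: "'k set"
    using that by (induction K rule: infinite_finite_induct) (simp_all add: W_zero W_add)
  have W_gen: "mon g \<in> W M" if "g \<in> G M" for g M
  proof -
    have "mon g z = (\<Sum>h\<in>G M. (if h = g then 1 else 0) * mon h z)" for z
      using that finG[of M] by (simp add: if_distrib[of "\<lambda>x. x * _"] cong: if_cong)
    then show ?thesis unfolding W_def by (auto intro!: exI[of _ "\<lambda>h. if h = g then 1 else 0"])
  qed
  have G_mono: "G M \<subseteq> G M'" if "M \<le> M'" for M M'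
    unfolding G_def using that by (intro Sigma_mono PiE_mono) auto
  have W_lin: "F \<in> W M'" if F: "F \<in> W M" and "\<And>g. g \<in> G M \<Longrightarrow> mon g \<in> W M'" for F M M'
  proof -
    obtain d where d: "\<forall>z\<in>Z. F z = (\<Sum>g\<in>G M. d g * mon g z)"
      using WE[OF F] by (rule exE)
    have "(\<lambda>z. \<Sum>g\<in>G M. d g * mon g z) \<in> W M'"
      by (intro W_sum W_scale that(2))
    then show ?thesis by (rule W_cong) (simp add: d)
  qed
  have W_mono: "F \<in> W M'" if "F \<in> W M" "M \<le> M'" for F M M'
    by (rule W_lin[OF that(1)], rule W_gen) (use G_mono[OF that(2)] in blast)
  \<comment> \<open>Multiplication by \<open>h\<close> raises the bound on the free exponents by at
    most \<open>E\<close>. The number \<open>E\<close> plays the part of a degree: it adds up in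
    products and, crudely, also in sums.\<close>
  define Op where "Op E h \<longleftrightarrow> (\<forall>M. \<forall>F\<in>W M. (\<lambda>z. h z * F z) \<in> W (M + E))"
    for E and h :: "('i \<Rightarrow> complex) \<Rightarrow> complex"
  have OpD: "(\<lambda>z. h z * F z) \<in> W (M + E)" if "Op E h" "F \<in> W M" for E h F M
    using that unfolding Op_def by simp
  have Op_mono: "Op E' h" if "Op E h" "E \<le> E'" for E E' h
    unfolding Op_def using W_mono[OF OpD[OF that(1)]] that(2) by simp
  have Op_gen: "Op E h" if h: "\<And>M g. g \<in> G M \<Longrightarrow> (\<lambda>z. h z * mon g z) \<in> W (M + E)" for E h
    unfolding Op_def
  proof (intro allI ballI)
    fix M F assume "F \<in> W M"
    from WE[OF this] obtain d where d: "\<forall>z\<in>Z. F z = (\<Sum>g\<in>G M. d g * mon g z)"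
      by (rule exE)
    have "(\<lambda>z. \<Sum>g\<in>G M. d g * (h z * mon g z)) \<in> W (M + E)"
      by (intro W_sum W_scale h)
    then show "(\<lambda>z. h z * F z) \<in> W (M + E)"
      by (rule W_cong) (use d in \<open>simp add: sum_distrib_left algebra_simps\<close>)
  qed
  have Op_const: "Op 0 (\<lambda>_. a)" for a
    unfolding Op_def by (simp add: W_scale)
  have Op_add: "Op (E + E') (\<lambda>z. h z + h' z)" if "Op E h" "Op E' h'" for E E' h h'
    unfolding Op_def
  proof (intro allI ballI)
    fix M F assume F: "F \<in> W M"
    have "(\<lambda>z. h z * F z) \<in> W (M + (E + E'))" using OpD[OF that(1) F] by (rule W_mono) simp
    moreover have "(\<lambda>z. h' z * F z) \<in> W (M + (E + E'))" using OpD[OF that(2) F] by (rule W_mono) simp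
    ultimately have "(\<lambda>z. h z * F z + h' z * F z) \<in> W (M + (E + E'))" by (rule W_add)
    then show "(\<lambda>z. (h z + h' z) * F z) \<in> W (M + (E + E'))" by (simp add: distrib_right)
  qed
  have Op_mult: "Op (E + E') (\<lambda>z. h z * h' z)" if "Op E h" "Op E' h'" for E E' h h'
    unfolding Op_def
  proof (intro allI ballI)
    fix M F assume F: "F \<in> W M"
    have "(\<lambda>z. h z * (h' z * F z)) \<in> W (M + E' + E)" by (rule OpD[OF that(1) OpD[OF that(2) F]])
    then show "(\<lambda>z. h z * h' z * F z) \<in> W (M + (E + E'))" by (simp add: algebra_simps)
  qed
  have Op_J: "\<exists>E. Op E h" if "h \<in> poly_functions J" for h
    using that
  proof (induction rule: poly_functions.induct)
    case (const a)
    show ?case using Op_const by (rule exI)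
  next
    case (coord j)
    have "Op 1 (\<lambda>z. z j)"
    proof (rule Op_gen)
      fix M g assume g: "g \<in> G M"
      let ?g = "((fst g)(j := Suc (fst g j)), snd g)"
      have gg: "?g \<in> G (M + 1)"
      proof -
        have "fst g \<in> J \<rightarrow>\<^sub>E {..M}" "snd g \<in> I - J \<rightarrow>\<^sub>E {..<n}" using g by (auto simp: G_def)
        then show ?thesis using coord unfolding G_def by (auto simp: PiE_iff extensional_def le_SucI)
      qed
      have "z j * mon g z = mon ?g z" for z
      proof -
        have "(\<Prod>l\<in>J. z l ^ fst ?g l) = z j ^ Suc (fst g j) * (\<Prod>l\<in>J - {j}. z l ^ fst ?g l)"
          using prod.remove[OF finJ coord, of "\<lambda>l. z l ^ fst ?g l"] by simp
        also have "(\<Prod>l\<in>J - {j}. z l ^ fst ?g l) = (\<Prod>l\<in>J - {j}. z l ^ fst g l)"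
          by (rule prod.cong) auto
        also have "z j ^ Suc (fst g j) * \<dots> = z j * (\<Prod>l\<in>J. z l ^ fst g l)"
          using prod.remove[OF finJ coord, of "\<lambda>l. z l ^ fst g l"] by simp
        finally show ?thesis by (simp add: mon_def)
      qed
      then show "(\<lambda>z. z j * mon g z) \<in> W (M + 1)" using W_gen[OF gg] by simp
    qed
    then show ?case by (rule exI)
  next
    case (add h h')
    then obtain E E' where "Op E h" "Op E' h'" by (elim exE)
    from Op_add[OF this] show ?case by (rule exI)
  next
    case (mult h h')
    then obtain E E' where "Op E h" "Op E' h'" by (elim exE)
    from Op_mult[OF this] show ?case by (rule exI)
  qed
  \<comment> \<open>If the exponent of \<open>z i\<close> is still below \<open>n\<close> after the
    multiplication, the monomial remains reduced; otherwise the factor \<open>p\<close> lets the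
    common relation replace the \<open>n\<close>-th power by lower ones. The bound \<open>?E\<close>
    covers both cases.\<close>
  have Op_coord: "\<exists>E. Op E (\<lambda>z. p z * z i)" if i: "i \<in> I - J" for i
  proof -
    obtain E where E: "Op E p" using Op_J[OF p(1)] by (rule exE)
    have "\<exists>E. \<forall>k. Op (E k) (c i k)"
      by (rule choice) (simp add: Op_J c[OF i])
    then obtain E' where "\<forall>k. Op (E' k) (c i k)" by (rule exE)
    note E' = this[rule_format]
    let ?E = "E + (\<Sum>k<n. E' k)"
    have "Op ?E (\<lambda>z. p z * z i)"
    proof (rule Op_gen)
      fix M g assume g: "g \<in> G M"
      define s where "s k = (fst g, (snd g)(i := k))" for k
      have sG: "s k \<in> G M" if "k < n" for k
      proof -
        have "fst g \<in> J \<rightarrow>\<^sub>E {..M}" "snd g \<in> I - J \<rightarrow>\<^sub>E {..<n}" using g by (auto simp: G_def)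
        then show ?thesis using i that unfolding G_def s_def by (auto simp: PiE_iff extensional_def)
      qed
      have gi: "snd g i < n" using g i by (auto simp: G_def PiE_iff)
      define R where "R z = (\<Prod>j\<in>J. z j ^ fst g j) * (\<Prod>l\<in>I - J - {i}. z l ^ snd g l)" for z :: "'i \<Rightarrow> complex"
      have ms: "mon (s k) z = z i ^ k * R z" for k z
      proof -
        have "(\<Prod>l\<in>I - J. z l ^ snd (s k) l) = z i ^ k * (\<Prod>l\<in>I - J - {i}. z l ^ snd (s k) l)"
          using prod.remove[OF finIJ i, of "\<lambda>l. z l ^ snd (s k) l"] by (simp add: s_def)
        also have "(\<Prod>l\<in>I - J - {i}. z l ^ snd (s k) l) = (\<Prod>l\<in>I - J - {i}. z l ^ snd g l)"
          by (rule prod.cong) (auto simp: s_def)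
        finally show ?thesis by (simp add: mon_def R_def s_def)
      qed
      have "s (snd g i) = g" by (simp add: s_def)
      then have mg: "mon g z = z i ^ snd g i * R z" for z using ms[of "snd g i" z] by simp
      show "(\<lambda>z. p z * z i * mon g z) \<in> W (M + ?E)"
      proof (cases "Suc (snd g i) < n")
        case True
        have "(\<lambda>z. p z * mon (s (Suc (snd g i))) z) \<in> W (M + E)"
          by (rule OpD[OF E W_gen[OF sG[OF True]]])
        then have "(\<lambda>z. p z * mon (s (Suc (snd g i))) z) \<in> W (M + ?E)" by (rule W_mono) simp
        then show ?thesis by (rule W_cong) (simp add: ms mg)
      next
        case False
        then have nn: "n = Suc (snd g i)" using gi by simp
        have "(\<lambda>z. \<Sum>k<n. c i k z * mon (s k) z) \<in> W (M + ?E)"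
        proof (rule W_sum)
          fix k assume k: "k \<in> {..<n}"
          have "(\<lambda>z. c i k z * mon (s k) z) \<in> W (M + E' k)"
            by (rule OpD[OF E' W_gen[OF sG]]) (use k in simp)
          then show "(\<lambda>z. c i k z * mon (s k) z) \<in> W (M + ?E)"
            by (rule W_mono) (use k member_le_sum[of k "{..<n}" E'] in simp)
        qed
        then show ?thesis
        proof (rule W_cong)
          fix z assume z: "z \<in> Z"
          have "p z * z i * mon g z = p z * z i ^ n * R z" unfolding mg nn by simp
          also have "\<dots> = (\<Sum>k<n. c i k z * mon (s k) z)"
            unfolding rel[OF i z] ms by (simp add: sum_distrib_right mult.assoc)
          finally show "p z * z i * mon g z = (\<Sum>k<n. c i k z * mon (s k) z)" .
        qed
      qed
    qed
    then show ?thesis by (rule exI)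
  qed
  obtain Ep where Ep: "Op Ep p" using Op_J[OF p(1)] by (rule exE)
  have Op_pow: "Op (r * Ep) (\<lambda>z. p z ^ r)" for r
  proof (induction r)
    case 0
    show ?case using Op_const[of 1] by simp
  next
    case (Suc r)
    show ?case using Op_mult[OF Ep Suc] by simp
  qed
  have Op_I: "\<exists>r E. Op E (\<lambda>z. p z ^ r * h z)" if "h \<in> poly_functions I" for h
    using that
  proof (induction rule: poly_functions.induct)
    case (const a)
    show ?case using Op_const[of a] by (intro exI[of _ 0]) auto
  next
    case (coord i)
    show ?case
    proof (cases "i \<in> J")
      case True
      then show ?thesis using Op_J[OF poly_functions.coord[OF True]] by (intro exI[of "\<lambda>r. \<exists>E. Op E (\<lambda>z. p z ^ r * z i)" 0]) simp
    next
      case False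
      then show ?thesis using Op_coord[of i] coord by (intro exI[of "\<lambda>r. \<exists>E. Op E (\<lambda>z. p z ^ r * z i)" 1]) simp
    qed
  next
    case (add h h')
    then obtain r E r' E' where "Op E (\<lambda>z. p z ^ r * h z)" "Op E' (\<lambda>z. p z ^ r' * h' z)" by (elim exE)
    from Op_add[OF Op_mult[OF Op_pow this(1)] Op_mult[OF Op_pow this(2)]]
    have "Op (r' * Ep + E + (r * Ep + E')) (\<lambda>z. p z ^ r' * (p z ^ r * h z) + p z ^ r * (p z ^ r' * h' z))" .
    then have "Op (r' * Ep + E + (r * Ep + E')) (\<lambda>z. p z ^ (r + r') * (h z + h' z))"
      by (simp add: power_add algebra_simps)
    then show ?case by (intro exI)
  next
    case (mult h h')
    then obtain r E r' E' where "Op E (\<lambda>z. p z ^ r * h z)" "Op E' (\<lambda>z. p z ^ r' * h' z)" by (elim exE)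
    from Op_mult[OF this]
    have "Op (E + E') (\<lambda>z. p z ^ (r + r') * (h z * h' z))"
      by (simp add: power_add algebra_simps)
    then show ?case by (intro exI)
  qed
  have "\<forall>l\<in>L. \<exists>r E. Op E (\<lambda>z. p z ^ r * f l z)" using Op_I f by simp
  then obtain r0 where "\<forall>l\<in>L. \<exists>E. Op E (\<lambda>z. p z ^ r0 l * f l z)" by (rule bchoice[THEN exE])
  then obtain E0 where E0: "\<forall>l\<in>L. Op (E0 l) (\<lambda>z. p z ^ r0 l * f l z)" by (rule bchoice[THEN exE])
  define r where "r = (\<Sum>l\<in>L. r0 l)"
  define E where "E = (\<Sum>l\<in>L. r * Ep + E0 l) + r * Ep"
  have Op_f: "Op E (\<lambda>z. p z ^ r * (f l z - b))" if l: "l \<in> L" for l b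
  proof -
    have r: "r0 l \<le> r" unfolding r_def using member_le_sum[OF l _ L(1), of r0] by simp
    have "Op ((r - r0 l) * Ep + E0 l + (r * Ep + 0))
        (\<lambda>z. p z ^ (r - r0 l) * (p z ^ r0 l * f l z) + p z ^ r * (- b))"
      using E0 l by (intro Op_add Op_mult Op_pow Op_const) simp
    moreover have "p z ^ (r - r0 l) * (p z ^ r0 l * f l z) + p z ^ r * (- b) = p z ^ r * (f l z - b)" for z
    proof -
      have "p z ^ (r - r0 l) * p z ^ r0 l = p z ^ r" using r by (simp add: power_add[symmetric])
      then show ?thesis by (simp only: mult.assoc[symmetric]) (simp add: right_diff_distrib)
    qed
    ultimately have "Op ((r - r0 l) * Ep + E0 l + r * Ep) (\<lambda>z. p z ^ r * (f l z - b))" by simp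
    moreover have "(r - r0 l) * Ep + E0 l + r * Ep \<le> E"
    proof -
      have "(r - r0 l) * Ep + E0 l \<le> r * Ep + E0 l" by simp
      also have "\<dots> \<le> (\<Sum>l\<in>L. r * Ep + E0 l)"
        using member_le_sum[OF l _ L(1), of "\<lambda>l. r * Ep + E0 l"] by simp
      finally show ?thesis by (simp add: E_def)
    qed
    ultimately show ?thesis by (rule Op_mono)
  qed
  have Op_prod: "Op (card K * E') (\<lambda>z. \<Prod>k\<in>K. h k z)"
    if "finite K" "\<And>k. k \<in> K \<Longrightarrow> Op E' (h k)" for K :: "('l \<times> nat) set" and E' h
    using that
  proof (induction K rule: finite_induct)
    case empty
    show ?case using Op_const[of 1] by simp
  next
    case (insert k K)
    then have "Op (E' + card K * E') (\<lambda>z. h k z * (\<Prod>k\<in>K. h k z))" by (intro Op_mult) auto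
    then show ?case using insert.hyps by simp
  qed
  have W_one: "(\<lambda>_. 1) \<in> W 0"
  proof -
    let ?g = "(\<lambda>j\<in>J. 0, \<lambda>i\<in>I - J. 0)"
    have "?g \<in> G 0" unfolding G_def using n by auto
    then have "mon ?g \<in> W 0" by (rule W_gen)
    then show ?thesis by (rule W_cong) (simp add: mon_def)
  qed
  \<comment> \<open>With these choices \<open>card (G M)\<close> is at most
    \<open>N * (N + 1) ^ card J\<close>, hence less than \<open>(N + 1) ^ card L\<close>, the number
    of points of the grid \<open>A\<close>. The polynomial \<open>e \<alpha>\<close> is an
    unnormalised Lagrange polynomial: on the grid it vanishes everywhere except at
    \<open>\<alpha>\<close>, so a nontrivial combination of these polynomials is not zero.\<close>
  define N where "N = n ^ card (I - J) * (E * card L + 1) ^ card J"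
  define M where "M = card L * N * E"
  define A where "A = (L \<rightarrow>\<^sub>E {..N})"
  define S where "S \<alpha> = (SIGMA l:L. {..N} - {\<alpha> l})" for \<alpha> :: "'l \<Rightarrow> nat"
  have finA: "finite A" unfolding A_def using L(1) by (intro finite_PiE) auto
  have finS: "finite (S \<alpha>)" for \<alpha> unfolding S_def using L(1) by auto
  \<comment> \<open>Every \<open>e \<alpha>\<close> has the same number of factors, so the same
    power of \<open>p\<close> makes all of them reduced, and this power can be cancelled from the
    final relation.\<close>
  have cardS: "card (S \<alpha>) = card L * N" if "\<alpha> \<in> A" for \<alpha>
  proof -
    have "card (S \<alpha>) = (\<Sum>l\<in>L. card ({..N} - {\<alpha> l}))" unfolding S_def using L(1) by (intro card_SigmaI) auto
    also have "\<dots> = (\<Sum>l\<in>L. N)" by (intro sum.cong) (use that in \<open>auto simp: A_def PiE_iff\<close>)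
    finally show ?thesis by simp
  qed
  define e where "e \<alpha> x = (\<Prod>(l, b)\<in>S \<alpha>. x l - of_nat b)" for \<alpha> and x :: "'l \<Rightarrow> complex"
  have "card (G M) = (M + 1) ^ card J * n ^ card (I - J)"
    unfolding G_def using finJ finIJ by (simp add: card_cartesian_product card_PiE)
  also have "\<dots> \<le> ((E * card L + 1) * (N + 1)) ^ card J * n ^ card (I - J)"
    by (intro mult_right_mono power_mono) (auto simp: M_def algebra_simps)
  also have "\<dots> = N * (N + 1) ^ card J" unfolding power_mult_distrib by (subst (2) N_def) (simp only: mult_ac)
  also have "\<dots> < (N + 1) * (N + 1) ^ card J" by simp
  also have "\<dots> \<le> (N + 1) ^ card L" using L(2) power_increasing[of "Suc (card J)" "card L" "N + 1"] by simp
  also have "\<dots> = card A" unfolding A_def using L(1) by (simp add: card_PiE)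
  finally have card: "card (G M) < card A" .
  have "\<exists>d. \<forall>z\<in>Z. p z ^ (r * (card L * N)) * e \<alpha> (\<lambda>l. f l z) = (\<Sum>g\<in>G M. d g * mon g z)"
    if \<alpha>: "\<alpha> \<in> A" for \<alpha>
  proof -
    have "Op (card (S \<alpha>) * E) (\<lambda>z. \<Prod>s\<in>S \<alpha>. p z ^ r * (f (fst s) z - of_nat (snd s)))"
      by (rule Op_prod[OF finS]) (auto simp: S_def intro: Op_f)
    from OpD[OF this W_one]
    have "(\<lambda>z. \<Prod>s\<in>S \<alpha>. p z ^ r * (f (fst s) z - of_nat (snd s))) \<in> W M"
      using cardS[OF \<alpha>] by (simp add: M_def)
    then have "(\<lambda>z. p z ^ (r * (card L * N)) * e \<alpha> (\<lambda>l. f l z)) \<in> W M"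
      by (rule W_cong)
        (simp add: prod.distrib cardS[OF \<alpha>] e_def power_mult case_prod_beta)
    then show ?thesis unfolding W_def by simp
  qed
  then have "\<forall>\<alpha>\<in>A. \<exists>d. \<forall>z\<in>Z. p z ^ (r * (card L * N)) * e \<alpha> (\<lambda>l. f l z) = (\<Sum>g\<in>G M. d g * mon g z)"
    by simp
  then obtain d where d: "\<forall>\<alpha>\<in>A. \<forall>z\<in>Z. p z ^ (r * (card L * N)) * e \<alpha> (\<lambda>l. f l z) = (\<Sum>g\<in>G M. d \<alpha> g * mon g z)"
    by (rule bchoice[THEN exE])
  obtain a \<alpha>0 where \<alpha>0: "\<alpha>0 \<in> A" "a \<alpha>0 \<noteq> 0" and a: "\<forall>g\<in>G M. (\<Sum>\<alpha>\<in>A. a \<alpha> * d \<alpha> g) = 0"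
    using linear_dependence[OF finG finA card, of d] by blast
  define q where "q x = (\<Sum>\<alpha>\<in>A. a \<alpha> * e \<alpha> x)" for x
  have q: "q \<in> poly_functions L"
    unfolding q_def e_def S_def by (auto intro!: poly_functions_intros simp: case_prod_beta)
  have qf: "(\<lambda>z. q (\<lambda>l. f l z)) \<in> poly_functions I"
    by (rule poly_functions_subst[OF q]) (simp add: f)
  have z: "p z ^ (r * (card L * N)) * q (\<lambda>l. f l z) = 0" if z: "z \<in> Z" for z
  proof -
    have "p z ^ (r * (card L * N)) * q (\<lambda>l. f l z)
        = (\<Sum>\<alpha>\<in>A. a \<alpha> * (p z ^ (r * (card L * N)) * e \<alpha> (\<lambda>l. f l z)))"
      by (simp add: q_def sum_distrib_left algebra_simps)
    also have "\<dots> = (\<Sum>\<alpha>\<in>A. a \<alpha> * (\<Sum>g\<in>G M. d \<alpha> g * mon g z))"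
      using d z by simp
    also have "\<dots> = (\<Sum>g\<in>G M. (\<Sum>\<alpha>\<in>A. a \<alpha> * d \<alpha> g) * mon g z)"
      by (simp add: sum_distrib_left sum_distrib_right sum.swap[of _ A] mult.assoc)
    also have "\<dots> = 0" using a by simp
    finally show ?thesis .
  qed
  have pI: "(\<lambda>z. p z ^ (r * (card L * N))) \<in> poly_functions I"
    using p(1) sub by (intro poly_functions_power) (rule poly_functions_mono)
  have "\<not> (\<forall>z\<in>Z. p z ^ (r * (card L * N)) = 0)"
    by (rule poly_irreducible_power[OF irr poly_functions_mono[OF p(1) sub] indep_not_vanishing[OF p]])
  from poly_irreducible_cancel[OF irr pI qf this z] have "\<forall>z\<in>Z. q (\<lambda>l. f l z) = 0" .
  moreover have "\<exists>v. q v \<noteq> 0"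
  proof -
    have "e \<alpha> (\<lambda>l. of_nat (\<alpha>0 l)) = 0" if \<alpha>: "\<alpha> \<in> A - {\<alpha>0}" for \<alpha>
    proof -
      obtain l where l: "\<alpha> l \<noteq> \<alpha>0 l" using \<alpha> by auto
      have lL: "l \<in> L" using l \<alpha> \<alpha>0(1) by (auto simp: A_def PiE_iff extensional_def)
      then have "(l, \<alpha>0 l) \<in> S \<alpha>" using l \<alpha>0(1) by (auto simp: S_def A_def PiE_iff)
      then show ?thesis unfolding e_def using finS by (intro prod_zero) (auto intro!: bexI[of _ "(l, \<alpha>0 l)"])
    qed
    then have "q (\<lambda>l. of_nat (\<alpha>0 l)) = a \<alpha>0 * e \<alpha>0 (\<lambda>l. of_nat (\<alpha>0 l))"
      unfolding q_def using sum.remove[OF finA \<alpha>0(1), of "\<lambda>\<alpha>. a \<alpha> * e \<alpha> (\<lambda>l. of_nat (\<alpha>0 l))"] by simp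
    moreover have "e \<alpha>0 (\<lambda>l. of_nat (\<alpha>0 l)) \<noteq> 0"
      unfolding e_def using finS by (auto simp: prod_zero_iff S_def)
    ultimately have "q (\<lambda>l. of_nat (\<alpha>0 l)) \<noteq> 0" using \<alpha>0(2) by simp
    then show ?thesis by (rule exI[of "\<lambda>v. q v \<noteq> 0"])
  qed
  ultimately have "(\<exists>v. q v \<noteq> 0) \<and> (\<forall>z\<in>Z. q (\<lambda>l. f l z) = 0)" by (rule conjI[rotated])
  then show ?thesis by - (rule bexI[OF _ q])
qed

end

context coord_basis
begin

text \<open>A basis that is maximal under inclusion is also largest in size: more than
  \<open>card J\<close> coordinate functions are dependent on \<open>Z\<close> by
  \<open>poly_functions_dependent\<close>.\<close>

lemma card_alg_indep_le:
  assumes K: "alg_indep K Z" "K \<subseteq> I"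
  shows "card K \<le> card J"
proof (rule ccontr)
  assume "\<not> ?thesis"
  then have c: "card J < card K" by simp
  have fK: "finite K" using K(2) fin by (rule finite_subset)
  have "\<exists>q\<in>poly_functions K. (\<exists>v. q v \<noteq> 0) \<and> (\<forall>z\<in>Z. q (\<lambda>l. z l) = 0)"
    by (rule poly_functions_dependent[OF fK c]) (use K(2) in \<open>simp add: poly_functions.coord subset_iff\<close>)
  then obtain q v where q: "q \<in> poly_functions K" "q v \<noteq> 0" "\<forall>z\<in>Z. q z = 0"
    by (elim bexE conjE exE) simp
  then show False using alg_indepD[OF K(1) q(1), of v] by simp
qed

text \<open>The \<open>card J + 1\<close> functions formed by \<open>f\<close> and the basis
  coordinates are dependent. In a relation written in powers of \<open>f\<close>, let
  \<open>c m\<close> be the lowest nonzero coefficient; cancelling \<open>f ^ m\<close> on the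
  irreducible set leaves \<open>c m\<close> as a multiple of \<open>f\<close>.\<close>

lemma divides_basis_polynomial:
  assumes f: "f \<in> poly_functions I" and nz: "\<not> (\<forall>z\<in>Z. f z = 0)"
  shows "\<exists>c\<in>poly_functions J. \<exists>h\<in>poly_functions I. (\<exists>u. c u \<noteq> 0) \<and> (\<forall>z\<in>Z. c z = f z * h z)"
proof -
  let ?L = "insert None (Some ` J)"
  let ?F = "\<lambda>l z. case l of None \<Rightarrow> f z | Some j \<Rightarrow> z j"
  have "finite ?L" using finJ by simp
  moreover have "card J < card ?L" using finJ by (simp add: card_image)
  moreover have "?F l \<in> poly_functions I" if "l \<in> ?L" for l
    using that f sub by (auto intro!: poly_functions.coord poly_functions.const)
  ultimately have "\<exists>q\<in>poly_functions ?L. (\<exists>v. q v \<noteq> 0) \<and> (\<forall>z\<in>Z. q (\<lambda>l. ?F l z) = 0)"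
    by (rule poly_functions_dependent)
  then obtain q v where q: "q \<in> poly_functions ?L" "q v \<noteq> 0" "\<forall>z\<in>Z. q (\<lambda>l. ?F l z) = 0"
    by (elim bexE conjE exE) simp
  obtain P n where P: "\<forall>k. P k \<in> poly_functions (Some ` J)" "\<forall>x. q x = (\<Sum>k\<le>n. P k x * x None ^ k)"
    using poly_functions_expand[OF q(1)] by (elim exE conjE)
  define c where "c k z = P k (\<lambda>l. case l of None \<Rightarrow> 0 | Some j \<Rightarrow> z j)" for k z
  have c: "c k \<in> poly_functions J" for k
    unfolding c_def
    by (rule poly_functions_subst[OF P(1)[rule_format]]) (auto intro!: poly_functions.coord poly_functions.const)
  have Pc: "P k x = c k (\<lambda>j. x (Some j))" for k x
    unfolding c_def by (rule poly_functions_cong[OF P(1)[rule_format]]) auto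
  have qz: "(\<Sum>k\<le>n. c k z * f z ^ k) = 0" if z: "z \<in> Z" for z
    using q(3) z P(2) by (simp add: Pc)
  have ex: "\<exists>k. k \<le> n \<and> (\<exists>u. c k u \<noteq> 0)"
  proof (rule ccontr)
    assume "\<not> ?thesis"
    then have "q v = 0" using P(2) by (simp add: Pc)
    then show False using q(2) by simp
  qed
  define m where "m = (LEAST k. k \<le> n \<and> (\<exists>u. c k u \<noteq> 0))"
  have m: "m \<le> n" "\<exists>u. c m u \<noteq> 0" using LeastI_ex[OF ex] unfolding m_def by simp_all
  have below: "c k u = 0" if "k < m" for k u
    using not_less_Least[OF that[unfolded m_def]] that m(1) by auto
  define h where "h z = - (\<Sum>k\<in>{m<..n}. c k z * f z ^ (k - Suc m))" for z
  have cI: "c k \<in> poly_functions I" for k using c sub by (rule poly_functions_mono)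
  have h: "h \<in> poly_functions I"
    unfolding h_def by (intro poly_functions_intros cI f)
  have pI: "(\<lambda>z. c m z - f z * h z) \<in> poly_functions I" by (intro poly_functions_intros cI f h)
  have z0: "f z ^ m * (c m z - f z * h z) = 0" if z: "z \<in> Z" for z
  proof -
    have "(\<Sum>k\<le>n. c k z * f z ^ k) = (\<Sum>k\<in>{m..n}. c k z * f z ^ k)"
      by (rule sum.mono_neutral_right) (use below in auto)
    also have "{m..n} = insert m {m<..n}" using m(1) by auto
    also have "(\<Sum>k\<in>insert m {m<..n}. c k z * f z ^ k) = c m z * f z ^ m + (\<Sum>k\<in>{m<..n}. c k z * f z ^ k)"
      by simp
    also have "(\<Sum>k\<in>{m<..n}. c k z * f z ^ k) = (\<Sum>k\<in>{m<..n}. f z ^ Suc m * (c k z * f z ^ (k - Suc m)))"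
    proof (rule sum.cong)
      fix k assume "k \<in> {m<..n}"
      then have "f z ^ k = f z ^ Suc m * f z ^ (k - Suc m)" by (simp only: power_add[symmetric]) simp
      then show "c k z * f z ^ k = f z ^ Suc m * (c k z * f z ^ (k - Suc m))" by simp
    qed simp
    also have "\<dots> = f z ^ Suc m * - h z" unfolding h_def by (simp add: sum_distrib_left)
    finally have "c m z * f z ^ m + f z ^ Suc m * - h z = 0" using qz[OF z] by simp
    then show ?thesis by (simp add: algebra_simps)
  qed
  have "\<forall>z\<in>Z. c m z - f z * h z = 0"
    using poly_irreducible_cancel[OF irr poly_functions_power[OF f] pI poly_irreducible_power[OF irr f nz] z0] .
  then have "(\<exists>u. c m u \<noteq> 0) \<and> (\<forall>z\<in>Z. c m z = f z * h z)" using m(2) by simp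
  then show ?thesis by - (rule bexI[OF bexI[OF _ h] c])
qed

end

lemma alg_indep_extend:
  assumes "finite A" "J \<subseteq> A" "alg_indep J Z"
  obtains K where "J \<subseteq> K" "K \<subseteq> A" "alg_indep K Z" "\<forall>i\<in>A - K. \<not> alg_indep (insert i K) Z"
proof -
  let ?F = "{K. J \<subseteq> K \<and> K \<subseteq> A \<and> alg_indep K Z}"
  have "finite ?F" by (rule finite_subset[of _ "Pow A"]) (use assms(1) in auto)
  moreover have "J \<in> ?F" using assms by simp
  then have "?F \<noteq> {}" by (metis empty_iff)
  ultimately have "\<exists>K\<in>?F. \<forall>K'\<in>?F. K \<subseteq> K' \<longrightarrow> K = K'" by (rule finite_has_maximal)
  then obtain K where K: "K \<in> ?F" "\<forall>K'\<in>?F. K \<subseteq> K' \<longrightarrow> K = K'" by (rule bexE)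
  have "\<not> alg_indep (insert i K) Z" if "i \<in> A - K" for i
    using bspec[OF K(2), of "insert i K"] K(1) that by auto
  then show thesis using that[of K] K(1) by simp
qed

lemma alg_indep_empty: "Z \<noteq> {} \<Longrightarrow> alg_indep {} Z"
proof (rule alg_indepI)
  fix p x assume "Z \<noteq> {}" and p: "p \<in> poly_functions {}" "\<And>z. z \<in> Z \<Longrightarrow> p z = 0"
  then obtain z where "z \<in> Z" by auto
  moreover have "p x = p z" by (rule poly_functions_cong[OF p(1)]) simp
  ultimately show "p x = 0" using p(2) by simp
qed

lemma not_alg_indep_empty: "\<not> alg_indep J {}"
  using alg_indepD[of J "{}" "\<lambda>_. 1"] poly_functions.const[of 1 J] by auto

text \<open>If \<open>J\<close> were a transcendence basis on \<open>Z\<close>, then a function vanishing on \<open>Z'\<close> but not on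
  \<open>Z\<close> would divide a nonzero polynomial in the coordinates \<open>J\<close>, which would vanish on \<open>Z'\<close>.\<close>

lemma alg_indep_step:
  assumes I: "finite I" "J \<subseteq> I" and Z: "poly_irreducible I Z" "Z' \<subseteq> Z" "alg_indep J Z'"
    and f: "f \<in> poly_functions I" "\<forall>z\<in>Z'. f z = 0" "\<not> (\<forall>z\<in>Z. f z = 0)"
  shows "\<exists>i\<in>I - J. alg_indep (insert i J) Z"
proof (rule ccontr)
  assume n: "\<not> ?thesis"
  have J: "alg_indep J Z" using Z(3) by (rule alg_indep_mono) (use Z(2) in simp_all)
  interpret coord_basis I J Z
    by unfold_locales (use I Z J n in auto)
  obtain c h u where c: "c \<in> poly_functions J" and "h \<in> poly_functions I"
    and cz: "\<forall>z\<in>Z. c z = f z * h z" and u: "c u \<noteq> 0"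
    using divides_basis_polynomial[OF f(1,3)] by (elim bexE conjE exE) simp
  have "c z = 0" if "z \<in> Z'" for z
  proof -
    have "z \<in> Z" using that Z(2) by blast
    then show ?thesis using cz f(2) that by simp
  qed
  then have "c u = 0" using alg_indepD[OF Z(3) c, of u] by simp
  then show False using u by simp
qed

section \<open>Chains of irreducible closed subsets\<close>

lemma closedin_subtopology_zariski:
  assumes "S \<subseteq> affine_space I"
  shows "closedin (subtopology (zariski I) S) Y \<longleftrightarrow> (\<exists>P\<subseteq>poly_functions I. Y = {x \<in> S. \<forall>p\<in>P. p x = 0})"
proof -
  have e: "zero_locus I P \<inter> S = {x \<in> S. \<forall>p\<in>P. p x = 0}" for P
    using assms by (auto simp: zero_locus_def)
  show ?thesis unfolding closedin_subtopology closedin_zariski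
    using e by (metis (no_types, lifting))
qed

lemma topspace_subtopology_zariski:
  "S \<subseteq> affine_space I \<Longrightarrow> topspace (subtopology (zariski I) S) = S"
  by (auto simp: topspace_zariski)

lemma closedin_vanishing:
  assumes "S \<subseteq> affine_space I" "p \<in> poly_functions I" "closedin (subtopology (zariski I) S) Y"
  shows "closedin (subtopology (zariski I) S) {x \<in> Y. p x = 0}"
proof -
  have "closedin (subtopology (zariski I) S) {x \<in> S. \<forall>q\<in>{p}. q x = 0}"
    unfolding closedin_subtopology_zariski[OF assms(1)] using assms(2)
    by (intro exI[of _ "{p}"] conjI) simp_all
  from closedin_Int[OF assms(3) this]
  have "closedin (subtopology (zariski I) S) (Y \<inter> {x \<in> S. \<forall>q\<in>{p}. q x = 0})" .
  moreover have "Y \<subseteq> S"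
    using closedin_subset[OF assms(3)] topspace_subtopology_zariski[OF assms(1)] by simp
  then have "Y \<inter> {x \<in> S. \<forall>q\<in>{p}. q x = 0} = {x \<in> Y. p x = 0}" by auto
  ultimately show ?thesis by simp
qed

lemma irreducible_in_poly_irreducible:
  assumes S: "S \<subseteq> affine_space I" and Z: "irreducible_in (subtopology (zariski I) S) Z"
  shows "poly_irreducible I Z"
proof (rule poly_irreducibleI)
  show "Z \<noteq> {}" using Z by (simp add: irreducible_in_def)
  fix p q assume p: "p \<in> poly_functions I" and q: "q \<in> poly_functions I"
    and pq: "\<And>z. z \<in> Z \<Longrightarrow> p z * q z = 0"
  let ?X = "subtopology (zariski I) S"
  have cl: "closedin ?X {x \<in> S. f x = 0}" if "f \<in> poly_functions I" for f
    using closedin_vanishing[OF S that, of S] topspace_subtopology_zariski[OF S] closedin_topspace[of ?X] by simp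
  have ZS: "Z \<subseteq> S" using Z topspace_subtopology_zariski[OF S] by (simp add: irreducible_in_def)
  have "Z \<subseteq> {x \<in> S. p x = 0} \<union> {x \<in> S. q x = 0}"
  proof
    fix z assume z: "z \<in> Z"
    show "z \<in> {x \<in> S. p x = 0} \<union> {x \<in> S. q x = 0}" using pq[OF z] z ZS by auto
  qed
  then have "Z \<subseteq> {x \<in> S. p x = 0} \<or> Z \<subseteq> {x \<in> S. q x = 0}"
    using Z cl[OF p] cl[OF q] unfolding irreducible_in_def by simp
  then show "(\<forall>z\<in>Z. p z = 0) \<or> (\<forall>z\<in>Z. q z = 0)" by auto
qed

text \<open>If all chains were shorter than \<open>d\<close>, their supremum would be at most
  \<open>d - 1\<close>. For \<open>d = 0\<close> there might be no chain at all, as in the empty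
  space.\<close>

lemma krull_dim_geE:
  assumes "enat d \<le> krull_dim X" "d > 0"
  obtains e Z where "d \<le> e" "\<forall>k\<le>e. closedin X (Z k) \<and> irreducible_in X (Z k)" "\<forall>k<e. Z k \<subset> Z (Suc k)"
proof -
  have "\<exists>e\<ge>d. \<exists>Z :: nat \<Rightarrow> 'a set.
     (\<forall>k\<le>e. closedin X (Z k) \<and> irreducible_in X (Z k)) \<and> (\<forall>k<e. Z k \<subset> Z (Suc k))"
  proof (rule ccontr)
    assume n: "\<not> ?thesis"
    have "krull_dim X \<le> enat (d - 1)"
      unfolding krull_dim_def
    proof (rule Sup_least)
      fix x assume "x \<in> {enat e |e. \<exists>Z :: nat \<Rightarrow> 'a set.
         (\<forall>k\<le>e. closedin X (Z k) \<and> irreducible_in X (Z k)) \<and> (\<forall>k<e. Z k \<subset> Z (Suc k))}"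
      then obtain e where "x = enat e" and e: "\<exists>Z :: nat \<Rightarrow> 'a set.
         (\<forall>k\<le>e. closedin X (Z k) \<and> irreducible_in X (Z k)) \<and> (\<forall>k<e. Z k \<subset> Z (Suc k))" by auto
      moreover have "e < d" using n e by (meson not_le_imp_less)
      ultimately show "x \<le> enat (d - 1)" by simp
    qed
    with assms(1) have "enat d \<le> enat (d - 1)" by (rule order_trans)
    then show False using assms(2) by simp
  qed
  then show thesis using that by (elim exE conjE)
qed

lemma krull_dim_geI:
  assumes "\<forall>k\<le>d. closedin X (Z k) \<and> irreducible_in X (Z k)" "\<forall>k<d. Z k \<subset> Z (Suc k)"
  shows "enat d \<le> krull_dim X"
  unfolding krull_dim_def by (rule Sup_upper) (use assms in blast)

text \<open>Along a chain of irreducible closed sets every strict inclusion adds one independent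
  coordinate by \<open>alg_indep_step\<close>, applied to an equation of the smaller set which fails
  on the larger one. As \<open>S\<close> is an arbitrary nonempty subset, sublevel sets are
  covered.\<close>

lemma krull_dim_alg_indep:
  assumes I: "finite I" and S: "S \<subseteq> affine_space I" "S \<noteq> {}"
    and d: "enat d \<le> krull_dim (subtopology (zariski I) S)"
  shows "\<exists>J\<subseteq>I. card J = d \<and> alg_indep J S"
proof (cases "d = 0")
  case True
  then show ?thesis using alg_indep_empty[OF S(2)] by (intro exI[of _ "{}"]) simp
next
  case False
  let ?X = "subtopology (zariski I) S"
  obtain e Z where e: "d \<le> e" and Z: "\<forall>k\<le>e. closedin ?X (Z k) \<and> irreducible_in ?X (Z k)"
    "\<forall>k<e. Z k \<subset> Z (Suc k)"
    using krull_dim_geE[OF d] False by auto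
  have ZS: "Z k \<subseteq> S" if "k \<le> e" for k
    using Z(1) that closedin_subset[of ?X "Z k"] topspace_subtopology_zariski[OF S(1)] by simp
  have "\<exists>J\<subseteq>I. card J = k \<and> alg_indep J (Z k)" if "k \<le> e" for k
    using that
  proof (induction k)
    case 0
    have "irreducible_in ?X (Z 0)" using Z(1) by simp
    then have "Z 0 \<noteq> {}" by (simp add: irreducible_in_def)
    from alg_indep_empty[OF this] show ?case by (intro exI[of _ "{}"]) simp
  next
    case (Suc k)
    then obtain J where J: "J \<subseteq> I" "card J = k" "alg_indep J (Z k)" by auto
    have irr: "poly_irreducible I (Z (Suc k))"
      using irreducible_in_poly_irreducible[OF S(1)] Z(1) Suc.prems by blast
    have sub: "Z k \<subset> Z (Suc k)" using Z(2) Suc.prems by simp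
    have "closedin ?X (Z k)" using Z(1) Suc.prems by simp
    then obtain P where P: "P \<subseteq> poly_functions I" "Z k = {x \<in> S. \<forall>p\<in>P. p x = 0}"
      unfolding closedin_subtopology_zariski[OF S(1)] by (elim exE conjE)
    obtain x where x: "x \<in> Z (Suc k)" "x \<notin> Z k" using sub by auto
    have "x \<in> S" using ZS[OF Suc.prems] x(1) by auto
    then obtain f where f: "f \<in> P" "f x \<noteq> 0" using x(2) P(2) by auto
    have fz: "\<forall>z\<in>Z k. f z = 0" using f(1) P(2) by auto
    have fn: "\<not> (\<forall>z\<in>Z (Suc k). f z = 0)" using f(2) x(1) by auto
    have "Z k \<subseteq> Z (Suc k)" using sub by auto
    from alg_indep_step[OF I J(1) irr this J(3) subsetD[OF P(1) f(1)] fz fn]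
    obtain i where i: "i \<in> I - J" "alg_indep (insert i J) (Z (Suc k))" by (rule bexE)
    moreover have "finite J" using J(1) I by (rule finite_subset)
    ultimately show ?case using J(1,2) by (intro exI[of _ "insert i J"]) simp
  qed
  then obtain J where J: "J \<subseteq> I" "card J = e" "alg_indep J (Z e)" by auto
  obtain J' where J': "J' \<subseteq> J" "card J' = d"
    using obtain_subset_with_card_n[of d J] J(2) e by auto
  have "alg_indep J' S" using J(3) J'(1) ZS[of e] by (rule alg_indep_mono) simp
  then show ?thesis using J(1) J' by (intro exI[of _ J']) auto
qed

section \<open>The Hilbert basis theorem\<close>

inductive_set ideal_gen :: "'i set \<Rightarrow> (('i \<Rightarrow> complex) \<Rightarrow> complex) set \<Rightarrow> (('i \<Rightarrow> complex) \<Rightarrow> complex) set"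
  for I :: "'i set" and F where
  zero: "(\<lambda>_. 0) \<in> ideal_gen I F"
| gen: "f \<in> F \<Longrightarrow> f \<in> ideal_gen I F"
| add: "\<lbrakk>f \<in> ideal_gen I F; g \<in> ideal_gen I F\<rbrakk> \<Longrightarrow> (\<lambda>x. f x + g x) \<in> ideal_gen I F"
| scale: "\<lbrakk>p \<in> poly_functions I; f \<in> ideal_gen I F\<rbrakk> \<Longrightarrow> (\<lambda>x. p x * f x) \<in> ideal_gen I F"

lemma ideal_gen_trans:
  assumes "f \<in> ideal_gen I F" "F \<subseteq> ideal_gen I G" shows "f \<in> ideal_gen I G"
  using assms(1)
  by (induction rule: ideal_gen.induct) (use assms(2) in \<open>auto intro: ideal_gen.zero ideal_gen.add ideal_gen.scale\<close>)

lemma ideal_gen_mono: "f \<in> ideal_gen I F \<Longrightarrow> F \<subseteq> G \<Longrightarrow> f \<in> ideal_gen I G"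
  by (erule ideal_gen_trans) (auto intro: ideal_gen.gen)

lemma ideal_gen_sum:
  "(\<And>k. k \<in> K \<Longrightarrow> f k \<in> ideal_gen I F) \<Longrightarrow> (\<lambda>x. \<Sum>k\<in>K. f k x) \<in> ideal_gen I F"
  by (induction K rule: infinite_finite_induct) (simp_all add: ideal_gen.zero ideal_gen.add)

lemma ideal_gen_poly_functions: "f \<in> ideal_gen I F \<Longrightarrow> F \<subseteq> poly_functions I \<Longrightarrow> f \<in> poly_functions I"
  by (induction rule: ideal_gen.induct) (auto intro: poly_functions.intros)

lemma ideal_gen_vanishing:
  assumes "f \<in> ideal_gen I F" "\<And>g. g \<in> F \<Longrightarrow> g x = 0" shows "f x = 0"
  using assms(1) by (induction rule: ideal_gen.induct) (use assms(2) in auto)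

lemma ideal_gen_image_combination:
  fixes f :: "nat \<Rightarrow> ('i \<Rightarrow> complex) \<Rightarrow> complex"
  assumes "p \<in> ideal_gen I (f ` {..<n})"
  shows "\<exists>g. (\<forall>k. g k \<in> poly_functions I) \<and> (\<forall>x. p x = (\<Sum>k<n. g k x * f k x))"
  using assms
proof (induction rule: ideal_gen.induct)
  case zero
  show ?case by (intro exI[of _ "\<lambda>_ _. 0"]) (simp add: poly_functions.const)
next
  case (gen p)
  then obtain k where k: "k < n" "p = f k" by auto
  show ?case
  proof (intro exI[of _ "\<lambda>l _. if l = k then 1 else 0"] conjI allI)
    show "p x = (\<Sum>l<n. (if l = k then 1 else 0) * f l x)" for x
      using k by (simp add: if_distrib[of "\<lambda>y. y * _"] cong: if_cong)
  qed (rule poly_functions.const)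
next
  case (add p q)
  then obtain g h where "\<forall>k. g k \<in> poly_functions I" "\<forall>x. p x = (\<Sum>k<n. g k x * f k x)"
    "\<forall>k. h k \<in> poly_functions I" "\<forall>x. q x = (\<Sum>k<n. h k x * f k x)" by (elim exE conjE)
  then show ?case
    by (intro exI[of _ "\<lambda>k x. g k x + h k x"]) (simp add: poly_functions.add distrib_right sum.distrib)
next
  case (scale p q)
  then obtain g where "\<forall>k. g k \<in> poly_functions I" "\<forall>x. q x = (\<Sum>k<n. g k x * f k x)"
    by (elim exE conjE)
  then show ?case using scale(1)
    by (intro exI[of _ "\<lambda>k x. p x * g k x"]) (simp add: poly_functions.mult sum_distrib_left mult.assoc)
qed

lemma ideal_gen_range_finite:
  fixes f :: "nat \<Rightarrow> ('i \<Rightarrow> complex) \<Rightarrow> complex"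
  assumes "p \<in> ideal_gen I (range f)"
  shows "\<exists>n. p \<in> ideal_gen I (f ` {..<n})"
  using assms
proof (induction rule: ideal_gen.induct)
  case zero
  show ?case by (rule exI[of _ 0]) (rule ideal_gen.zero)
next
  case (gen p)
  then obtain k where "p = f k" by auto
  then have "p \<in> ideal_gen I (f ` {..<Suc k})" by (intro ideal_gen.gen) simp
  then show ?case by (rule exI)
next
  case (add p q)
  then obtain a b where ab: "p \<in> ideal_gen I (f ` {..<a})" "q \<in> ideal_gen I (f ` {..<b})" by (elim exE)
  have "p \<in> ideal_gen I (f ` {..<a + b})" "q \<in> ideal_gen I (f ` {..<a + b})"
    by (rule ideal_gen_mono[OF ab(1)], force, rule ideal_gen_mono[OF ab(2)], force)
  from ideal_gen.add[OF this] show ?case by (rule exI)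
next
  case (scale p q)
  then obtain a where "q \<in> ideal_gen I (f ` {..<a})" by (elim exE)
  from ideal_gen.scale[OF scale(1) this] show ?case by (rule exI)
qed

lemma poly_functions_empty: "p \<in> poly_functions {} \<Longrightarrow> p = (\<lambda>_. p x)"
  using poly_functions_cong[of p "{}"] by (intro ext) simp

text \<open>Hilbert's theorem by minimal degrees, inductively on the number of variables. In an
  ideal that is not finitely generated, elements \<open>h m\<close> are chosen successively, each of
  least degree in the coordinate \<open>i\<close> outside the ideal of its predecessors. The
  induction hypothesis gives a combination of their leading coefficients which lowers the degree of
  some \<open>h n\<close>.\<close>

theorem poly_functions_noetherian:
  fixes f :: "nat \<Rightarrow> ('i \<Rightarrow> complex) \<Rightarrow> complex"
  assumes "finite I" "\<forall>n. f n \<in> poly_functions I"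
  shows "\<exists>n. f n \<in> ideal_gen I (f ` {..<n})"
  using assms
proof (induction I arbitrary: f rule: finite_induct)
  case empty
  define u :: "'i \<Rightarrow> complex" where "u = (\<lambda>_. 0)"
  have f: "f n = (\<lambda>_. f n u)" for n using empty by (intro poly_functions_empty) simp
  show ?case
  proof (cases "f 0 u = 0")
    case True
    then have "f 0 = (\<lambda>_. 0)" using f[of 0] by simp
    then show ?thesis by (intro exI[of _ 0]) (simp add: ideal_gen.zero)
  next
    case False
    have "(\<lambda>x. (f 1 u / f 0 u) * f 0 x) \<in> ideal_gen {} (f ` {..<1})"
      by (intro ideal_gen.scale poly_functions.const ideal_gen.gen) simp
    moreover have "(f 1 u / f 0 u) * f 0 x = f 1 x" for x
    proof -
      have "f 0 x = f 0 u" by (subst f) simp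
      moreover have "f 1 x = f 1 u" by (subst f) simp
      ultimately show ?thesis using False by simp
    qed
    ultimately show ?thesis by (intro exI[of _ 1]) simp
  qed
next
  case (insert i I)
  let ?I = "insert i I"
  show ?case
  proof (rule ccontr)
    assume "\<not> ?thesis"
    then have nf: "f n \<notin> ideal_gen ?I (f ` {..<n})" for n by simp
    define A where "A = ideal_gen ?I (range f)"
    have Apoly: "p \<in> poly_functions ?I" if "p \<in> A" for p
      using that insert.prems unfolding A_def by (intro ideal_gen_poly_functions) auto
    \<comment> \<open>\<open>deg p d\<close> only says that \<open>d\<close> bounds the degree in
      the coordinate \<open>i\<close>; the degree proper is the least such bound
      \<open>D p\<close>.\<close>
    define deg where "deg p d \<longleftrightarrow> (\<exists>P. (\<forall>k. P k \<in> poly_functions I) \<and> (\<forall>x. p x = (\<Sum>k\<le>d. P k x * x i ^ k)))"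
      for p and d :: nat
    define D where "D p = (LEAST d. deg p d)" for p
    have degD: "deg p (D p)" if "p \<in> A" for p
    proof -
      have "\<exists>d. deg p d" using poly_functions_expand[OF Apoly[OF that]] unfolding deg_def by (elim exE) auto
      then show ?thesis unfolding D_def by (rule LeastI_ex)
    qed
    have D_le: "D p \<le> d" if "deg p d" for p d unfolding D_def using that by (rule Least_le)
    \<comment> \<open>A finite \<open>S\<close> lies in the ideal of some initial segment of
      \<open>f\<close>, which misses the next \<open>f n\<close>. So the ideal \<open>A\<close> is
      not finitely generated.\<close>
    have new: "\<exists>p\<in>A. p \<notin> ideal_gen ?I S" if S: "finite S" "S \<subseteq> A" for S
    proof -
      have "\<exists>n. S \<subseteq> ideal_gen ?I (f ` {..<n})" using S
      proof (induction S rule: finite_induct)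
        case (insert p S)
        then obtain a where a: "S \<subseteq> ideal_gen ?I (f ` {..<a})" by auto
        have "p \<in> ideal_gen ?I (range f)" using insert.prems by (simp add: A_def)
        from ideal_gen_range_finite[OF this] obtain b where b: "p \<in> ideal_gen ?I (f ` {..<b})" by (rule exE)
        have "p \<in> ideal_gen ?I (f ` {..<a + b})" using b by (rule ideal_gen_mono) force
        moreover have "q \<in> ideal_gen ?I (f ` {..<a + b})" if "q \<in> S" for q
          using subsetD[OF a that] by (rule ideal_gen_mono) force
        ultimately show ?case by (intro exI[of _ "a + b"]) auto
      qed simp
      then obtain n where n: "S \<subseteq> ideal_gen ?I (f ` {..<n})" by (rule exE)
      have "f n \<notin> ideal_gen ?I S" using nf[of n] ideal_gen_trans[OF _ n, of "f n"] by auto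
      moreover have "f n \<in> A" unfolding A_def by (rule ideal_gen.gen) simp
      ultimately show ?thesis by (rule bexI)
    qed
    define Q where "Q h m r \<longleftrightarrow> r \<in> A \<and> r \<notin> ideal_gen ?I (h ` {..<m}) \<and>
      (\<forall>p\<in>A. p \<notin> ideal_gen ?I (h ` {..<m}) \<longrightarrow> D r \<le> D p)" for h and m :: nat and r
    have "\<exists>h. \<forall>m. Q h m (h m)"
    proof (rule dependent_wellorder_choice)
      fix r and g h :: "nat \<Rightarrow> (('i \<Rightarrow> complex) \<Rightarrow> complex)" and m :: nat
      assume "\<And>y. y < m \<Longrightarrow> g y = h y"
      then have "g ` {..<m} = h ` {..<m}" by (intro image_cong) auto
      then show "Q g m r = Q h m r" by (simp add: Q_def)
    next
      fix m :: nat and h assume "\<And>y. y < m \<Longrightarrow> Q h y (h y)"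
      then have "h ` {..<m} \<subseteq> A" by (auto simp: Q_def)
      then obtain p where p: "p \<in> A \<and> p \<notin> ideal_gen ?I (h ` {..<m})"
        using new[of "h ` {..<m}"] by auto
      define r where "r = arg_min D (\<lambda>p. p \<in> A \<and> p \<notin> ideal_gen ?I (h ` {..<m}))"
      have "r \<in> A \<and> r \<notin> ideal_gen ?I (h ` {..<m})"
        unfolding r_def by (rule arg_min_natI[of "\<lambda>p. p \<in> A \<and> p \<notin> ideal_gen ?I (h ` {..<m})", OF p])
      moreover have "D r \<le> D p" if "p \<in> A" "p \<notin> ideal_gen ?I (h ` {..<m})" for p
        unfolding r_def
        by (rule arg_min_nat_le[of "\<lambda>p. p \<in> A \<and> p \<notin> ideal_gen ?I (h ` {..<m})"]) (simp add: that)
      ultimately show "\<exists>r. Q h m r" unfolding Q_def by auto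
    qed
    then obtain h where h: "\<forall>m. Q h m (h m)" by (rule exE)
    have hA: "h m \<in> A" and hn: "h m \<notin> ideal_gen ?I (h ` {..<m})"
      and hmin: "\<And>p. p \<in> A \<Longrightarrow> p \<notin> ideal_gen ?I (h ` {..<m}) \<Longrightarrow> D (h m) \<le> D p" for m
      using h by (simp_all add: Q_def)
    have "\<forall>m. \<exists>P. (\<forall>k. P k \<in> poly_functions I) \<and> (\<forall>x. h m x = (\<Sum>k\<le>D (h m). P k x * x i ^ k))"
      using degD[OF hA] unfolding deg_def by simp
    then obtain P where P: "\<forall>m. (\<forall>k. P m k \<in> poly_functions I) \<and> (\<forall>x. h m x = (\<Sum>k\<le>D (h m). P m k x * x i ^ k))"
      by (rule choice[THEN exE])
    define a where "a m = P m (D (h m))" for m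
    have "\<forall>m. a m \<in> poly_functions I" using P by (simp add: a_def)
    from insert.IH[OF this] obtain n where "a n \<in> ideal_gen I (a ` {..<n})" by (rule exE)
    from ideal_gen_image_combination[OF this] obtain g where g: "\<forall>k. g k \<in> poly_functions I"
      "\<forall>x. a n x = (\<Sum>k<n. g k x * a k x)" by (elim exE conjE)
    define d where "d = D (h n)"
    have Dle: "D (h k) \<le> d" if "k < n" for k
    proof -
      have "h n \<notin> ideal_gen ?I (h ` {..<k})"
      proof
        assume "h n \<in> ideal_gen ?I (h ` {..<k})"
        then have "h n \<in> ideal_gen ?I (h ` {..<n})" by (rule ideal_gen_mono) (use that in force)
        then show False using hn by simp
      qed
      from hmin[OF hA this] show ?thesis by (simp add: d_def)
    qed
    \<comment> \<open>The powers of \<open>x i\<close> lift every \<open>h k\<close> to degree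
      \<open>d\<close>, so that the leading terms add up to that of \<open>h n\<close>. By
      \<open>Dle\<close> the degrees of the predecessors do not exceed \<open>d\<close>.\<close>
    define s where "s x = (\<Sum>k<n. g k x * x i ^ (d - D (h k)) * h k x)" for x
    have gI: "g k \<in> poly_functions ?I" for k by (rule poly_functions_mono[OF g(1)[rule_format]]) blast
    have s: "s \<in> ideal_gen ?I (h ` {..<n})"
      unfolding s_def
      by (intro ideal_gen_sum ideal_gen.scale poly_functions.mult gI poly_functions_power
          poly_functions.coord ideal_gen.gen) auto
    define h' where "h' x = h n x + - 1 * s x" for x
    have h'n: "h' \<notin> ideal_gen ?I (h ` {..<n})"
    proof
      assume "h' \<in> ideal_gen ?I (h ` {..<n})"
      from ideal_gen.add[OF this s] have "h n \<in> ideal_gen ?I (h ` {..<n})" by (simp add: h'_def)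
      then show False using hn by simp
    qed
    have "s \<in> A"
      unfolding A_def using s by (rule ideal_gen_trans) (use hA A_def in auto)
    then have h'A: "h' \<in> A"
      using hA[of n] unfolding A_def h'_def by (intro ideal_gen.add ideal_gen.scale poly_functions.const)
    define R where "R l x = P n l x - (\<Sum>k<n. if l < d - D (h k) then 0 else g k x * P k (l - (d - D (h k))) x)" for l x
    have Rp: "R l \<in> poly_functions I" for l
    proof -
      have "(\<lambda>x. if l < d - D (h k) then 0 else g k x * P k (l - (d - D (h k))) x) \<in> poly_functions I" for k
        using g(1) P by (cases "l < d - D (h k)") (simp_all add: poly_functions.const poly_functions.mult)
      then show ?thesis unfolding R_def using P
        by (intro poly_functions_diff poly_functions_sum) simp_all
    qed
    have sexp: "s x = (\<Sum>l\<le>d. (\<Sum>k<n. if l < d - D (h k) then 0 else g k x * P k (l - (d - D (h k))) x) * x i ^ l)" for x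
    proof -
      have e: "g k x * x i ^ (d - D (h k)) * h k x
          = (\<Sum>l\<le>d. (if l < d - D (h k) then 0 else g k x * P k (l - (d - D (h k))) x) * x i ^ l)"
        if k: "k < n" for k
      proof -
        let ?e = "d - D (h k)"
        have "g k x * x i ^ ?e * h k x = (\<Sum>l\<le>D (h k). g k x * P k l x * x i ^ (l + ?e))"
          using P by (simp add: sum_distrib_left power_add algebra_simps)
        also have "\<dots> = (\<Sum>l\<in>{?e..d}. (if l < ?e then 0 else g k x * P k (l - ?e) x) * x i ^ l)"
          by (rule sum.reindex_bij_witness[of _ "\<lambda>l. l - ?e" "\<lambda>l. l + ?e"]) (use Dle[OF k] in auto)
        also have "\<dots> = (\<Sum>l\<le>d. (if l < ?e then 0 else g k x * P k (l - ?e) x) * x i ^ l)"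
          by (rule sum.mono_neutral_left) auto
        finally show ?thesis .
      qed
      show ?thesis unfolding s_def sum_distrib_right
        by (subst sum.swap) (intro sum.cong e, simp_all)
    qed
    have h'exp: "h' x = (\<Sum>l\<le>d. R l x * x i ^ l)" for x
      using P unfolding h'_def sexp R_def d_def by (simp add: left_diff_distrib sum_subtractf)
    have Rd: "R d x = 0" for x
    proof -
      have "(\<Sum>k<n. if d < d - D (h k) then 0 else g k x * P k (d - (d - D (h k))) x) = (\<Sum>k<n. g k x * a k x)"
        by (intro sum.cong) (use Dle in \<open>auto simp: a_def\<close>)
      then show ?thesis unfolding R_def using g(2) by (simp add: a_def d_def)
    qed
    \<comment> \<open>In degree 0 the difference \<open>h'\<close> is the zero function, which lies
      in every ideal; otherwise its degree is below \<open>d\<close>, against the minimality of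
      \<open>h n\<close>.\<close>
    show False
    proof (cases d)
      case 0
      then have "h' = (\<lambda>_. 0)" using h'exp Rd by (intro ext) simp
      then show False using h'n ideal_gen.zero by metis
    next
      case (Suc e)
      have "h' x = (\<Sum>l\<le>e. R l x * x i ^ l)" for x
        using h'exp[of x] Rd[of x] unfolding Suc by simp
      then have "deg h' e" unfolding deg_def using Rp by (intro exI[of _ R]) simp
      from D_le[OF this] have "D h' \<le> e" .
      with hmin[OF h'A h'n] show False using Suc by (simp add: d_def)
    qed
  qed
qed

text \<open>A closed set minimal with the property \<open>Q\<close> is irreducible: in a cover by
  two closed sets, one of the two parts inherits \<open>Q\<close>. This replaces the decomposition
  into components and leaves \<open>Q\<close> free, to be independence of coordinates or
  branching.\<close>

lemma irreducible_subset:
  assumes I: "finite I" and S: "S \<subseteq> affine_space I"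
    and Y: "closedin (subtopology (zariski I) S) Y" "Q Y"
    and Q: "\<And>A B. Q (A \<union> B) \<Longrightarrow> Q A \<or> Q B" "\<not> Q {}"
  obtains Y0 where "Y0 \<subseteq> Y" "Q Y0" "closedin (subtopology (zariski I) S) Y0"
    "irreducible_in (subtopology (zariski I) S) Y0"
proof -
  let ?X = "subtopology (zariski I) S"
  define \<C> where "\<C> = {Y'. Y' \<subseteq> Y \<and> Q Y' \<and> closedin ?X Y'}"
  have "\<exists>Y0\<in>\<C>. \<forall>Y'\<in>\<C>. \<not> Y' \<subset> Y0"
  proof (rule ccontr)
    assume "\<not> ?thesis"
    then have step: "\<exists>Y''\<in>\<C>. Y'' \<subset> Y'" if "Y' \<in> \<C>" for Y' using that by auto
    have "\<exists>F. \<forall>n. F n \<in> \<C> \<and> F (Suc n) \<subset> F n"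
      by (rule dependent_nat_choice[of "\<lambda>_ Y'. Y' \<in> \<C>" "\<lambda>_ Y' Y''. Y'' \<subset> Y'"])
        (use Y step in \<open>auto simp: \<C>_def\<close>)
    then obtain F where F: "\<forall>n. F n \<in> \<C> \<and> F (Suc n) \<subset> F n" by (rule exE)
    have "\<exists>f. f \<in> poly_functions I \<and> (\<forall>x\<in>F (Suc n). f x = 0) \<and> (\<exists>x\<in>F n. f x \<noteq> 0)" for n
    proof -
      have "closedin ?X (F (Suc n))" using F by (simp add: \<C>_def)
      then obtain P where P: "P \<subseteq> poly_functions I" "F (Suc n) = {x \<in> S. \<forall>p\<in>P. p x = 0}"
        unfolding closedin_subtopology_zariski[OF S] by (elim exE conjE)
      obtain x where x: "x \<in> F n" "x \<notin> F (Suc n)" using F by auto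
      have "F n \<subseteq> S" using F closedin_subset[of ?X "F n"] topspace_subtopology_zariski[OF S]
        by (simp add: \<C>_def)
      then obtain p where "p \<in> P" "p x \<noteq> 0" using x P(2) by auto
      moreover from this(1) P have "p \<in> poly_functions I" "\<forall>x\<in>F (Suc n). p x = 0" by auto
      ultimately show ?thesis using x(1) by (intro exI[of _ p] conjI bexI[of _ x])
    qed
    then have "\<forall>n. \<exists>f. f \<in> poly_functions I \<and> (\<forall>x\<in>F (Suc n). f x = 0) \<and> (\<exists>x\<in>F n. f x \<noteq> 0)" by (rule allI)
    then obtain f where f: "\<forall>n. f n \<in> poly_functions I \<and> (\<forall>x\<in>F (Suc n). f n x = 0) \<and> (\<exists>x\<in>F n. f n x \<noteq> 0)"
      by (rule choice[THEN exE])
    obtain n where n: "f n \<in> ideal_gen I (f ` {..<n})"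
      using poly_functions_noetherian[OF I, of f] f by auto
    \<comment> \<open>At a point of \<open>F n\<close> where \<open>f n\<close> is nonzero all
      earlier \<open>f k\<close> vanish, since they vanish on \<open>F (Suc k)\<close>, which
      contains \<open>F n\<close>. So \<open>f n\<close> cannot lie in the ideal of its
      predecessors.\<close>
    obtain x where x: "x \<in> F n" "f n x \<noteq> 0" using f by auto
    have dec: "F b \<subseteq> F a" if "a \<le> b" for a b
      using that by (rule lift_Suc_antimono_le[rotated]) (use F in auto)
    have "f k x = 0" if "k < n" for k
      using dec[of "Suc k" n] that x(1) f by auto
    then have "f n x = 0" by (intro ideal_gen_vanishing[OF n]) auto
    then show False using x(2) by simp
  qed
  then obtain Y0 where Y0: "Y0 \<in> \<C>" "\<forall>Y'\<in>\<C>. \<not> Y' \<subset> Y0" by (rule bexE)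
  have cl: "closedin ?X Y0" and QY: "Q Y0" and sub: "Y0 \<subseteq> Y" using Y0(1) by (simp_all add: \<C>_def)
  have "irreducible_in ?X Y0"
    unfolding irreducible_in_def
  proof (intro conjI allI impI)
    show "Y0 \<noteq> {}" using QY Q(2) by auto
    show "Y0 \<subseteq> topspace ?X" using cl by (rule closedin_subset)
    fix A B assume AB: "closedin ?X A \<and> closedin ?X B \<and> Y0 \<subseteq> A \<union> B"
    then have "Y0 = (Y0 \<inter> A) \<union> (Y0 \<inter> B)" by auto
    then have "Q (Y0 \<inter> A) \<or> Q (Y0 \<inter> B)" using Q(1)[of "Y0 \<inter> A" "Y0 \<inter> B"] QY by simp
    moreover have "Y0 \<subseteq> C" if "Q (Y0 \<inter> C)" "closedin ?X C" for C
    proof -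
      have "Y0 \<inter> C \<in> \<C>" using that cl sub by (auto simp: \<C>_def)
      then have "\<not> Y0 \<inter> C \<subset> Y0" using Y0(2) by simp
      then show ?thesis by auto
    qed
    ultimately show "Y0 \<subseteq> A \<or> Y0 \<subseteq> B" using AB by auto
  qed
  then show thesis using that[OF sub QY cl] by simp
qed

section \<open>Infinitely branching sets\<close>

text \<open>Such a set contains the leaves of a tree which branches infinitely at every level, the
  \<open>k\<close>-th level choosing the value of the \<open>k\<close>-th coordinate in the list. Unlike the dominance of
  a projection, this gives lower bounds for the Krull dimension of arbitrary subsets.\<close>

primrec branching :: "'i list \<Rightarrow> ('i \<Rightarrow> complex) set \<Rightarrow> bool" where
  "branching [] S \<longleftrightarrow> S \<noteq> {}"
| "branching (i # is) S \<longleftrightarrow> infinite {t. branching is {x \<in> S. x i = t}}"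

text \<open>The tree records only the values of the listed coordinates, so its leaves may be
  exchanged for points with the same values, possibly in another affine space.\<close>

lemma branching_transfer:
  assumes "branching xs S" "\<And>x. x \<in> S \<Longrightarrow> \<exists>y\<in>S'. \<forall>i\<in>set xs. y i = x i"
  shows "branching xs S'"
  using assms
proof (induction xs arbitrary: S S')
  case Nil
  then show ?case by auto
next
  case (Cons i xs)
  have "branching xs {x \<in> S'. x i = t}" if "branching xs {x \<in> S. x i = t}" for t
    using that by (rule Cons.IH) (use Cons.prems(2) in force)
  then have "{t. branching xs {x \<in> S. x i = t}} \<subseteq> {t. branching xs {x \<in> S'. x i = t}}" by auto
  then show ?case using Cons.prems(1) by (auto dest: finite_subset)
qed

lemma branching_mono: "branching xs S \<Longrightarrow> S \<subseteq> S' \<Longrightarrow> branching xs S'"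
  by (erule branching_transfer) auto

lemma not_branching_empty: "\<not> branching xs {}"
  by (induction xs) auto

text \<open>At each level, infinitely many values cannot be covered by two finite sets. Like
  independence, branching thus survives in one part of a finite cover and is a valid
  \<open>Q\<close> for \<open>irreducible_subset\<close>.\<close>

lemma branching_Un: "branching xs (S \<union> S') \<Longrightarrow> branching xs S \<or> branching xs S'"
proof (induction xs arbitrary: S S')
  case Nil
  then show ?case by auto
next
  case (Cons i xs)
  have e: "{x \<in> S \<union> S'. x i = t} = {x \<in> S. x i = t} \<union> {x \<in> S'. x i = t}" for t by auto
  have "{t. branching xs {x \<in> S \<union> S'. x i = t}}
      \<subseteq> {t. branching xs {x \<in> S. x i = t}} \<union> {t. branching xs {x \<in> S'. x i = t}}"
    unfolding e using Cons.IH by auto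
  then show ?case using Cons.prems by (auto dest: finite_subset)
qed

lemma branching_UN:
  assumes "finite K" "branching xs (\<Union>k\<in>K. S k)" shows "\<exists>k\<in>K. branching xs (S k)"
  using assms
proof (induction K rule: finite_induct)
  case empty
  then show ?case by (simp add: not_branching_empty)
next
  case (insert k K)
  then show ?case using branching_Un[of xs "S k" "\<Union>k\<in>K. S k"] by auto
qed

text \<open>The tree is cut at the level where \<open>xs\<close> ends. A node is represented by any
  function with the right values on \<open>xs\<close>, and the tree below it branches along
  \<open>ys\<close>.\<close>

lemma branching_append:
  assumes "branching (xs @ ys) S"
  shows "branching xs {x. branching ys {y \<in> S. \<forall>i\<in>set xs. y i = x i}}"
  using assms
proof (induction xs arbitrary: S)
  case Nil
  then show ?case by simp
next
  case (Cons i xs)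
  let ?R = "\<lambda>S xs. {x. branching ys {y \<in> S. \<forall>i\<in>set xs. y i = x i}}"
  have "branching xs {x \<in> ?R S (i # xs). x i = t}" if t: "branching (xs @ ys) {x \<in> S. x i = t}" for t
  proof (rule branching_transfer[OF Cons.IH[OF t]])
    fix x assume "x \<in> ?R {x \<in> S. x i = t} xs"
    then have b: "branching ys {y \<in> {x \<in> S. x i = t}. \<forall>i\<in>set xs. y i = x i}" by simp
    have "{y \<in> {x \<in> S. x i = t}. \<forall>i\<in>set xs. y i = x i} \<noteq> {}"
    proof
      assume e: "{y \<in> {x \<in> S. x i = t}. \<forall>i\<in>set xs. y i = x i} = {}"
      show False using b unfolding e by (simp add: not_branching_empty)
    qed
    then obtain y where y: "y \<in> S" "y i = t" "\<forall>j\<in>set xs. y j = x j" by auto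
    have "branching ys {w \<in> S. \<forall>j\<in>set (i # xs). w j = y j}"
      using b by (rule branching_mono) (use y in auto)
    then show "\<exists>y\<in>{x \<in> ?R S (i # xs). x i = t}. \<forall>i\<in>set xs. y i = x i"
      using y by (intro bexI[of _ y]) auto
  qed
  then have "{t. branching (xs @ ys) {x \<in> S. x i = t}} \<subseteq> {t. branching xs {x \<in> ?R S (i # xs). x i = t}}"
    by auto
  then show ?case using Cons.prems by (auto dest: finite_subset)
qed

text \<open>The closed set is shrunk to an irreducible one that still branches, which becomes the
  top of the chain. Its slice at one branching value \<open>t\<close> carries the remaining tree,
  and the slice is proper because a second value \<open>t'\<close> also occurs.\<close>

lemma branching_krull_dim:
  assumes I: "finite I" "set xs \<subseteq> I" and S: "S \<subseteq> affine_space I" "branching xs S"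
  shows "enat (length xs) \<le> krull_dim (subtopology (zariski I) S)"
proof -
  let ?X = "subtopology (zariski I) S"
  have "\<exists>Z. (\<forall>k\<le>length xs. closedin ?X (Z k) \<and> irreducible_in ?X (Z k)) \<and>
      (\<forall>k<length xs. Z k \<subset> Z (Suc k)) \<and> Z (length xs) \<subseteq> Y"
    if "closedin ?X Y" "branching xs Y" "set xs \<subseteq> I" for Y
    using that
  proof (induction xs arbitrary: Y)
    case Nil
    obtain Y0 where "Y0 \<subseteq> Y" "closedin ?X Y0" "irreducible_in ?X Y0"
      using irreducible_subset[OF I(1) S(1) Nil(1), where Q = "branching []"] Nil(2) branching_Un
        not_branching_empty by metis
    then show ?case by (intro exI[of _ "\<lambda>_. Y0"]) simp
  next
    case (Cons i xs)
    obtain Y0 where Y0: "Y0 \<subseteq> Y" "branching (i # xs) Y0" "closedin ?X Y0" "irreducible_in ?X Y0"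
      using irreducible_subset[OF I(1) S(1) Cons.prems(1), where Q = "branching (i # xs)"]
        Cons.prems(2) branching_Un not_branching_empty by metis
    define T where "T = {t. branching xs {x \<in> Y0. x i = t}}"
    have inf: "infinite T" using Y0(2) by (simp add: T_def)
    then obtain t where t: "t \<in> T" by (metis finite.emptyI ex_in_conv)
    have "infinite (T - {t})" using inf by simp
    then obtain t' where t': "t' \<in> T" "t' \<noteq> t" by (metis finite.emptyI ex_in_conv DiffE singletonI)
    have "{x \<in> Y0. x i = t'} \<noteq> {}"
    proof
      assume e: "{x \<in> Y0. x i = t'} = {}"
      show False using t'(1) unfolding T_def mem_Collect_eq e by (simp add: not_branching_empty)
    qed
    then have ne: "{x \<in> Y0. x i = t} \<subset> Y0" using t'(2) by auto
    have "closedin ?X {x \<in> Y0. x i - t = 0}"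
      by (rule closedin_vanishing[OF S(1) _ Y0(3)])
        (use Cons.prems(3) in \<open>simp add: poly_functions.coord poly_functions.const poly_functions_diff\<close>)
    then have "closedin ?X {x \<in> Y0. x i = t}" by simp
    moreover have "branching xs {x \<in> Y0. x i = t}" using t by (simp add: T_def)
    ultimately obtain Z where Z: "\<forall>k\<le>length xs. closedin ?X (Z k) \<and> irreducible_in ?X (Z k)"
      "\<forall>k<length xs. Z k \<subset> Z (Suc k)" "Z (length xs) \<subseteq> {x \<in> Y0. x i = t}"
      using Cons.IH[of "{x \<in> Y0. x i = t}"] Cons.prems(3) by auto
    let ?Z = "Z(Suc (length xs) := Y0)"
    have "\<forall>k\<le>length (i # xs). closedin ?X (?Z k) \<and> irreducible_in ?X (?Z k)"
      using Z(1) Y0(3,4) by (auto simp: le_Suc_eq)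
    moreover have "\<forall>k<length (i # xs). ?Z k \<subset> ?Z (Suc k)"
      using Z(2,3) ne by (auto simp: less_Suc_eq)
    moreover have "?Z (length (i # xs)) \<subseteq> Y" using Y0(1) by simp
    ultimately show ?case by (intro exI[of _ ?Z]) simp
  qed
  from this[of S] obtain Z where "\<forall>k\<le>length xs. closedin ?X (Z k) \<and> irreducible_in ?X (Z k)"
      "\<forall>k<length xs. Z k \<subset> Z (Suc k)"
    using I(2) S(2) closedin_topspace[of ?X] topspace_subtopology_zariski[OF S(1)] by auto
  then show ?thesis by (rule krull_dim_geI)
qed

section \<open>Generic points\<close>

lemma complex_polynomial_root:
  fixes a :: "nat \<Rightarrow> complex"
  assumes "n > 0" "a n \<noteq> 0"
  shows "\<exists>t. (\<Sum>k\<le>n. a k * t ^ k) = 0"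
proof -
  define p where "p = (\<Sum>k\<le>n. monom (a k) k)"
  have "coeff p n = a n" unfolding p_def by (simp add: coeff_sum)
  then have "degree p > 0" using assms le_degree[of p n] by auto
  then have "\<not> constant (poly p)" by (simp add: constant_degree)
  then obtain t where "poly p t = 0" using fundamental_theorem_of_algebra by blast
  then show ?thesis unfolding p_def by (intro exI[of _ t]) (simp add: poly_sum poly_monom)
qed

context coord_basis
begin

text \<open>The coordinates outside \<open>J\<close> are lifted one at a time, as roots of minimal relations over
  the coordinates already present; pseudo-division by the minimal relation shows that the
  lifted point satisfies all equations of \<open>Z\<close>.\<close>

lemma generic_lift_aux:
  assumes "finite K" "K \<subseteq> I - J" "g \<in> poly_functions (J \<union> K)" "\<not> (\<forall>z\<in>Z. g z = 0)"
  shows "\<exists>q\<in>poly_functions J. (\<exists>u. q u \<noteq> 0) \<and> (\<forall>c. q c \<noteq> 0 \<longrightarrow>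
    (\<exists>z. (\<forall>p\<in>poly_functions (J \<union> K). (\<forall>w\<in>Z. p w = 0) \<longrightarrow> p z = 0) \<and> g z \<noteq> 0 \<and> (\<forall>j\<in>J. z j = c j)))"
  using assms
proof (induction K arbitrary: g rule: finite_induct)
  case empty
  have g: "g \<in> poly_functions J" using empty by simp
  obtain w where w: "g w \<noteq> 0" using empty.prems(3) by blast
  show ?case
  proof (intro bexI[OF _ g] conjI allI impI)
    show "\<exists>u. g u \<noteq> 0" using w by (rule exI[of "\<lambda>u. g u \<noteq> 0"])
    fix c assume c: "g c \<noteq> 0"
    have "p c = 0" if "p \<in> poly_functions (J \<union> {})" "\<forall>w\<in>Z. p w = 0" for p
      using alg_indepD[OF indep, of p c] that by simp
    then show "\<exists>z. (\<forall>p\<in>poly_functions (J \<union> {}). (\<forall>w\<in>Z. p w = 0) \<longrightarrow> p z = 0) \<and> g z \<noteq> 0 \<and> (\<forall>j\<in>J. z j = c j)"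
      using c by (intro exI[of _ c]) simp
  qed
next
  case (insert i K)
  define I0 where "I0 = J \<union> K"
  have I1: "J \<union> insert i K = insert i I0" by (auto simp: I0_def)
  have iI: "i \<in> I - J" and KI: "K \<subseteq> I - J" using insert.prems(1) by auto
  have iI0: "i \<notin> I0" using iI insert.hyps(2) by (auto simp: I0_def)
  have JI0: "J \<subseteq> I0" by (auto simp: I0_def)
  have sub1: "insert i I0 \<subseteq> I" using iI KI sub by (auto simp: I0_def)
  have g: "g \<in> poly_functions (insert i I0)" using insert.prems(2) unfolding I1 .
  interpret B: coord_basis "insert i I0" J Z
    by unfold_locales
      (use sub1 JI0 fin finite_subset irr indep max in \<open>auto intro: poly_irreducible_mono finite_subset[of "insert i I0" I]\<close>)
  have up: "p \<in> poly_functions (insert i I0)" if "p \<in> poly_functions I0" for p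
    using that by (rule poly_functions_mono) auto
  \<comment> \<open>The least degree \<open>n\<close> of such a relation is that of the minimal
    polynomial of the coordinate \<open>i\<close> over the coordinates in \<open>I0\<close>; it may
    be smaller than the degree of a relation over \<open>J\<close>.\<close>
  define rel where "rel n c \<longleftrightarrow> (\<forall>k. c k \<in> poly_functions I0) \<and> \<not> (\<forall>z\<in>Z. c n z = 0) \<and>
    (\<forall>z\<in>Z. (\<Sum>k\<le>n. c k z * z i ^ k) = 0)" for n :: nat and c
  have "\<exists>n c. rel n c"
  proof -
    obtain c n u where c: "\<forall>k. c k \<in> poly_functions J" "c n u \<noteq> 0" "\<forall>z\<in>Z. (\<Sum>k\<le>n. c k z * z i ^ k) = 0"
      using algebraic_relation[OF indep max[OF iI]] by (elim exE conjE)
    have "c k \<in> poly_functions I0" for k by (rule poly_functions_mono[OF c(1)[rule_format] JI0])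
    moreover have "\<not> (\<forall>z\<in>Z. c n z = 0)" by (rule indep_not_vanishing[OF c(1)[rule_format] c(2)])
    ultimately have "rel n c" using c(3) by (simp add: rel_def)
    then have "\<exists>c. rel n c" by (rule exI[of "rel n"])
    then show ?thesis by (rule exI[of "\<lambda>n. \<exists>c. rel n c"])
  qed
  define n where "n = (LEAST n. \<exists>c. rel n c)"
  have "\<exists>c. rel n c" unfolding n_def using \<open>\<exists>n c. rel n c\<close> by (rule LeastI_ex)
  then obtain c where relc: "rel n c" by (rule exE)
  have least: "n \<le> m" if "rel m d" for m d
    unfolding n_def by (rule Least_le, rule exI[of "rel m"], rule that)
  have c: "c k \<in> poly_functions I0" for k using relc by (simp add: rel_def)
  have cn: "\<not> (\<forall>z\<in>Z. c n z = 0)" using relc by (simp add: rel_def)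
  have cz: "(\<Sum>k\<le>n. c k z * z i ^ k) = 0" if "z \<in> Z" for z using relc that by (simp add: rel_def)
  have n: "n > 0"
  proof (rule ccontr)
    assume "\<not> n > 0"
    then have "c n z = 0" if "z \<in> Z" for z using cz[OF that] by simp
    then show False using cn by simp
  qed
  \<comment> \<open>Pseudo-remainders of degree below \<open>n\<close>. The identity is asked at
    every \<open>x\<close> that satisfies the minimal relation, not only on \<open>Z\<close>,
    because it will be evaluated at the lifted point, which is not yet known to satisfy the
    equations of \<open>Z\<close>.\<close>
  define Red where "Red h \<longleftrightarrow> (\<exists>N r. (\<forall>k. r k \<in> poly_functions I0) \<and>
    (\<forall>x. (\<Sum>k\<le>n. c k x * x i ^ k) = 0 \<longrightarrow> c n x ^ N * h x = (\<Sum>k<n. r k x * x i ^ k)))" for h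
  have Red_power: "Red (\<lambda>x. x i ^ m)" for m
  proof (induction m)
    case 0
    have "(\<Sum>k<n. (if k = 0 then 1 else 0) * x i ^ k) = 1" for x :: "'i \<Rightarrow> complex"
      using n by (simp add: if_distrib[of "\<lambda>y. y * _"] cong: if_cong)
    then show ?case unfolding Red_def
      by (intro exI[of _ "0::nat"] exI[of _ "\<lambda>k _. if k = (0::nat) then 1 else 0"]) (simp add: poly_functions.const)
  next
    case (Suc m)
    then obtain N r where r: "\<forall>k. r k \<in> poly_functions I0"
      "\<forall>x. (\<Sum>k\<le>n. c k x * x i ^ k) = 0 \<longrightarrow> c n x ^ N * x i ^ m = (\<Sum>k<n. r k x * x i ^ k)"
      unfolding Red_def by (elim exE conjE)
    \<comment> \<open>Multiplication by \<open>x i\<close> shifts the remainder by one degree. Its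
      new term of degree \<open>n\<close>, with coefficient \<open>r (n - 1)\<close>, is traded for
      the lower terms of the relation at the cost of one more factor \<open>c n\<close>.\<close>
    define s where "s k x = (if k = 0 then 0 else c n x * r (k - 1) x) - r (n - 1) x * c k x" for k x
    have "s k \<in> poly_functions I0" for k
    proof (cases "k = 0")
      case True
      then show ?thesis unfolding s_def using r(1) c
        by (simp add: poly_functions_uminus poly_functions.mult)
    next
      case False
      then show ?thesis unfolding s_def using r(1) c
        by (simp add: poly_functions_diff poly_functions.mult)
    qed
    moreover have "c n x ^ Suc N * x i ^ Suc m = (\<Sum>k<n. s k x * x i ^ k)"
      if x: "(\<Sum>k\<le>n. c k x * x i ^ k) = 0" for x
    proof -
      obtain n' where n': "n = Suc n'" using n by (cases n) auto
      have top: "c n x * x i ^ n = - (\<Sum>k<n. c k x * x i ^ k)"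
        using x by (simp add: lessThan_Suc_atMost[symmetric] eq_neg_iff_add_eq_0 add.commute)
      have "c n x ^ Suc N * x i ^ Suc m = c n x * x i * (c n x ^ N * x i ^ m)" by simp
      also have "c n x ^ N * x i ^ m = (\<Sum>k<n'. r k x * x i ^ k) + r n' x * x i ^ n'"
        using r(2) x by (simp add: n')
      also have "c n x * x i * \<dots> = (\<Sum>k<n'. c n x * r k x * x i ^ Suc k) + r n' x * (c n x * x i ^ n)"
        by (simp add: n' distrib_left sum_distrib_left algebra_simps)
      also have "(\<Sum>k<n'. c n x * r k x * x i ^ Suc k) = (\<Sum>k<n. (if k = 0 then 0 else c n x * r (k - 1) x) * x i ^ k)"
        unfolding n' sum.lessThan_Suc_shift by simp
      also have "r n' x * (c n x * x i ^ n) = - (\<Sum>k<n. r n' x * c k x * x i ^ k)"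
        unfolding top by (simp add: sum_distrib_left mult.assoc)
      finally show ?thesis
        by (simp add: s_def n' left_diff_distrib sum_subtractf)
    qed
    ultimately show ?case unfolding Red_def
      by (intro exI[of _ "Suc N"] exI[of _ s]) blast
  qed
  have Red_add: "Red (\<lambda>x. h x + h' x)" if "Red h" "Red h'" for h h'
  proof -
    obtain N r where r: "\<forall>k. r k \<in> poly_functions I0"
      "\<forall>x. (\<Sum>k\<le>n. c k x * x i ^ k) = 0 \<longrightarrow> c n x ^ N * h x = (\<Sum>k<n. r k x * x i ^ k)"
      using \<open>Red h\<close> unfolding Red_def by (elim exE conjE)
    obtain N' r' where r': "\<forall>k. r' k \<in> poly_functions I0"
      "\<forall>x. (\<Sum>k\<le>n. c k x * x i ^ k) = 0 \<longrightarrow> c n x ^ N' * h' x = (\<Sum>k<n. r' k x * x i ^ k)"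
      using \<open>Red h'\<close> unfolding Red_def by (elim exE conjE)
    let ?s = "\<lambda>k x. c n x ^ N' * r k x + c n x ^ N * r' k x"
    have "?s k \<in> poly_functions I0" for k
      using r(1) r'(1) c by (intro poly_functions.add poly_functions.mult poly_functions_power) simp_all
    moreover have "c n x ^ (N + N') * (h x + h' x) = (\<Sum>k<n. ?s k x * x i ^ k)"
      if x: "(\<Sum>k\<le>n. c k x * x i ^ k) = 0" for x
    proof -
      have "c n x ^ (N + N') * (h x + h' x) = c n x ^ N' * (c n x ^ N * h x) + c n x ^ N * (c n x ^ N' * h' x)"
        by (simp add: power_add algebra_simps)
      also have "\<dots> = c n x ^ N' * (\<Sum>k<n. r k x * x i ^ k) + c n x ^ N * (\<Sum>k<n. r' k x * x i ^ k)"
        using r(2) r'(2) x by simp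
      finally show ?thesis by (simp add: sum_distrib_left sum.distrib distrib_right mult.assoc)
    qed
    ultimately show ?thesis unfolding Red_def
      by (intro exI[of _ "N + N'"] exI[of _ ?s]) blast
  qed
  have Red_scale: "Red (\<lambda>x. P x * h x)" if P: "P \<in> poly_functions I0" and h: "Red h" for P h
  proof -
    obtain N r where r: "\<forall>k. r k \<in> poly_functions I0"
      "\<forall>x. (\<Sum>k\<le>n. c k x * x i ^ k) = 0 \<longrightarrow> c n x ^ N * h x = (\<Sum>k<n. r k x * x i ^ k)"
      using h unfolding Red_def by (elim exE conjE)
    let ?s = "\<lambda>k x. P x * r k x"
    have "?s k \<in> poly_functions I0" for k using r(1) P by (intro poly_functions.mult) simp_all
    moreover have "c n x ^ N * (P x * h x) = (\<Sum>k<n. ?s k x * x i ^ k)"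
      if x: "(\<Sum>k\<le>n. c k x * x i ^ k) = 0" for x
    proof -
      have "c n x ^ N * (P x * h x) = P x * (c n x ^ N * h x)" by simp
      also have "\<dots> = P x * (\<Sum>k<n. r k x * x i ^ k)" using r(2) x by simp
      finally show ?thesis by (simp add: sum_distrib_left mult.assoc)
    qed
    ultimately show ?thesis unfolding Red_def
      by (intro exI[of _ N] exI[of _ ?s]) blast
  qed
  have Red: "Red h" if h: "h \<in> poly_functions (insert i I0)" for h
  proof -
    obtain P m where P: "\<forall>k. P k \<in> poly_functions I0" "\<forall>x. h x = (\<Sum>k\<le>m. P k x * x i ^ k)"
      using poly_functions_expand[OF h] by (elim exE conjE)
    have "Red (\<lambda>x. \<Sum>k\<le>m. P k x * x i ^ k)" for m
    proof (induction m)
      case 0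
      show ?case using Red_scale[OF P(1)[rule_format] Red_power[of 0]] by simp
    next
      case (Suc m)
      show ?case using Red_add[OF Suc Red_scale[OF P(1)[rule_format] Red_power[of "Suc m"]]] by simp
    qed
    moreover have "h = (\<lambda>x. \<Sum>k\<le>m. P k x * x i ^ k)" using P(2) by (intro ext) simp
    ultimately show ?thesis by simp
  qed
  \<comment> \<open>On \<open>Z\<close> the function \<open>g\<close> divides a polynomial
    \<open>c0\<close> in the coordinates \<open>J\<close> alone, so \<open>g\<close> is nonzero at
    the lift as soon as \<open>c0\<close> is. The induction hypothesis is applied to
    \<open>c n * c0\<close>, which also keeps the leading coefficient nonzero.\<close>
  obtain c0 h0 where c0: "c0 \<in> poly_functions J" and h0: "h0 \<in> poly_functions (insert i I0)"
    and c0n: "\<exists>u. c0 u \<noteq> 0" and c0z: "\<forall>z\<in>Z. c0 z = g z * h0 z"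
    using B.divides_basis_polynomial[OF g insert.prems(3)] by (elim bexE conjE)
  have c00: "c0 \<in> poly_functions I0" using c0 JI0 by (rule poly_functions_mono)
  have c0nz: "\<not> (\<forall>z\<in>Z. c0 z = 0)" using c0n by (elim exE) (rule indep_not_vanishing[OF c0])
  let ?g0 = "\<lambda>x. c n x * c0 x"
  have g0: "?g0 \<in> poly_functions (J \<union> K)" using c c00 by (simp add: I0_def poly_functions.mult)
  have "\<not> (\<forall>z\<in>Z. ?g0 z = 0)"
  proof
    assume "\<forall>z\<in>Z. ?g0 z = 0"
    then have "\<forall>z\<in>Z. c0 z = 0"
      using poly_irreducible_cancel[OF B.irr up[OF c] up[OF c00] cn] by simp
    then show False using c0nz by simp
  qed
  from insert.IH[OF KI g0 this] obtain q where q: "q \<in> poly_functions J" "\<exists>u. q u \<noteq> 0"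
    and lift: "\<forall>d. q d \<noteq> 0 \<longrightarrow> (\<exists>z. (\<forall>p\<in>poly_functions (J \<union> K). (\<forall>w\<in>Z. p w = 0) \<longrightarrow> p z = 0) \<and>
      ?g0 z \<noteq> 0 \<and> (\<forall>j\<in>J. z j = d j))" by (elim bexE conjE)
  show ?case
  proof (intro bexI[OF _ q(1)] conjI q(2) allI impI)
    fix d assume qd: "q d \<noteq> 0"
    obtain z0 where z0: "\<forall>p\<in>poly_functions I0. (\<forall>w\<in>Z. p w = 0) \<longrightarrow> p z0 = 0"
      and g0z: "?g0 z0 \<noteq> 0" and z0d: "\<forall>j\<in>J. z0 j = d j"
      using mp[OF spec[OF lift] qd] unfolding I0_def[symmetric] by (elim exE conjE)
    obtain t where t: "(\<Sum>k\<le>n. c k z0 * t ^ k) = 0"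
      using complex_polynomial_root[of n "\<lambda>k. c k z0"] n g0z by auto
    define z where "z = z0(i := t)"
    have zz0: "p z = p z0" if "p \<in> poly_functions I0" for p
      using that by (rule poly_functions_cong) (use iI0 in \<open>auto simp: z_def\<close>)
    have zr: "(\<Sum>k\<le>n. c k z * z i ^ k) = 0" using t by (simp add: zz0[OF c]) (simp add: z_def)
    have cl: "p z = 0" if p: "p \<in> poly_functions (insert i I0)" "\<forall>w\<in>Z. p w = 0" for p
    proof -
      obtain N r where r: "\<forall>k. r k \<in> poly_functions I0"
        "\<forall>x. (\<Sum>k\<le>n. c k x * x i ^ k) = 0 \<longrightarrow> c n x ^ N * p x = (\<Sum>k<n. r k x * x i ^ k)"
        using Red[OF p(1)] unfolding Red_def by (elim exE conjE)
      \<comment> \<open>Otherwise the highest coefficient that does not vanish on \<open>Z\<close>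
        would be the top of a relation of degree below \<open>n\<close>.\<close>
      have rz: "\<forall>w\<in>Z. r k w = 0" if "k < n" for k
      proof (rule ccontr)
        assume nk: "\<not> (\<forall>w\<in>Z. r k w = 0)"
        let ?M = "{k. k < n \<and> \<not> (\<forall>w\<in>Z. r k w = 0)}"
        define m where "m = Max ?M"
        have fM: "finite ?M" by simp
        have "k \<in> ?M" using that nk by simp
        then have "m \<in> ?M" unfolding m_def by (intro Max_in[OF fM]) auto
        then have m: "m < n" "\<not> (\<forall>w\<in>Z. r m w = 0)" by auto
        have above: "r l w = 0" if l: "l < n" "m < l" and w: "w \<in> Z" for l w
        proof (rule ccontr)
          assume "r l w \<noteq> 0"
          then have "l \<in> ?M" using l w by auto
          then have "l \<le> m" unfolding m_def by (rule Max_ge[OF fM])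
          then show False using l by simp
        qed
        have "(\<Sum>l\<le>m. r l w * w i ^ l) = 0" if w: "w \<in> Z" for w
        proof -
          have "(\<Sum>l\<le>m. r l w * w i ^ l) = (\<Sum>l<n. r l w * w i ^ l)"
            by (rule sum.mono_neutral_left) (use m above w in auto)
          also have "\<dots> = 0" using r(2)[rule_format, OF cz[OF w]] p(2) w by simp
          finally show ?thesis .
        qed
        then have "rel m r" using r(1) m(2) by (simp add: rel_def)
        from least[OF this] show False using m(1) by simp
      qed
      have "r k z = 0" if "k < n" for k
        using zz0[OF r(1)[rule_format]] z0 r(1) rz[OF that] by simp
      then have "c n z ^ N * p z = 0" using r(2)[rule_format, OF zr] by simp
      then show ?thesis using g0z zz0[OF c] by simp
    qed
    have "(\<lambda>x. c0 x - g x * h0 x) \<in> poly_functions (insert i I0)"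
      using up[OF c00] g h0 by (intro poly_functions_diff poly_functions.mult)
    from cl[OF this] have "c0 z - g z * h0 z = 0" using c0z by simp
    moreover have "c0 z \<noteq> 0" using zz0[OF c00] g0z by simp
    ultimately have gz: "g z \<noteq> 0" by auto
    have zd: "\<forall>j\<in>J. z j = d j" using z0d iI by (auto simp: z_def)
    show "\<exists>z. (\<forall>p\<in>poly_functions (J \<union> insert i K). (\<forall>w\<in>Z. p w = 0) \<longrightarrow> p z = 0) \<and> g z \<noteq> 0 \<and> (\<forall>j\<in>J. z j = d j)"
      unfolding I1 by (rule exI[of _ z]) (use cl gz zd in \<open>intro conjI ballI impI; simp\<close>)
  qed
qed

text \<open>With \<open>K = I - J\<close>, \<open>generic_lift_aux\<close> yields a point at which
  all polynomials vanishing on \<open>Z\<close> vanish; restricted to \<open>I\<close> it lies in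
  the closed set \<open>Z\<close>. So the projection of the part of \<open>Z\<close> where
  \<open>g\<close> is nonzero contains a nonempty open set.\<close>

lemma generic_lift:
  assumes g: "g \<in> poly_functions I" "\<not> (\<forall>z\<in>Z. g z = 0)" and Z: "closedin (zariski I) Z"
  shows "\<exists>q\<in>poly_functions J. (\<exists>u. q u \<noteq> 0) \<and>
    (\<forall>c. q c \<noteq> 0 \<longrightarrow> (\<exists>z\<in>{z \<in> Z. g z \<noteq> 0}. \<forall>j\<in>J. z j = c j))"
proof -
  have I: "J \<union> (I - J) = I" using sub by auto
  have fIJ: "finite (I - J)" using fin by simp
  have gI: "g \<in> poly_functions (J \<union> (I - J))" using g(1) unfolding I .
  obtain q where q: "q \<in> poly_functions J" "\<exists>u. q u \<noteq> 0"
    and lift: "\<forall>c. q c \<noteq> 0 \<longrightarrow> (\<exists>z. (\<forall>p\<in>poly_functions I. (\<forall>w\<in>Z. p w = 0) \<longrightarrow> p z = 0) \<and>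
      g z \<noteq> 0 \<and> (\<forall>j\<in>J. z j = c j))"
    using generic_lift_aux[OF fIJ subset_refl gI g(2)] unfolding I by (elim bexE conjE)
  obtain P where P: "P \<subseteq> poly_functions I" "Z = zero_locus I P"
    using Z unfolding closedin_zariski by (elim exE conjE)
  show ?thesis
  proof (intro bexI[OF _ q(1)] conjI q(2) allI impI)
    fix c assume qc: "q c \<noteq> 0"
    obtain z where z: "\<forall>p\<in>poly_functions I. (\<forall>w\<in>Z. p w = 0) \<longrightarrow> p z = 0"
      "g z \<noteq> 0" "\<forall>j\<in>J. z j = c j"
      using mp[OF spec[OF lift] qc] by (elim exE conjE)
    define y where "y = restrict z I"
    have yz: "p y = p z" if "p \<in> poly_functions I" for p
      using that by (rule poly_functions_cong) (simp add: y_def)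
    have "p y = 0" if p: "p \<in> P" for p
    proof -
      have pI: "p \<in> poly_functions I" using p P(1) by auto
      have "\<forall>w\<in>Z. p w = 0" using p P(2) by (simp add: zero_locus_def)
      then have "p z = 0" using z(1) pI by simp
      then show ?thesis using yz[OF pI] by simp
    qed
    then have "y \<in> Z" using P(2) by (simp add: zero_locus_def affine_space_def y_def)
    moreover have "g y \<noteq> 0" using z(2) yz[OF g(1)] by simp
    moreover have "\<forall>j\<in>J. y j = c j" using z(3) sub by (auto simp: y_def)
    ultimately show "\<exists>z\<in>{z \<in> Z. g z \<noteq> 0}. \<forall>j\<in>J. z j = c j" by (intro bexI[of _ y]) simp_all
  qed
qed

end

text \<open>The coordinates of the witness \<open>u\<close> are replaced one at a time by values at
  which \<open>q\<close> stays nonzero; infinitely many values qualify at each level.\<close>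

lemma branchingI_generic:
  assumes "distinct xs" "q \<in> poly_functions (set xs)" "q u \<noteq> 0"
    "\<And>c. q c \<noteq> 0 \<Longrightarrow> \<exists>z\<in>S. \<forall>j\<in>set xs. z j = c j"
  shows "branching xs S"
  using assms
proof (induction xs arbitrary: q u S)
  case Nil
  then show ?case by auto
next
  case (Cons i xs)
  have "branching xs {x \<in> S. x i = t}" if t: "q (u(i := t)) \<noteq> 0" for t
  proof (rule Cons.IH[of "\<lambda>c. q (c(i := t))" u])
    show "distinct xs" using Cons.prems(1) by simp
    show "(\<lambda>c. q (c(i := t))) \<in> poly_functions (set xs)"
      using Cons.prems(2) by (intro poly_functions_upd) simp
    show "q (u(i := t)) \<noteq> 0" by (rule t)
    fix c assume "q (c(i := t)) \<noteq> 0"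
    from Cons.prems(4)[OF this] obtain z where z: "z \<in> S" "\<forall>j\<in>set (i # xs). z j = (c(i := t)) j"
      by (rule bexE)
    moreover have "i \<notin> set xs" using Cons.prems(1) by simp
    ultimately show "\<exists>z\<in>{x \<in> S. x i = t}. \<forall>j\<in>set xs. z j = c j"
      by (intro bexI[of _ z]) auto
  qed
  then have "{t. q (u(i := t)) \<noteq> 0} \<subseteq> {t. branching xs {x \<in> S. x i = t}}" by auto
  moreover have "infinite {t. q (u(i := t)) \<noteq> 0}"
    using Cons.prems(2,3) by (rule poly_functions_upd_infinite)
  ultimately show ?case by (auto dest: finite_subset)
qed

lemma (in coord_basis) branching_generic:
  assumes "distinct xs" "set xs = J" "g \<in> poly_functions I" "\<not> (\<forall>z\<in>Z. g z = 0)"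
    "closedin (zariski I) Z"
  shows "branching xs {z \<in> Z. g z \<noteq> 0}"
proof -
  obtain q u where q: "q \<in> poly_functions J"
    "\<forall>c. q c \<noteq> 0 \<longrightarrow> (\<exists>z\<in>{z \<in> Z. g z \<noteq> 0}. \<forall>j\<in>J. z j = c j)" "q u \<noteq> 0"
    using generic_lift[OF assms(3-5)] by (elim bexE conjE exE)
  show ?thesis
    using assms(1) q(1)[folded assms(2)] q(3)
    by (rule branchingI_generic) (use q(2) assms(2) in simp)
qed

section \<open>Independent coordinates on closed sets\<close>

lemma irreducible_subset_alg_indep:
  assumes I: "finite I" and X: "closedin (zariski I) X" and J: "alg_indep J X"
  obtains Z where "Z \<subseteq> X" "closedin (zariski I) Z" "poly_irreducible I Z" "alg_indep J Z"
proof -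
  have e: "subtopology (zariski I) (affine_space I) = zariski I"
    by (simp add: subtopology_topspace topspace_zariski[symmetric])
  have X': "closedin (subtopology (zariski I) (affine_space I)) X" using X by (simp add: e)
  obtain Z where Z: "Z \<subseteq> X" "alg_indep J Z" "closedin (subtopology (zariski I) (affine_space I)) Z"
    "irreducible_in (subtopology (zariski I) (affine_space I)) Z"
    using I subset_refl X' J alg_indep_Un not_alg_indep_empty by (rule irreducible_subset)
  have "poly_irreducible I Z" using irreducible_in_poly_irreducible[OF subset_refl Z(4)] .
  then show thesis using that Z(1-3) by (simp add: e)
qed

text \<open>Converse of \<open>krull_dim_alg_indep\<close> for closed sets: on an irreducible closed
  subset \<open>J\<close> extends to a basis, and the generic points form a tree over its
  coordinates. Closedness is what puts the lifted points into the set.\<close>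

lemma alg_indep_krull_dim:
  assumes I: "finite I" "J \<subseteq> I" and X: "closedin (zariski I) X" and J: "alg_indep J X"
  shows "enat (card J) \<le> krull_dim (subtopology (zariski I) X)"
proof -
  obtain Z where Z: "Z \<subseteq> X" "closedin (zariski I) Z" "poly_irreducible I Z" "alg_indep J Z"
    using irreducible_subset_alg_indep[OF I(1) X J] .
  obtain K where K: "J \<subseteq> K" "K \<subseteq> I" "alg_indep K Z" "\<forall>i\<in>I - K. \<not> alg_indep (insert i K) Z"
    using alg_indep_extend[OF I Z(4)] .
  interpret coord_basis I K Z by unfold_locales (use I K Z in simp_all)
  obtain xs where xs: "set xs = K" "distinct xs" using finite_distinct_list[OF finJ] by auto
  have "\<not> (\<forall>z\<in>Z. (1::complex) = 0)" using poly_irreducible_nonempty[OF Z(3)] by auto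
  then have "branching xs {z \<in> Z. (1::complex) \<noteq> 0}"
    by (rule branching_generic[OF xs(2,1) poly_functions.const[of 1] _ Z(2)])
  then have "branching xs X" by (rule branching_mono) (use Z(1) in auto)
  moreover have XI: "X \<subseteq> affine_space I" using closedin_subset[OF X] by (simp add: topspace_zariski)
  moreover have "set xs \<subseteq> I" using xs K by simp
  ultimately have "enat (length xs) \<le> krull_dim (subtopology (zariski I) X)"
    using branching_krull_dim[OF I(1)] by simp
  moreover have "card J \<le> length xs"
    using xs card_mono[OF finJ K(1)] by (simp add: distinct_card[symmetric])
  ultimately show ?thesis by (meson enat_ord_simps(1) order_trans)
qed

section \<open>Dimension and fibres\<close>

lemma krull_dim_le_card:
  assumes I: "finite I" and S: "S \<subseteq> affine_space I"
  shows "krull_dim (subtopology (zariski I) S) \<le> enat (card I)"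
proof (rule ccontr)
  assume "\<not> ?thesis"
  then have d: "enat (Suc (card I)) \<le> krull_dim (subtopology (zariski I) S)"
    using ileI1[of "enat (card I)"] by (simp add: eSuc_enat)
  obtain e Z where "Suc (card I) \<le> e" "\<forall>k\<le>e. closedin (subtopology (zariski I) S) (Z k) \<and>
      irreducible_in (subtopology (zariski I) S) (Z k)" "\<forall>k<e. Z k \<subset> Z (Suc k)"
    using krull_dim_geE[OF d zero_less_Suc] .
  from this(2) have "irreducible_in (subtopology (zariski I) S) (Z 0)" by simp
  then have "S \<noteq> {}" unfolding irreducible_in_def by auto
  from krull_dim_alg_indep[OF I S this d] obtain J where J: "J \<subseteq> I" "card J = Suc (card I)" by auto
  show False using card_mono[OF I J(1)] J(2) by simp
qed

lemma krull_dim_nat: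
  assumes "finite I" "S \<subseteq> affine_space I"
  obtains k where "krull_dim (subtopology (zariski I) S) = enat k" "k \<le> card I"
  using krull_dim_le_card[OF assms] by (cases "krull_dim (subtopology (zariski I) S)") auto

text \<open>\<open>override_on y a A\<close> takes the coordinates in \<open>A\<close> from
  \<open>a\<close> and the others from \<open>y\<close>. The fibre thus lies in the affine space of
  \<open>B\<close> itself, where its codimension is measured.\<close>

definition fibre :: "'i set \<Rightarrow> 'i set \<Rightarrow> ('i \<Rightarrow> complex) set \<Rightarrow> ('i \<Rightarrow> complex) \<Rightarrow> ('i \<Rightarrow> complex) set" where
  "fibre A B X a = {y \<in> affine_space B. override_on y a A \<in> X}"

lemma poly_functions_override_on_left:
  assumes "p \<in> poly_functions (J \<union> K)" "K \<subseteq> A"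
  shows "(\<lambda>y. p (override_on y a A)) \<in> poly_functions J"
proof -
  have "(\<lambda>y. override_on y a A l) \<in> poly_functions J" if "l \<in> J \<union> K" for l
    using that assms(2) by (cases "l \<in> A") (auto simp: override_on_def intro: poly_functions.const poly_functions.coord)
  from poly_functions_subst[OF assms(1) this] show ?thesis by simp
qed

lemma poly_functions_override_on_right:
  assumes "p \<in> poly_functions (J \<union> K)" "J \<inter> A = {}"
  shows "(\<lambda>a. p (override_on y a A)) \<in> poly_functions K"
proof -
  have "(\<lambda>a. override_on y a A l) \<in> poly_functions K" if "l \<in> J \<union> K" for l
    using that assms(2) by (cases "l \<in> A") (auto simp: override_on_def intro: poly_functions.const poly_functions.coord)
  from poly_functions_subst[OF assms(1) this] show ?thesis by simp
qed

lemma override_on_affine_space: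
  assumes "a \<in> affine_space A" "y \<in> affine_space B"
  shows "override_on y a A \<in> affine_space (A \<union> B)"
  using assms by (auto simp: affine_space_def override_on_def PiE_iff extensional_def)

lemma fibre_subset_affine_space: "fibre A B X a \<subseteq> affine_space B"
  by (auto simp: fibre_def)

lemma alg_indep_UN:
  assumes "finite K" "alg_indep J (\<Union>k\<in>K. S k)" shows "\<exists>k\<in>K. alg_indep J (S k)"
  using assms
proof (induction K rule: finite_induct)
  case empty
  then show ?case by (simp add: not_alg_indep_empty)
next
  case (insert k K)
  then show ?case using alg_indep_Un[of J "S k" "\<Union>k\<in>K. S k"] by auto
qed

text \<open>Each fibre over \<open>S\<close> has an independent set of \<open>j\<close> coordinates.
  There are finitely many candidates, so a single \<open>J\<close> works over a part of
  \<open>S\<close> on which \<open>K\<close> is still independent, and \<open>J \<union> K\<close>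
  is then independent on \<open>X\<close>.\<close>

lemma krull_dim_fibre_le:
  assumes fin: "finite A" "finite B" and disj: "A \<inter> B = {}" and X: "closedin (zariski (A \<union> B)) X"
    and S: "S \<subseteq> affine_space A" "S \<noteq> {}" "\<And>a. a \<in> S \<Longrightarrow> fibre A B X a \<noteq> {}"
      "\<And>a. a \<in> S \<Longrightarrow> enat j \<le> krull_dim (subtopology (zariski B) (fibre A B X a))"
    and e: "enat e \<le> krull_dim (subtopology (zariski A) S)"
  shows "enat (e + j) \<le> krull_dim (subtopology (zariski (A \<union> B)) X)"
proof -
  obtain K where K: "K \<subseteq> A" "card K = e" "alg_indep K S"
    using krull_dim_alg_indep[OF fin(1) S(1,2) e] by auto
  let ?J = "{J. J \<subseteq> B \<and> card J = j}"
  have "finite ?J" using fin(2) by (auto intro: finite_subset[of _ "Pow B"])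
  have "\<exists>J\<in>?J. alg_indep J (fibre A B X a)" if "a \<in> S" for a
    using krull_dim_alg_indep[OF fin(2) fibre_subset_affine_space S(3)[OF that] S(4)[OF that]] by auto
  then have "S \<subseteq> (\<Union>J\<in>?J. {a \<in> S. alg_indep J (fibre A B X a)})" by auto
  with K(3) have "alg_indep K (\<Union>J\<in>?J. {a \<in> S. alg_indep J (fibre A B X a)})"
    by (rule alg_indep_mono[OF _ subset_refl])
  from alg_indep_UN[OF \<open>finite ?J\<close> this]
  obtain J where J: "J \<subseteq> B" "card J = j" and KJ: "alg_indep K {a \<in> S. alg_indep J (fibre A B X a)}"
    by auto
  have "alg_indep (J \<union> K) X"
  proof (rule alg_indepI)
    fix p x assume p: "p \<in> poly_functions (J \<union> K)" "\<And>z. z \<in> X \<Longrightarrow> p z = 0"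
    have "p (override_on x a A) = 0" if a: "a \<in> {a \<in> S. alg_indep J (fibre A B X a)}" for a
    proof -
      have "(\<lambda>y. p (override_on y a A)) \<in> poly_functions J"
        by (rule poly_functions_override_on_left[OF p(1) K(1)])
      moreover have "p (override_on y a A) = 0" if "y \<in> fibre A B X a" for y
        using that p(2) by (simp add: fibre_def)
      ultimately show ?thesis using alg_indepD[of J "fibre A B X a" "\<lambda>y. p (override_on y a A)" x] a by simp
    qed
    moreover have "(\<lambda>a. p (override_on x a A)) \<in> poly_functions K"
      by (rule poly_functions_override_on_right[OF p(1)]) (use J(1) disj in auto)
    \<comment> \<open>For fixed \<open>x\<close> the polynomial in \<open>a\<close> vanishes on a
      set where \<open>K\<close> is independent, hence everywhere, in particular at
      \<open>a = x\<close>.\<close>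
    ultimately have "p (override_on x x A) = 0"
      using alg_indepD[OF KJ, of "\<lambda>a. p (override_on x a A)" x] by simp
    moreover have "override_on x x A = x" by (auto simp: override_on_def)
    ultimately show "p x = 0" by simp
  qed
  then have "enat (card (J \<union> K)) \<le> krull_dim (subtopology (zariski (A \<union> B)) X)"
    by (intro alg_indep_krull_dim[OF _ _ X]) (use fin J(1) K(1) in auto)
  moreover have "card (J \<union> K) = e + j"
  proof -
    have "finite J" "finite K" using J(1) K(1) fin by (auto intro: finite_subset)
    moreover have "J \<inter> K = {}" using J(1) K(1) disj by auto
    ultimately show ?thesis using J(2) K(2) by (simp add: card_Un_disjoint)
  qed
  ultimately show ?thesis by simp
qed

text \<open>The basis starts with a maximal independent \<open>K\<close> inside \<open>A\<close>, so
  its extension \<open>J\<close> adds only coordinates in \<open>B\<close>. A generic tree along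
  \<open>K\<close> followed by \<open>J - K\<close> is cut after \<open>K\<close>. Fixing the
  coordinates in \<open>K\<close> leaves finitely many points of the base, and one of them carries
  the branching in the direction of the fibre.\<close>

lemma krull_dim_fibre_attained:
  assumes fin: "finite A" "finite B" and disj: "A \<inter> B = {}"
    and X: "closedin (zariski (A \<union> B)) X" "X \<noteq> {}"
    and D: "enat D \<le> krull_dim (subtopology (zariski (A \<union> B)) X)"
  shows "\<exists>e j. D \<le> e + j \<and> j \<le> card B \<and>
    {a \<in> affine_space A. enat j \<le> krull_dim (subtopology (zariski B) (fibre A B X a))} \<noteq> {} \<and>
    enat e \<le> krull_dim (subtopology (zariski A)
      {a \<in> affine_space A. enat j \<le> krull_dim (subtopology (zariski B) (fibre A B X a))})"
proof -
  let ?I = "A \<union> B"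
  have finI: "finite ?I" using fin by simp
  have XI: "X \<subseteq> affine_space ?I" using closedin_subset[OF X(1)] by (simp add: topspace_zariski)
  obtain J0 where J0: "J0 \<subseteq> ?I" "card J0 = D" "alg_indep J0 X"
    using krull_dim_alg_indep[OF finI XI X(2) D] by auto
  obtain Z where Z: "Z \<subseteq> X" "closedin (zariski ?I) Z" "poly_irreducible ?I Z" "alg_indep J0 Z"
    using irreducible_subset_alg_indep[OF finI X(1) J0(3)] .
  obtain K where K: "{} \<subseteq> K" "K \<subseteq> A" "alg_indep K Z" "\<forall>i\<in>A - K. \<not> alg_indep (insert i K) Z"
    using alg_indep_extend[OF fin(1) empty_subsetI alg_indep_empty[OF poly_irreducible_nonempty[OF Z(3)]]] .
  have KI: "K \<subseteq> ?I" using K(2) by auto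
  obtain J where J: "K \<subseteq> J" "J \<subseteq> ?I" "alg_indep J Z" "\<forall>i\<in>?I - J. \<not> alg_indep (insert i J) Z"
    using alg_indep_extend[OF finI KI K(3)] .
  interpret b: coord_basis ?I J Z by unfold_locales (use finI J Z in simp_all)
  have DJ: "D \<le> card J" using b.card_alg_indep_le[OF Z(4) J0(1)] J0(2) by simp
  have JA: "J - K \<subseteq> B"
  proof
    fix i assume i: "i \<in> J - K"
    have "alg_indep (insert i K) Z" using J(3) by (rule alg_indep_mono) (use i J(1) in auto)
    then have "i \<notin> A - K" using K(4) by auto
    then show "i \<in> B" using i J(2) by auto
  qed
  have finK: "finite K" using K(2) fin(1) by (rule finite_subset)
  obtain xs where xs: "set xs = K" "distinct xs" using finite_distinct_list[OF finK] by auto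
  have "finite (J - K)" using b.finJ by simp
  then obtain ys where ys: "set ys = J - K" "distinct ys" using finite_distinct_list by blast
  have "\<forall>i\<in>A - K. \<exists>c n u. n > 0 \<and> (\<forall>k. c k \<in> poly_functions K) \<and> c n u \<noteq> 0 \<and>
      (\<forall>z\<in>Z. (\<Sum>k\<le>n. c k z * z i ^ k) = 0)"
    using algebraic_relation[OF K(3)] K(4) by simp
  then obtain c where "\<forall>i\<in>A - K. \<exists>n u. n > 0 \<and> (\<forall>k. c i k \<in> poly_functions K) \<and> c i n u \<noteq> 0 \<and>
      (\<forall>z\<in>Z. (\<Sum>k\<le>n. c i k z * z i ^ k) = 0)" by (rule bchoice[THEN exE])
  then obtain n where "\<forall>i\<in>A - K. \<exists>u. n i > 0 \<and> (\<forall>k. c i k \<in> poly_functions K) \<and> c i (n i) u \<noteq> 0 \<and>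
      (\<forall>z\<in>Z. (\<Sum>k\<le>n i. c i k z * z i ^ k) = 0)" by (rule bchoice[THEN exE])
  then obtain v where "\<forall>i\<in>A - K. n i > 0 \<and> (\<forall>k. c i k \<in> poly_functions K) \<and> c i (n i) (v i) \<noteq> 0 \<and>
      (\<forall>z\<in>Z. (\<Sum>k\<le>n i. c i k z * z i ^ k) = 0)" by (rule bchoice[THEN exE])
  then have c: "c i k \<in> poly_functions K" "c i (n i) (v i) \<noteq> 0"
      "z \<in> Z \<Longrightarrow> (\<Sum>k\<le>n i. c i k z * z i ^ k) = 0" if "i \<in> A - K" for i k z
    using that by simp_all
  \<comment> \<open>Where \<open>g\<close> is nonzero, the relations of the remaining coordinates in
    \<open>A\<close> over \<open>K\<close> keep their leading coefficients, so these coordinates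
    take finitely many values once those in \<open>K\<close> are fixed.\<close>
  define g where "g z = (\<Prod>i\<in>A - K. c i (n i) z)" for z
  have cI: "c i k \<in> poly_functions ?I" if "i \<in> A - K" for i k
    using c(1)[OF that] KI by (rule poly_functions_mono)
  have finAK: "finite (A - K)" using fin by simp
  have g: "g \<in> poly_functions ?I" unfolding g_def by (rule poly_functions_prod) (rule cI)
  have "\<not> (\<forall>z\<in>Z. g z = 0)" unfolding g_def
  proof (rule poly_irreducible_prod[OF Z(3) finAK cI])
    fix i assume i: "i \<in> A - K"
    show "\<not> (\<forall>z\<in>Z. c i (n i) z = 0)"
      using alg_indepD[OF K(3) c(1)[OF i], of "n i" "v i"] c(2)[OF i] by auto
  qed
  moreover have "distinct (xs @ ys)" "set (xs @ ys) = J" using xs ys J(1) by auto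
  ultimately have "branching (xs @ ys) {z \<in> Z. g z \<noteq> 0}"
    using b.branching_generic[OF _ _ g _ Z(2)] by simp
  from branching_append[OF this]
  have R: "branching xs {x. branching ys {y \<in> {z \<in> Z. g z \<noteq> 0}. \<forall>i\<in>set xs. y i = x i}}" .
  let ?S = "{a \<in> affine_space A. enat (length ys) \<le> krull_dim (subtopology (zariski B) (fibre A B X a))}"
  have bS: "branching xs ?S"
  proof (rule branching_transfer[OF R])
    fix x
    let ?Y = "{y \<in> {z \<in> Z. g z \<noteq> 0}. \<forall>i\<in>set xs. y i = x i}"
    assume "x \<in> {x. branching ys {y \<in> {z \<in> Z. g z \<noteq> 0}. \<forall>i\<in>set xs. y i = x i}}"
    then have b: "branching ys ?Y" by simp
    define T where "T i = (if i \<in> K then {x i} else {t. (\<Sum>k\<le>n i. c i k x * t ^ k) = 0})" for i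
    have cx: "c i k y = c i k x" if "i \<in> A - K" "y \<in> ?Y" for i k y
      using c(1)[OF that(1)] by (rule poly_functions_cong) (use that(2) xs in auto)
    have T: "finite (T i)" if "i \<in> A" for i
    proof (cases "i \<in> K")
      case True
      then show ?thesis by (simp add: T_def)
    next
      case False
      then have i: "i \<in> A - K" using that by simp
      have "?Y \<noteq> {}"
      proof
        assume e: "?Y = {}"
        show False using b unfolding e by (simp add: not_branching_empty)
      qed
      then obtain y where y: "y \<in> ?Y" by blast
      then have "g y \<noteq> 0" by simp
      then have "c i (n i) y \<noteq> 0" unfolding g_def using finAK i by (simp add: prod_zero_iff)
      then have nz: "c i (n i) x \<noteq> 0" using cx[OF i y] by simp
      have "finite {t. (\<Sum>k\<le>n i. c i k x * t ^ k) = 0}"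
        using polyfun_rootbound(1)[of "\<lambda>k. c i k x" "n i" "n i"] nz by auto
      then show ?thesis using False by (simp add: T_def)
    qed
    have "(\<lambda>y. restrict y A) ` ?Y \<subseteq> Pi\<^sub>E A T"
    proof
      fix a assume "a \<in> (\<lambda>y. restrict y A) ` ?Y"
      then obtain y where y: "y \<in> ?Y" "a = restrict y A" by auto
      have "y i \<in> T i" if "i \<in> A" for i
      proof (cases "i \<in> K")
        case True
        then show ?thesis using y(1) xs by (auto simp: T_def)
      next
        case False
        then have i: "i \<in> A - K" using that by simp
        show ?thesis using c(3)[OF i, of y] y(1) False by (simp add: T_def cx[OF i y(1)])
      qed
      then show "a \<in> Pi\<^sub>E A T" unfolding y(2) by auto
    qed
    then have finF: "finite ((\<lambda>y. restrict y A) ` ?Y)"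
      by (rule finite_subset) (use fin(1) T in \<open>auto intro: finite_PiE\<close>)
    have "?Y \<subseteq> (\<Union>a\<in>(\<lambda>y. restrict y A) ` ?Y. {y \<in> ?Y. restrict y A = a})" by auto
    with b have "branching ys (\<Union>a\<in>(\<lambda>y. restrict y A) ` ?Y. {y \<in> ?Y. restrict y A = a})"
      by (rule branching_mono)
    from branching_UN[OF finF this] obtain a where a: "a \<in> (\<lambda>y. restrict y A) ` ?Y"
      and ba: "branching ys {y \<in> ?Y. restrict y A = a}" by (rule bexE)
    have "branching ys (fibre A B X a)"
    proof (rule branching_transfer[OF ba])
      fix y assume y: "y \<in> {y \<in> ?Y. restrict y A = a}"
      then have yX: "y \<in> X" using Z(1) by auto
      then have yI: "y \<in> affine_space ?I" using XI by auto
      have "a = restrict y A" using y by simp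
      then have "override_on (restrict y B) a A = y"
        using yI by (auto simp: override_on_def affine_space_def PiE_iff extensional_def fun_eq_iff)
      then have "restrict y B \<in> fibre A B X a" using yX by (simp add: fibre_def affine_space_def)
      moreover have "\<forall>i\<in>set ys. restrict y B i = y i" using ys JA by auto
      ultimately show "\<exists>y'\<in>fibre A B X a. \<forall>i\<in>set ys. y' i = y i" by (intro bexI[of _ "restrict y B"])
    qed
    moreover have "set ys \<subseteq> B" using ys JA by simp
    ultimately have "enat (length ys) \<le> krull_dim (subtopology (zariski B) (fibre A B X a))"
      using branching_krull_dim[OF fin(2) _ fibre_subset_affine_space] by simp
    moreover have "a \<in> affine_space A" using a by (auto simp: affine_space_def)
    moreover have "\<forall>i\<in>set xs. a i = x i" using a xs K(2) by auto
    ultimately show "\<exists>y\<in>?S. \<forall>i\<in>set xs. y i = x i" by (intro bexI[of _ a]) simp_all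
  qed
  have "set xs \<subseteq> A" using xs K(2) by simp
  with bS have "enat (length xs) \<le> krull_dim (subtopology (zariski A) ?S)"
    by (intro branching_krull_dim[OF fin(1)]) auto
  moreover have "D \<le> length xs + length ys"
  proof -
    have "length xs + length ys = card (set (xs @ ys))"
      using xs ys by (subst distinct_card) auto
    also have "set (xs @ ys) = J" using xs ys J(1) by auto
    finally show ?thesis using DJ by simp
  qed
  moreover have "length ys \<le> card B"
    using ys JA card_mono[OF fin(2) JA] by (simp add: distinct_card[symmetric])
  moreover have "?S \<noteq> {}"
  proof
    assume e: "?S = {}"
    show False using bS unfolding e by (simp add: not_branching_empty)
  qed
  ultimately show ?thesis by (intro exI[of _ "length xs"] exI[of _ "length ys"] conjI)
qed

section \<open>Codimension of a closed set and of its fibres\<close>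

lemma codim_le_iff:
  assumes "finite I" "S \<subseteq> affine_space I"
  shows "codim I S \<le> enat j \<longleftrightarrow> enat (card I - j) \<le> krull_dim (subtopology (zariski I) S)"
proof -
  obtain k where "krull_dim (subtopology (zariski I) S) = enat k" "k \<le> card I"
    by (rule krull_dim_nat[OF assms])
  then show ?thesis by (auto simp: codim_def)
qed

text \<open>Empty sublevel sets are excluded: \<open>krull_dim\<close> gives the empty set dimension
  0, so its codimension would be \<open>card A\<close>, and the inequality could fail.\<close>

lemma codim_le_fibre:
  assumes fin: "finite A" "finite B" and disj: "A \<inter> B = {}" and X: "closedin (zariski (A \<union> B)) X"
    and ne: "\<And>a. a \<in> affine_space A \<Longrightarrow> fibre A B X a \<noteq> {}"
      "{a \<in> affine_space A. codim B (fibre A B X a) \<le> enat j} \<noteq> {}"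
  shows "codim (A \<union> B) X \<le> codim A {a \<in> affine_space A. codim B (fibre A B X a) \<le> enat j} + enat j"
proof -
  let ?S = "{a \<in> affine_space A. codim B (fibre A B X a) \<le> enat j}"
  have SA: "?S \<subseteq> affine_space A" by auto
  obtain e where e: "krull_dim (subtopology (zariski A) ?S) = enat e" "e \<le> card A"
    using krull_dim_nat[OF fin(1) SA] .
  have "enat (e + (card B - j)) \<le> krull_dim (subtopology (zariski (A \<union> B)) X)"
    by (rule krull_dim_fibre_le[OF fin disj X, of ?S])
      (use ne e codim_le_iff[OF fin(2) fibre_subset_affine_space] in auto)
  moreover have XI: "X \<subseteq> affine_space (A \<union> B)" using closedin_subset[OF X] by (simp add: topspace_zariski)
  obtain k where k: "krull_dim (subtopology (zariski (A \<union> B)) X) = enat k" "k \<le> card (A \<union> B)"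
    using krull_dim_nat[OF finite_UnI[OF fin] XI] .
  ultimately show ?thesis
    using e fin disj by (simp add: codim_def card_Un_disjoint)
qed

lemma codim_fibre_attained:
  assumes fin: "finite A" "finite B" and disj: "A \<inter> B = {}"
    and X: "closedin (zariski (A \<union> B)) X" "X \<noteq> {}"
  shows "\<exists>j. {a \<in> affine_space A. codim B (fibre A B X a) \<le> enat j} \<noteq> {} \<and>
    codim A {a \<in> affine_space A. codim B (fibre A B X a) \<le> enat j} + enat j \<le> codim (A \<union> B) X"
proof -
  have XI: "X \<subseteq> affine_space (A \<union> B)" using closedin_subset[OF X(1)] by (simp add: topspace_zariski)
  obtain k where k: "krull_dim (subtopology (zariski (A \<union> B)) X) = enat k" "k \<le> card (A \<union> B)"
    using krull_dim_nat[OF finite_UnI[OF fin] XI] .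
  let ?K = "\<lambda>j. {a \<in> affine_space A. enat j \<le> krull_dim (subtopology (zariski B) (fibre A B X a))}"
  obtain e j where ej: "k \<le> e + j" "j \<le> card B" "enat e \<le> krull_dim (subtopology (zariski A) (?K j))"
    and ne: "?K j \<noteq> {}"
    using krull_dim_fibre_attained[OF fin disj X, of k] k(1) by auto
  have S: "{a \<in> affine_space A. codim B (fibre A B X a) \<le> enat (card B - j)} = ?K j"
    using codim_le_iff[OF fin(2) fibre_subset_affine_space] ej(2) by simp
  have KA: "?K j \<subseteq> affine_space A" by auto
  obtain l where l: "krull_dim (subtopology (zariski A) (?K j)) = enat l" "l \<le> card A"
    using krull_dim_nat[OF fin(1) KA] .
  have "codim A (?K j) + enat (card B - j) \<le> codim (A \<union> B) X"
    using k l ej fin disj by (simp add: codim_def card_Un_disjoint)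
  with ne show ?thesis unfolding S[symmetric] by (intro exI[of _ "card B - j"]) simp
qed

section \<open>Relabelling coordinates\<close>

lemma krull_dim_homeomorphic_le:
  assumes f: "homeomorphic_map X Y f"
  shows "krull_dim X \<le> krull_dim Y"
proof -
  have cl: "closedin Y (f ` Z)" if "closedin X Z" for Z
    using homeomorphic_imp_closed_map[OF f] that by (simp add: closed_map_def)
  have inj: "inj_on f (topspace X)" using f by (rule homeomorphic_imp_injective_map)
  have surj: "f ` topspace X = topspace Y" using f by (rule homeomorphic_imp_surjective_map)
  have cont: "continuous_map X Y f" using f by (rule homeomorphic_imp_continuous_map)
  have irr: "irreducible_in Y (f ` Z)" if Z: "irreducible_in X Z" for Z
    unfolding irreducible_in_def
  proof (intro conjI allI impI)
    have sub: "Z \<subseteq> topspace X" and ne: "Z \<noteq> {}" using Z by (simp_all add: irreducible_in_def)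
    show "f ` Z \<noteq> {}" using ne by simp
    show "f ` Z \<subseteq> topspace Y" using sub surj by blast
    fix A B assume AB: "closedin Y A \<and> closedin Y B \<and> f ` Z \<subseteq> A \<union> B"
    have "closedin X {x \<in> topspace X. f x \<in> C}" if "closedin Y C" for C
      using cont that by (rule closedin_continuous_map_preimage)
    moreover have "Z \<subseteq> {x \<in> topspace X. f x \<in> A} \<union> {x \<in> topspace X. f x \<in> B}" using AB sub by auto
    ultimately have "Z \<subseteq> {x \<in> topspace X. f x \<in> A} \<or> Z \<subseteq> {x \<in> topspace X. f x \<in> B}"
      using Z AB unfolding irreducible_in_def by simp
    then show "f ` Z \<subseteq> A \<or> f ` Z \<subseteq> B" by auto
  qed
  show ?thesis unfolding krull_dim_def
  proof (rule Sup_mono)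
    fix d assume "d \<in> {enat d |d. \<exists>Z :: nat \<Rightarrow> 'a set.
      (\<forall>k\<le>d. closedin X (Z k) \<and> irreducible_in X (Z k)) \<and> (\<forall>k<d. Z k \<subset> Z (Suc k))}"
    then obtain e Z where d: "d = enat e" and Z: "\<forall>k\<le>e. closedin X (Z k) \<and> irreducible_in X (Z k)"
      "\<forall>k<e. Z k \<subset> Z (Suc k)" by auto
    have "\<forall>k\<le>e. closedin Y (f ` Z k) \<and> irreducible_in Y (f ` Z k)" using Z(1) cl irr by simp
    moreover have "f ` Z k \<subset> f ` Z (Suc k)" if "k < e" for k
    proof -
      have "Z (Suc k) \<subseteq> topspace X" using Z(1) that closedin_subset by (metis Suc_leI)
      then have "inj_on f (Z (Suc k))" using inj by (rule inj_on_subset[rotated])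
      then show ?thesis using Z(2) that by (intro image_strict_mono) simp_all
    qed
    ultimately have "enat e \<in> {enat d |d. \<exists>Z :: nat \<Rightarrow> 'b set.
      (\<forall>k\<le>d. closedin Y (Z k) \<and> irreducible_in Y (Z k)) \<and> (\<forall>k<d. Z k \<subset> Z (Suc k))}"
      by (intro CollectI exI[of _ e] conjI refl exI[of _ "\<lambda>k. f ` Z k"]) simp_all
    then show "\<exists>b\<in>{enat d |d. \<exists>Z :: nat \<Rightarrow> 'b set.
      (\<forall>k\<le>d. closedin Y (Z k) \<and> irreducible_in Y (Z k)) \<and> (\<forall>k<d. Z k \<subset> Z (Suc k))}. d \<le> b"
      unfolding d by (rule bexI[of "\<lambda>b. enat e \<le> b" "enat e", OF order_refl])
  qed
qed

lemma continuous_map_relabel: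
  assumes h: "h ` I \<subseteq> I'"
  shows "continuous_map (zariski I') (zariski I) (\<lambda>x. \<lambda>i\<in>I. x (h i))"
  unfolding continuous_map_closedin
proof (intro conjI allI impI)
  show "(\<lambda>x. \<lambda>i\<in>I. x (h i)) \<in> topspace (zariski I') \<rightarrow> topspace (zariski I)"
    by (simp add: topspace_zariski affine_space_def)
next
  fix C assume "closedin (zariski I) C"
  then obtain P where P: "P \<subseteq> poly_functions I" "C = zero_locus I P"
    unfolding closedin_zariski by (elim exE conjE)
  let ?P = "(\<lambda>p x. p (\<lambda>i\<in>I. x (h i))) ` P"
  have "(\<lambda>x. p (\<lambda>i\<in>I. x (h i))) \<in> poly_functions I'" if p: "p \<in> P" for p
  proof -
    have "p \<in> poly_functions I" using p P(1) by auto
    moreover have "(\<lambda>x. (\<lambda>i\<in>I. x (h i)) i) \<in> poly_functions I'" if "i \<in> I" for i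
      using that h by (auto intro!: poly_functions.coord)
    ultimately show ?thesis by (rule poly_functions_subst)
  qed
  then have "?P \<subseteq> poly_functions I'" by auto
  moreover have "{x \<in> topspace (zariski I'). (\<lambda>i\<in>I. x (h i)) \<in> C} = zero_locus I' ?P"
    unfolding P(2) by (auto simp: topspace_zariski zero_locus_def affine_space_def)
  ultimately show "closedin (zariski I') {x \<in> topspace (zariski I'). (\<lambda>i\<in>I. x (h i)) \<in> C}"
    unfolding closedin_zariski by (intro exI[of _ ?P] conjI)
qed

text \<open>The coordinates of one covector are indexed by numbers in \<open>GR_sublevel\<close> and
  by pairs in the fibres, and a permutation of the factors renames the pairs. Renaming is a
  homeomorphism, and the Krull dimension is a topological invariant.\<close>

lemma codim_relabel:
  assumes h: "bij_betw h I I'" and S: "S \<subseteq> affine_space I"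
  shows "codim I S = codim I' {x \<in> affine_space I'. (\<lambda>i\<in>I. x (h i)) \<in> S}"
proof -
  let ?\<phi> = "\<lambda>x. \<lambda>i\<in>I. x (h i)"
  let ?\<psi> = "\<lambda>y. \<lambda>i\<in>I'. y (the_inv_into I h i)"
  let ?S = "{x \<in> affine_space I'. ?\<phi> x \<in> S}"
  have inj: "inj_on h I" and im: "h ` I = I'" using h by (simp_all add: bij_betw_def)
  have g: "the_inv_into I h ` I' \<subseteq> I" using the_inv_into_into[OF inj] im by blast
  have hm: "homeomorphic_maps (zariski I') (zariski I) ?\<phi> ?\<psi>"
    unfolding homeomorphic_maps_def
  proof (intro conjI ballI)
    show "continuous_map (zariski I') (zariski I) ?\<phi>" by (rule continuous_map_relabel) (simp add: im)
    show "continuous_map (zariski I) (zariski I') ?\<psi>" by (rule continuous_map_relabel) (rule g)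
    fix x assume x: "x \<in> topspace (zariski I')"
    show "?\<psi> (?\<phi> x) = x"
    proof
      fix i show "?\<psi> (?\<phi> x) i = x i"
      proof (cases "i \<in> I'")
        case True
        then have "the_inv_into I h i \<in> I" "h (the_inv_into I h i) = i"
          using g f_the_inv_into_f[OF inj] im by auto
        then show ?thesis using True by simp
      next
        case False
        then show ?thesis using x by (simp add: topspace_zariski affine_space_def PiE_iff extensional_def)
      qed
    qed
  next
    fix y assume y: "y \<in> topspace (zariski I)"
    show "?\<phi> (?\<psi> y) = y"
    proof
      fix i show "?\<phi> (?\<psi> y) i = y i"
      proof (cases "i \<in> I")
        case True
        then show ?thesis using im the_inv_into_f_f[OF inj True] by auto
      next
        case False
        then show ?thesis using y by (simp add: topspace_zariski affine_space_def PiE_iff extensional_def)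
      qed
    qed
  qed
  have "?\<phi> ` (topspace (zariski I') \<inter> ?S) = topspace (zariski I) \<inter> S"
  proof
    show "topspace (zariski I) \<inter> S \<subseteq> ?\<phi> ` (topspace (zariski I') \<inter> ?S)"
    proof
      fix y assume y: "y \<in> topspace (zariski I) \<inter> S"
      have e: "?\<phi> (?\<psi> y) = y" using hm y by (simp add: homeomorphic_maps_def)
      have "?\<psi> y \<in> affine_space I'" by (simp add: affine_space_def)
      then have "?\<psi> y \<in> topspace (zariski I') \<inter> ?S" using y e by (simp add: topspace_zariski)
      from imageI[OF this, of ?\<phi>] show "y \<in> ?\<phi> ` (topspace (zariski I') \<inter> ?S)" unfolding e .
    qed
  qed (use S in \<open>auto simp: topspace_zariski\<close>)
  with hm have hm': "homeomorphic_maps (subtopology (zariski I') ?S) (subtopology (zariski I) S) ?\<phi> ?\<psi>"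
    by (rule homeomorphic_maps_subtopologies)
  then have "homeomorphic_map (subtopology (zariski I') ?S) (subtopology (zariski I) S) ?\<phi>"
    "homeomorphic_map (subtopology (zariski I) S) (subtopology (zariski I') ?S) ?\<psi>"
    by (auto simp: homeomorphic_maps_map)
  then have "krull_dim (subtopology (zariski I) S) = krull_dim (subtopology (zariski I') ?S)"
    by (intro antisym krull_dim_homeomorphic_le)
  moreover have "card I = card I'" using h by (rule bij_betw_same_card)
  ultimately show ?thesis by (simp add: codim_def)
qed

section \<open>Kernels of a matrix and of its transpose\<close>

text \<open>Finite-dimensional duality, adding one coordinate \<open>i\<close> to \<open>J\<close>
  at a time. If \<open>V\<close> attains arbitrary values on \<open>J\<close>, then either some
  element is zero on \<open>J\<close> but not at \<open>i\<close>, or the value at \<open>i\<close>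
  is a linear function of the values on \<open>J\<close>, which gives the form.\<close>

lemma subspace_surjective_or_form:
  fixes V :: "('i \<Rightarrow> complex) set"
  assumes "finite J" and V: "(\<lambda>_. 0) \<in> V" "\<And>u v c. u \<in> V \<Longrightarrow> v \<in> V \<Longrightarrow> (\<lambda>i. u i + c * v i) \<in> V"
  shows "(\<forall>c. \<exists>v\<in>V. \<forall>i\<in>J. v i = c i) \<or> (\<exists>c. (\<exists>i\<in>J. c i \<noteq> 0) \<and> (\<forall>v\<in>V. (\<Sum>i\<in>J. c i * v i) = 0))"
  using assms(1)
proof (induction J rule: finite_induct)
  case empty
  then show ?case using V(1) by auto
next
  case (insert i J)
  have comb: "(\<lambda>l. u l + (\<Sum>k\<in>K. c k * v k l)) \<in> V"
    if "finite K" "u \<in> V" "\<And>k. k \<in> K \<Longrightarrow> v k \<in> V" for u c v and K :: "'i set"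
    using that
  proof (induction K rule: finite_induct)
    case (insert k K)
    then have "(\<lambda>l. u l + (\<Sum>k\<in>K. c k * v k l)) \<in> V" by simp
    from V(2)[OF this insert.prems(2)[of k], of "c k"] show ?case
      using insert.hyps by (simp add: algebra_simps)
  qed simp
  show ?case
  proof (cases "\<forall>c. \<exists>v\<in>V. \<forall>j\<in>J. v j = c j")
    case False
    then obtain c where c: "\<exists>j\<in>J. c j \<noteq> 0" "\<forall>v\<in>V. (\<Sum>j\<in>J. c j * v j) = 0"
      using mp[OF insert.IH[unfolded disj_imp] False] by (elim exE conjE)
    let ?c = "c(i := 0)"
    have "(\<Sum>j\<in>insert i J. ?c j * v j) = (\<Sum>j\<in>J. c j * v j)" for v
      using insert.hyps by (auto intro!: sum.cong)
    moreover have "\<exists>j\<in>insert i J. ?c j \<noteq> 0" using c(1) insert.hyps by auto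
    ultimately show ?thesis using c(2) by (intro disjI2 exI[of _ ?c]) simp
  next
    case True
    show ?thesis
    proof (cases "\<exists>w\<in>V. (\<forall>j\<in>J. w j = 0) \<and> w i \<noteq> 0")
      case ex: True
      then obtain w where w: "w \<in> V" "\<forall>j\<in>J. w j = 0" "w i \<noteq> 0" by auto
      have "\<exists>v\<in>V. \<forall>j\<in>insert i J. v j = c j" for c
      proof -
        obtain u where u: "u \<in> V" "\<forall>j\<in>J. u j = c j" using True by auto
        show ?thesis
          by (rule bexI[OF _ V(2)[OF u(1) w(1), of "(c i - u i) / w i"]]) (use u(2) w(2,3) in auto)
      qed
      then show ?thesis by simp
    next
      case nex: False
      have "\<forall>a. \<exists>v. v \<in> V \<and> (\<forall>j\<in>J. v j = (if j = a then 1 else 0))"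
      proof
        fix a
        show "\<exists>v. v \<in> V \<and> (\<forall>j\<in>J. v j = (if j = a then 1 else 0))"
          using spec[OF True, of "\<lambda>j. if j = a then 1 else 0"] by blast
      qed
      then obtain v where v: "\<forall>a. v a \<in> V \<and> (\<forall>j\<in>J. v a j = (if j = a then 1 else 0))"
        by (rule choice[THEN exE])
      \<comment> \<open>Since \<open>v j\<close> restricts to the \<open>j\<close>-th unit vector on
        \<open>J\<close>, subtracting from \<open>u\<close> the combination of the
        \<open>v j\<close> with coefficients \<open>u j\<close> leaves an element that is zero on
        \<open>J\<close>, hence at \<open>i\<close>. Its value at \<open>i\<close> is the value of
        the form at \<open>u\<close>.\<close>
      let ?c = "\<lambda>j. if j = i then 1 else - v j i"
      have "(\<Sum>j\<in>insert i J. ?c j * u j) = 0" if u: "u \<in> V" for u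
      proof -
        let ?w = "\<lambda>l. u l + (\<Sum>k\<in>J. - u k * v k l)"
        have wV: "?w \<in> V" by (rule comb[OF insert.hyps(1) u]) (use v in simp)
        have wJ: "?w j = 0" if "j \<in> J" for j
        proof -
          have "(\<Sum>k\<in>J. - u k * v k j) = (\<Sum>k\<in>J. if k = j then - u k else 0)"
            by (rule sum.cong) (use v that in auto)
          then show ?thesis using that insert.hyps(1) by simp
        qed
        have "\<forall>w\<in>V. (\<forall>j\<in>J. w j = 0) \<longrightarrow> w i = 0" using nex by auto
        from bspec[OF this wV] have "?w i = 0" by (rule mp) (rule ballI, rule wJ)
        moreover have "(\<Sum>j\<in>insert i J. ?c j * u j) = ?w i"
        proof -
          have "(\<Sum>j\<in>J. ?c j * u j) = (\<Sum>k\<in>J. - u k * v k i)"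
            by (rule sum.cong) (use insert.hyps in auto)
          then show ?thesis using insert.hyps by simp
        qed
        ultimately show ?thesis by simp
      qed
      then show ?thesis by (intro disjI2 exI[of _ ?c]) auto
    qed
  qed
qed

text \<open>Each equation is solved for at most one coordinate; those remaining in \<open>J\<close>
  can be prescribed freely. This is the rank bound in terms of coordinates.\<close>

lemma linear_equations_solution:
  fixes U :: "'s \<Rightarrow> 'i \<Rightarrow> complex"
  assumes "finite R" "finite I"
  shows "\<exists>J\<subseteq>I. card I \<le> card J + card R \<and>
    (\<forall>c. \<exists>w. (\<forall>s\<in>R. (\<Sum>b\<in>I. w b * U s b) = 0) \<and> (\<forall>b\<in>J. w b = c b))"
  using assms
proof (induction R arbitrary: I U rule: finite_induct)
  case empty
  then show ?case by (intro exI[of _ I]) auto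
next
  case (insert s R)
  show ?case
  proof (cases "\<forall>b\<in>I. U s b = 0")
    case True
    obtain J where "J \<subseteq> I" "card I \<le> card J + card R"
      "\<forall>c. \<exists>w. (\<forall>s\<in>R. (\<Sum>b\<in>I. w b * U s b) = 0) \<and> (\<forall>b\<in>J. w b = c b)"
      using insert.IH[OF insert.prems, of U] by auto
    then show ?thesis using True insert.hyps by (intro exI[of _ J]) simp
  next
    case False
    then obtain b0 where b0: "b0 \<in> I" "U s b0 \<noteq> 0" by auto
    let ?I = "I - {b0}"
    let ?U = "\<lambda>t b. U t b - U t b0 / U s b0 * U s b"
    have "finite ?I" using insert.prems by simp
    from insert.IH[OF this, of ?U] obtain J where J: "J \<subseteq> ?I" "card ?I \<le> card J + card R"
      "\<forall>c. \<exists>w. (\<forall>t\<in>R. (\<Sum>b\<in>?I. w b * ?U t b) = 0) \<and> (\<forall>b\<in>J. w b = c b)" by auto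
    have "\<exists>w. (\<forall>t\<in>insert s R. (\<Sum>b\<in>I. w b * U t b) = 0) \<and> (\<forall>b\<in>J. w b = c b)" for c
    proof -
      obtain w where w: "\<forall>t\<in>R. (\<Sum>b\<in>?I. w b * ?U t b) = 0" "\<forall>b\<in>J. w b = c b"
        using spec[OF J(3), of c] by (elim exE conjE)
      define \<sigma> where "\<sigma> t = (\<Sum>b\<in>?I. w b * U t b)" for t
      let ?w = "w(b0 := - \<sigma> s / U s b0)"
      have e: "(\<Sum>b\<in>I. ?w b * U t b) = - \<sigma> s / U s b0 * U t b0 + \<sigma> t" for t
      proof -
        have "(\<Sum>b\<in>I. ?w b * U t b) = ?w b0 * U t b0 + (\<Sum>b\<in>?I. ?w b * U t b)"
          using insert.prems b0(1) by (rule sum.remove)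
        also have "(\<Sum>b\<in>?I. ?w b * U t b) = \<sigma> t" unfolding \<sigma>_def by (rule sum.cong) auto
        finally show ?thesis by simp
      qed
      have "(\<Sum>b\<in>?I. w b * ?U t b) = \<sigma> t - U t b0 / U s b0 * \<sigma> s" for t
        unfolding \<sigma>_def by (simp add: right_diff_distrib sum_subtractf sum_distrib_left mult.left_commute)
      then have "\<sigma> t = U t b0 / U s b0 * \<sigma> s" if "t \<in> R" for t using w(1) that by simp
      then have "(\<Sum>b\<in>I. ?w b * U t b) = 0" if "t \<in> R" for t
        using that unfolding e by simp
      moreover have "(\<Sum>b\<in>I. ?w b * U s b) = 0" unfolding e using b0(2) by simp
      moreover have "\<forall>b\<in>J. ?w b = c b" using w(2) J(1) by auto
      ultimately show ?thesis by (intro exI[of _ ?w]) simp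
    qed
    moreover have "card I \<le> card J + card (insert s R)"
      using J(2) insert.hyps insert.prems b0(1) by simp
    ultimately show ?thesis using J(1) by (intro exI[of _ J]) auto
  qed
qed

lemma closedin_zariski_equations:
  assumes "\<And>s. s \<in> R \<Longrightarrow> f s \<in> poly_functions I"
  shows "closedin (zariski I) {x \<in> affine_space I. \<forall>s\<in>R. f s x = 0}"
  unfolding closedin_zariski using assms
  by (intro exI[of _ "f ` R"]) (auto simp: zero_locus_def)

text \<open>If the left kernel of \<open>M\<close> projects onto the coordinates in \<open>J\<close>, then the rows in \<open>J\<close> are
  combinations of the other rows, so the right kernel is cut out by \<open>card (I - J)\<close> equations.\<close>

lemma codim_kernel_transpose:
  fixes M :: "'a \<Rightarrow> 'b \<Rightarrow> complex"
  assumes fin: "finite I" "finite I'"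
    and j: "codim I {y \<in> affine_space I. \<forall>b\<in>I'. (\<Sum>a\<in>I. y a * M a b) = 0} \<le> enat j"
  shows "codim I' {w \<in> affine_space I'. \<forall>a\<in>I. (\<Sum>b\<in>I'. w b * M a b) = 0} \<le> enat j"
proof -
  let ?K = "{y \<in> affine_space I. \<forall>b\<in>I'. (\<Sum>a\<in>I. y a * M a b) = 0}"
  let ?L = "{w \<in> affine_space I'. \<forall>a\<in>I. (\<Sum>b\<in>I'. w b * M a b) = 0}"
  let ?V = "{y. \<forall>b\<in>I'. (\<Sum>a\<in>I. y a * M a b) = 0}"
  have K: "?K \<subseteq> affine_space I" by auto
  have "(\<lambda>i\<in>I. 0) \<in> ?K" by (simp add: affine_space_def)
  then have Kne: "?K \<noteq> {}" by (metis empty_iff)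
  obtain J where J: "J \<subseteq> I" "card J = card I - j" "alg_indep J ?K"
    using krull_dim_alg_indep[OF fin(1) K Kne iffD1[OF codim_le_iff[OF fin(1) K] j]]
    by (elim exE conjE)
  have finJ: "finite J" using J(1) fin(1) by (rule finite_subset)
  have JV: "alg_indep J ?V" using J(3) by (rule alg_indep_mono) auto
  \<comment> \<open>On a linear space independence of coordinates makes the projection onto: a
    nonzero linear form vanishing on \<open>?V\<close> would be a polynomial relation.\<close>
  have surj: "\<forall>c. \<exists>v\<in>?V. \<forall>i\<in>J. v i = c i"
  proof (rule ccontr)
    assume n: "\<not> ?thesis"
    have alt: "(\<forall>c. \<exists>v\<in>?V. \<forall>i\<in>J. v i = c i) \<or> (\<exists>c. (\<exists>i\<in>J. c i \<noteq> 0) \<and> (\<forall>v\<in>?V. (\<Sum>i\<in>J. c i * v i) = 0))"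
    proof (rule subspace_surjective_or_form[OF finJ])
      fix u v and c :: complex assume "u \<in> ?V" "v \<in> ?V"
      then show "(\<lambda>i. u i + c * v i) \<in> ?V"
        by (simp add: distrib_right sum.distrib mult.assoc sum_distrib_left[symmetric])
    qed simp
    obtain c where "\<exists>i\<in>J. c i \<noteq> 0" and cV: "\<forall>v\<in>?V. (\<Sum>i\<in>J. c i * v i) = 0"
      using mp[OF alt[unfolded disj_imp] n] by (elim exE conjE)
    then obtain i where i: "i \<in> J" "c i \<noteq> 0" by (elim bexE)
    have "(\<lambda>v. \<Sum>i\<in>J. c i * v i) \<in> poly_functions J"
      by (intro poly_functions_sum poly_functions.mult poly_functions.const poly_functions.coord)
    from alg_indepD[OF JV this, of "\<lambda>j. if j = i then 1 else 0"] cV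
    have "(\<Sum>j\<in>J. c j * (if j = i then 1 else 0)) = 0" by simp
    then show False using i finJ by (simp add: if_distrib cong: if_cong)
  qed
  have "\<forall>a. \<exists>v. v \<in> ?V \<and> (\<forall>i\<in>J. v i = (if i = a then 1 else 0))"
  proof
    fix a
    show "\<exists>v. v \<in> ?V \<and> (\<forall>i\<in>J. v i = (if i = a then 1 else 0))"
      using spec[OF surj, of "\<lambda>i. if i = a then 1 else 0"] by blast
  qed
  then obtain v where v: "\<forall>a. v a \<in> ?V \<and> (\<forall>i\<in>J. v a i = (if i = a then 1 else 0))"
    by (rule choice[THEN exE])
  have row: "M a b = - (\<Sum>s\<in>I - J. v a s * M s b)" if "a \<in> J" "b \<in> I'" for a b
  proof -
    have "(\<Sum>s\<in>I. v a s * M s b) = (\<Sum>s\<in>I - J. v a s * M s b) + (\<Sum>s\<in>J. v a s * M s b)"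
      by (rule sum.subset_diff[OF J(1) fin(1)])
    also have "(\<Sum>s\<in>J. v a s * M s b) = (\<Sum>s\<in>J. if s = a then M s b else 0)"
      by (rule sum.cong) (use v in auto)
    also have "\<dots> = M a b" using finJ that by simp
    finally have "(\<Sum>s\<in>I - J. v a s * M s b) + M a b = (\<Sum>s\<in>I. v a s * M s b)" by simp
    also have "\<dots> = 0" using v that(2) by simp
    finally show ?thesis by (simp add: eq_neg_iff_add_eq_0 add.commute)
  qed
  have L: "?L \<subseteq> affine_space I'" by auto
  obtain J' where J': "J' \<subseteq> I'" "card I' \<le> card J' + card (I - J)"
    "\<forall>c. \<exists>w. (\<forall>s\<in>I - J. (\<Sum>b\<in>I'. w b * M s b) = 0) \<and> (\<forall>b\<in>J'. w b = c b)"
    using linear_equations_solution[of "I - J" I' M] fin by auto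
  have "alg_indep J' ?L"
  proof (rule alg_indepI)
    fix p x assume p: "p \<in> poly_functions J'" "\<And>z. z \<in> ?L \<Longrightarrow> p z = 0"
    obtain w where w: "\<forall>s\<in>I - J. (\<Sum>b\<in>I'. w b * M s b) = 0" "\<forall>b\<in>J'. w b = x b"
      using spec[OF J'(3), of x] by (elim exE conjE)
    have "(\<Sum>b\<in>I'. w b * M a b) = 0" if a: "a \<in> I" for a
    proof (cases "a \<in> J")
      case True
      have "(\<Sum>b\<in>I'. w b * M a b) = (\<Sum>b\<in>I'. w b * - (\<Sum>s\<in>I - J. v a s * M s b))"
        by (intro sum.cong refl) (simp add: row[OF True])
      also have "\<dots> = - (\<Sum>s\<in>I - J. v a s * (\<Sum>b\<in>I'. w b * M s b))"
        by (simp add: sum_negf sum_distrib_left mult.left_commute sum.swap[of _ I'])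
      also have "\<dots> = 0" using w(1) by simp
      finally show ?thesis .
    next
      case False
      then show ?thesis using w(1) a by simp
    qed
    then have "restrict w I' \<in> ?L" by (simp add: affine_space_def)
    then have "p (restrict w I') = 0" by (rule p(2))
    moreover have "p (restrict w I') = p x"
      using p(1) by (rule poly_functions_cong) (use w(2) J'(1) in auto)
    ultimately show "p x = 0" by simp
  qed
  moreover have "closedin (zariski I') ?L"
    by (intro closedin_zariski_equations poly_functions_sum poly_functions.mult
        poly_functions.const poly_functions.coord)
  ultimately have "enat (card J') \<le> krull_dim (subtopology (zariski I') ?L)"
    using alg_indep_krull_dim[OF fin(2) J'(1)] by simp
  moreover have "card I' - j \<le> card J'"
  proof -
    have "card (I - J) = card I - card J" using J(1) finJ by (simp add: card_Diff_subset)
    then show ?thesis using J(2) J'(2) by simp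
  qed
  ultimately show ?thesis unfolding codim_le_iff[OF fin(2) L]
    by (meson enat_ord_simps(1) order_trans)
qed

section \<open>Geometric rank\<close>

lemma tensor_eval_cong:
  assumes "\<And>l a. l \<in> F \<Longrightarrow> a < m l \<Longrightarrow> x l a = y l a"
  shows "tensor_eval F m T x = tensor_eval F m T y"
  unfolding tensor_eval_def
proof (rule sum.cong[OF refl])
  fix j assume "j \<in> multi_indices F m"
  then have "(\<Prod>l\<in>F. x l (j l)) = (\<Prod>l\<in>F. y l (j l))"
    by (intro prod.cong refl assms) (auto simp: multi_indices_def PiE_iff)
  then show "T j * (\<Prod>l\<in>F. x l (j l)) = T j * (\<Prod>l\<in>F. y l (j l))" by simp
qed

lemma tensor_eval_expand:
  assumes F: "finite F" "i \<in> F"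
  shows "tensor_eval F m T (x(i := c)) =
    (\<Sum>a<m i. c a * (\<Sum>j\<in>multi_indices (F - {i}) m. T (j(i := a)) * (\<Prod>l\<in>F - {i}. x l (j l))))"
proof -
  let ?M = "multi_indices (F - {i}) m"
  let ?f = "\<lambda>j. T j * (\<Prod>l\<in>F. (x(i := c)) l (j l))"
  have M: "multi_indices F m = (\<lambda>(a, j). j(i := a)) ` ({..<m i} \<times> ?M)"
    using PiE_insert_eq[of i "F - {i}" "\<lambda>l. {..<m l}"] F(2)
    by (simp add: multi_indices_def insert_absorb)
  have inj: "inj_on (\<lambda>(a, j). j(i := a)) ({..<m i} \<times> ?M)"
    unfolding multi_indices_def by (rule inj_combinator) simp
  have "tensor_eval F m T (x(i := c)) = (\<Sum>(a, j)\<in>{..<m i} \<times> ?M. ?f (j(i := a)))"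
    unfolding tensor_eval_def M by (subst sum.reindex[OF inj]) (rule sum.cong, auto)
  also have "\<dots> = (\<Sum>a<m i. \<Sum>j\<in>?M. ?f (j(i := a)))" by (rule sum.cartesian_product[symmetric])
  also have "\<dots> = (\<Sum>a<m i. \<Sum>j\<in>?M. c a * (T (j(i := a)) * (\<Prod>l\<in>F - {i}. x l (j l))))"
  proof (intro sum.cong refl)
    fix a j
    have "(\<Prod>l\<in>F. (x(i := c)) l ((j(i := a)) l)) = c a * (\<Prod>l\<in>F - {i}. (x(i := c)) l ((j(i := a)) l))"
      using prod.remove[OF F, of "\<lambda>l. (x(i := c)) l ((j(i := a)) l)"] by simp
    also have "(\<Prod>l\<in>F - {i}. (x(i := c)) l ((j(i := a)) l)) = (\<Prod>l\<in>F - {i}. x l (j l))"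
      by (rule prod.cong) auto
    finally show "?f (j(i := a)) = c a * (T (j(i := a)) * (\<Prod>l\<in>F - {i}. x l (j l)))" by simp
  qed
  finally show ?thesis by (simp add: sum_distrib_left)
qed

lemma tensor_eval_contract:
  assumes F: "finite F" "i \<in> F"
  shows "tensor_eval (F - {i}) m (contract F m i T c) x = tensor_eval F m T (x(i := c))"
  unfolding tensor_eval_expand[OF F] tensor_eval_def[of "F - {i}"] contract_def
  by (simp add: sum_distrib_left sum_distrib_right mult.assoc)
    (subst sum.swap, simp)

lemma tensor_eval_linear:
  assumes F: "finite F" "i \<in> F"
  shows "tensor_eval F m T (x(i := c)) =
    (\<Sum>a<m i. c a * tensor_eval F m T (x(i := (\<lambda>b. if b = a then 1 else 0))))"
proof -
  have "tensor_eval F m T (x(i := (\<lambda>b. if b = a then 1 else 0))) =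
      (\<Sum>j\<in>multi_indices (F - {i}) m. T (j(i := a)) * (\<Prod>l\<in>F - {i}. x l (j l)))" if "a < m i" for a
    unfolding tensor_eval_expand[OF F] using that by (simp add: if_distrib[of "\<lambda>y. y * _"] cong: if_cong)
  then show ?thesis unfolding tensor_eval_expand[OF F] by (intro sum.cong refl) simp
qed

text \<open>The variety defining the geometric rank, with the omitted factor \<open>k\<close> not necessarily in
  last position.\<close>

definition kernel_variety ::
  "nat set \<Rightarrow> (nat \<Rightarrow> nat) \<Rightarrow> ((nat \<Rightarrow> nat) \<Rightarrow> complex) \<Rightarrow> nat \<Rightarrow> (nat \<times> nat \<Rightarrow> complex) set" where
  "kernel_variety F m T k = {x \<in> affine_space (coords (F - {k}) m).
     \<forall>y. tensor_eval F m T ((curry x)(k := y)) = 0}"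

lemma GR_eq: "GR F m T = codim (coords (F - {Max F}) m) (kernel_variety F m T (Max F))"
proof -
  let ?k = "Max F"
  have "(\<forall>y\<in>affine_space {..<m ?k}. tensor_eval F m T ((curry x)(?k := y)) = 0)
      \<longleftrightarrow> (\<forall>y. tensor_eval F m T ((curry x)(?k := y)) = 0)" for x
  proof
    assume *: "\<forall>y\<in>affine_space {..<m ?k}. tensor_eval F m T ((curry x)(?k := y)) = 0"
    show "\<forall>y. tensor_eval F m T ((curry x)(?k := y)) = 0"
    proof
      fix y
      have "restrict y {..<m ?k} \<in> affine_space {..<m ?k}" by (simp add: affine_space_def)
      with * have "tensor_eval F m T ((curry x)(?k := restrict y {..<m ?k})) = 0" by (rule bspec)
      moreover have "tensor_eval F m T ((curry x)(?k := restrict y {..<m ?k})) = tensor_eval F m T ((curry x)(?k := y))"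
        by (rule tensor_eval_cong) auto
      ultimately show "tensor_eval F m T ((curry x)(?k := y)) = 0" by simp
    qed
  qed simp
  then show ?thesis by (simp add: GR_def Let_def kernel_variety_def)
qed

lemma finite_coords: "finite F \<Longrightarrow> finite (coords F m)"
  by (simp add: coords_def)

lemma coords_Un: "coords (F \<union> G) m = coords F m \<union> coords G m"
  by (auto simp: coords_def)

lemma card_coords_single: "card (coords {i} m) = m i"
  by (simp add: coords_def)

lemma kernel_variety_subset: "kernel_variety F m T k \<subseteq> affine_space (coords (F - {k}) m)"
  by (auto simp: kernel_variety_def)

lemma closedin_kernel_variety: "closedin (zariski (coords (F - {k}) m)) (kernel_variety F m T k)"
proof -
  have "(\<lambda>x. tensor_eval F m T ((curry x)(k := y))) \<in> poly_functions (coords (F - {k}) m)" for y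
    unfolding tensor_eval_def
  proof (intro poly_functions_sum poly_functions.mult poly_functions.const poly_functions_prod)
    fix j l assume j: "j \<in> multi_indices F m" and l: "l \<in> F"
    show "(\<lambda>x. ((curry x)(k := y)) l (j l)) \<in> poly_functions (coords (F - {k}) m)"
    proof (cases "l = k")
      case True
      then show ?thesis by (simp add: poly_functions.const)
    next
      case False
      then have "(l, j l) \<in> coords (F - {k}) m"
        using j l by (auto simp: coords_def multi_indices_def PiE_iff)
      then show ?thesis using False by (simp add: poly_functions.coord)
    qed
  qed
  then have "closedin (zariski (coords (F - {k}) m))
      {x \<in> affine_space (coords (F - {k}) m). \<forall>y\<in>UNIV. tensor_eval F m T ((curry x)(k := y)) = 0}"
    by (intro closedin_zariski_equations)
  then show ?thesis by (simp add: kernel_variety_def)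
qed

lemma tensor_eval_zero_factor:
  assumes "finite F" "l \<in> F" "\<And>a. a < m l \<Longrightarrow> x l a = 0"
  shows "tensor_eval F m T x = 0"
  unfolding tensor_eval_def
proof (rule sum.neutral, rule ballI)
  fix j assume "j \<in> multi_indices F m"
  then have "j l < m l" using assms(2) by (auto simp: multi_indices_def PiE_iff)
  then have "(\<Prod>l\<in>F. x l (j l)) = 0" using assms by (intro prod_zero) auto
  then show "T j * (\<Prod>l\<in>F. x l (j l)) = 0" by simp
qed

lemma kernel_variety_zero_factor:
  assumes "finite F" "l \<in> F" "l \<noteq> k" "x \<in> affine_space (coords (F - {k}) m)" "\<And>a. a < m l \<Longrightarrow> x (l, a) = 0"
  shows "x \<in> kernel_variety F m T k"
  using assms(4) tensor_eval_zero_factor[OF assms(1,2)] assms(3,5) by (simp add: kernel_variety_def)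

lemma kernel_variety_nonempty:
  assumes "finite F" "l \<in> F" "l \<noteq> k"
  shows "kernel_variety F m T k \<noteq> {}"
proof -
  have "(\<lambda>i\<in>coords (F - {k}) m. 0) \<in> kernel_variety F m T k"
    using assms by (intro kernel_variety_zero_factor[OF assms]) (auto simp: affine_space_def coords_def)
  then show ?thesis by (metis empty_iff)
qed

text \<open>Fixing the covector in factor \<open>i\<close> contracts \<open>T\<close> with it. For
  \<open>k = Max (F - {i})\<close> the codimension of the fibre is the geometric rank of the
  contraction.\<close>

lemma fibre_kernel_variety:
  assumes F: "finite F" "i \<in> F" and k: "i \<noteq> k" and a: "a \<in> affine_space (coords {i} m)"
  shows "fibre (coords {i} m) (coords (F - {i} - {k}) m) (kernel_variety F m T k) a
    = kernel_variety (F - {i}) m (contract F m i T (curry a i)) k"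
proof -
  have U: "coords {i} m \<union> coords (F - {i} - {k}) m = coords (F - {k}) m"
    unfolding coords_Un[symmetric] using F(2) k by (intro arg_cong[where f = "\<lambda>F. coords F m"]) auto
  have e: "tensor_eval F m T ((curry (override_on y a (coords {i} m)))(k := w))
      = tensor_eval (F - {i}) m (contract F m i T (curry a i)) ((curry y)(k := w))" for y w
    unfolding tensor_eval_contract[OF F] by (rule tensor_eval_cong) (use k in \<open>auto simp: override_on_def coords_def\<close>)
  have "override_on y a (coords {i} m) \<in> affine_space (coords (F - {k}) m)"
    if "y \<in> affine_space (coords (F - {i} - {k}) m)" for y
    using override_on_affine_space[OF a that] by (simp add: U)
  then show ?thesis by (auto simp: fibre_def kernel_variety_def e)
qed

text \<open>With the factors other than \<open>k\<close> and \<open>l\<close> fixed,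
  \<open>T\<close> becomes a bilinear form whose matrix has the displayed entries, and the fibre is
  its left kernel. Exchanging \<open>k\<close> and \<open>l\<close> transposes the matrix, since the
  two updates commute.\<close>

lemma fibre_kernel_variety_pair:
  assumes F: "finite F" "k \<in> F" "l \<in> F" and kl: "k \<noteq> l" and z: "z \<in> affine_space (coords (F - {k, l}) m)"
  shows "fibre (coords (F - {k, l}) m) (coords {l} m) (kernel_variety F m T k) z =
    {y \<in> affine_space (coords {l} m). \<forall>b\<in>coords {k} m. (\<Sum>a\<in>coords {l} m. y a *
      tensor_eval F m T ((curry z)(l := \<lambda>c. if c = snd a then 1 else 0, k := \<lambda>c. if c = snd b then 1 else 0))) = 0}"
proof -
  let ?A = "coords (F - {k, l}) m"
  let ?e = "\<lambda>a c. if c = a then 1 else (0::complex)"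
  have U: "?A \<union> coords {l} m = coords (F - {k}) m"
    unfolding coords_Un[symmetric] using F kl by (intro arg_cong[where f = "\<lambda>F. coords F m"]) auto
  have sum_coords: "(\<Sum>a\<in>coords {l} m. f a) = (\<Sum>a<m l. f (l, a))" for f :: "nat \<times> nat \<Rightarrow> complex" and l
    unfolding coords_def by (rule sum.reindex_bij_witness[of _ "\<lambda>a. (l, a)" snd]) auto
  have "(\<forall>w. tensor_eval F m T ((curry (override_on y z ?A))(k := w)) = 0) \<longleftrightarrow>
      (\<forall>b\<in>coords {k} m. (\<Sum>a\<in>coords {l} m. y a * tensor_eval F m T ((curry z)(l := ?e (snd a), k := ?e (snd b)))) = 0)" for y
  proof -
    have e: "tensor_eval F m T ((curry (override_on y z ?A))(k := w))
        = tensor_eval F m T ((curry z)(l := curry y l, k := w))" for w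
      by (rule tensor_eval_cong) (use kl in \<open>auto simp: override_on_def coords_def\<close>)
    have lin: "tensor_eval F m T ((curry z)(l := curry y l, k := w)) =
       (\<Sum>b<m k. w b * (\<Sum>a<m l. y (l, a) * tensor_eval F m T ((curry z)(l := ?e a, k := ?e b))))" for w
    proof -
      have "tensor_eval F m T ((curry z)(l := curry y l, k := ?e b)) =
          (\<Sum>a<m l. y (l, a) * tensor_eval F m T ((curry z)(l := ?e a, k := ?e b)))" for b
        using tensor_eval_linear[OF F(1,3), of m T "(curry z)(k := ?e b)" "curry y l"]
        by (simp add: fun_upd_twist[OF kl])
      then show ?thesis using tensor_eval_linear[OF F(1,2), of m T "(curry z)(l := curry y l)" w] by simp
    qed
    have "(\<forall>w. (\<Sum>b<m k. w b * R b) = 0) \<longleftrightarrow> (\<forall>b<m k. R b = 0)" for R :: "nat \<Rightarrow> complex"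
    proof
      assume *: "\<forall>w. (\<Sum>b<m k. w b * R b) = 0"
      show "\<forall>b<m k. R b = 0"
      proof (intro allI impI)
        fix b assume b: "b < m k"
        have "(\<Sum>c<m k. ?e b c * R c) = R b"
          using b by (simp add: if_distrib[of "\<lambda>y. y * _"] cong: if_cong)
        then show "R b = 0" using spec[OF *, of "?e b"] by simp
      qed
    qed simp
    then show ?thesis unfolding e lin sum_coords by (auto simp: coords_def)
  qed
  moreover have "override_on y z ?A \<in> affine_space (coords (F - {k}) m)"
    if "y \<in> affine_space (coords {l} m)" for y
    using override_on_affine_space[OF z that] by (simp add: U)
  ultimately show ?thesis by (auto simp: fibre_def kernel_variety_def)
qed

lemma codim_fibre_pair_le:
  assumes F: "finite F" "k \<in> F" "l \<in> F" and kl: "k \<noteq> l" and z: "z \<in> affine_space (coords (F - {k, l}) m)"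
    and j: "codim (coords {l} m) (fibre (coords (F - {k, l}) m) (coords {l} m) (kernel_variety F m T k) z) \<le> enat j"
  shows "codim (coords {k} m) (fibre (coords (F - {k, l}) m) (coords {k} m) (kernel_variety F m T l) z) \<le> enat j"
proof -
  have z': "z \<in> affine_space (coords (F - {l, k}) m)" using z by (simp add: insert_commute)
  have s: "coords (F - {k, l}) m = coords (F - {l, k}) m" by (simp add: insert_commute)
  have f: "finite (coords {l} m)" "finite (coords {k} m)" by (simp_all add: finite_coords)
  let ?M = "\<lambda>a b. tensor_eval F m T ((curry z)(l := \<lambda>c. if c = snd a then 1 else 0, k := \<lambda>c. if c = snd b then 1 else 0))"
  have "codim (coords {k} m) {w \<in> affine_space (coords {k} m). \<forall>a\<in>coords {l} m. (\<Sum>b\<in>coords {k} m. w b * ?M a b) = 0} \<le> enat j"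
    by (rule codim_kernel_transpose[OF f]) (use j fibre_kernel_variety_pair[OF F kl z] in simp)
  moreover have "fibre (coords (F - {k, l}) m) (coords {k} m) (kernel_variety F m T l) z =
      {w \<in> affine_space (coords {k} m). \<forall>a\<in>coords {l} m. (\<Sum>b\<in>coords {k} m. w b * ?M a b) = 0}"
    unfolding s fibre_kernel_variety_pair[OF F(1,3,2) kl[symmetric] z'] fun_upd_twist[OF kl] ..
  ultimately show ?thesis by simp
qed

text \<open>Over the product of the other factors, the two varieties have as fibres the left and the
  right kernels of the same matrices.\<close>

lemma codim_kernel_variety_le:
  assumes F: "finite F" "k \<in> F" "l \<in> F" and kl: "k \<noteq> l"
    and i: "i \<in> F" "i \<noteq> k" "i \<noteq> l"
  shows "codim (coords (F - {l}) m) (kernel_variety F m T l) \<le> codim (coords (F - {k}) m) (kernel_variety F m T k)"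
proof -
  let ?A = "coords (F - {k, l}) m"
  have Ul: "?A \<union> coords {l} m = coords (F - {k}) m" and Uk: "?A \<union> coords {k} m = coords (F - {l}) m"
    unfolding coords_Un[symmetric] using F kl by (auto intro!: arg_cong[where f = "\<lambda>F. coords F m"])
  have fin: "finite ?A" "finite (coords {l} m)" "finite (coords {k} m)" using F(1) by (simp_all add: finite_coords)
  have disj: "?A \<inter> coords {l} m = {}" "?A \<inter> coords {k} m = {}" by (auto simp: coords_def)
  let ?S = "\<lambda>k l j. {z \<in> affine_space ?A. codim (coords {l} m) (fibre ?A (coords {l} m) (kernel_variety F m T k) z) \<le> enat j}"
  \<comment> \<open>Transposition works in both directions, so the two projections have the same
    sublevel sets, through which \<open>codim_le_fibre\<close> and
    \<open>codim_fibre_attained\<close> can be chained.\<close>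
  have eq: "?S k l j = ?S l k j" for j
    using codim_fibre_pair_le[OF F kl] codim_fibre_pair_le[OF F(1,3,2) kl[symmetric]]
    by (auto simp: insert_commute)
  obtain j where j: "?S k l j \<noteq> {}" "codim ?A (?S k l j) + enat j \<le> codim (coords (F - {k}) m) (kernel_variety F m T k)"
    using codim_fibre_attained[OF fin(1,2) disj(1), of "kernel_variety F m T k"]
      closedin_kernel_variety[of F k m T] kernel_variety_nonempty[OF F(1,3) kl[symmetric], of m T]
    unfolding Ul by auto
  have "codim (?A \<union> coords {k} m) (kernel_variety F m T l) \<le> codim ?A (?S l k j) + enat j"
  proof (rule codim_le_fibre[OF fin(1,3) disj(2)])
    show "closedin (zariski (?A \<union> coords {k} m)) (kernel_variety F m T l)"
      unfolding Uk by (rule closedin_kernel_variety)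
    show "?S l k j \<noteq> {}" using j(1) unfolding eq .
    fix z assume z: "z \<in> affine_space ?A"
    have "z \<in> affine_space (coords (F - {l, k}) m)" using z by (simp add: insert_commute)
    from fibre_kernel_variety_pair[OF F(1,3,2) kl[symmetric] this]
    have "(\<lambda>i\<in>coords {k} m. 0) \<in> fibre ?A (coords {k} m) (kernel_variety F m T l) z"
      by (simp add: insert_commute affine_space_def)
    then show "fibre ?A (coords {k} m) (kernel_variety F m T l) z \<noteq> {}" by (metis empty_iff)
  qed
  then show ?thesis using j(2) unfolding Uk eq by (rule order_trans)
qed

lemma codim_kernel_variety_eq:
  assumes F: "finite F" "card F \<ge> 3" "k \<in> F" "l \<in> F"
  shows "codim (coords (F - {k}) m) (kernel_variety F m T k) = codim (coords (F - {l}) m) (kernel_variety F m T l)"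
proof (cases "k = l")
  case False
  have "card (F - {k, l}) \<noteq> 0" using F False by (simp add: card_Diff_subset)
  then obtain i where "i \<in> F - {k, l}" by (metis card.empty ex_in_conv)
  then have i: "i \<in> F" "i \<noteq> k" "i \<noteq> l" by auto
  show ?thesis
    using codim_kernel_variety_le[OF F(1,3,4) False i] codim_kernel_variety_le[OF F(1,4,3) False[symmetric] i(1,3,2)]
    by (intro antisym)
qed simp

text \<open>A zero covector in factor \<open>l\<close> makes \<open>T\<close> vanish, whatever the
  others are. The kernel variety thus contains a linear subspace on which all coordinates outside
  factor \<open>l\<close> are free.\<close>

lemma codim_kernel_variety_le_dim:
  assumes F: "finite F" "l \<in> F" "l \<noteq> k"
  shows "codim (coords (F - {k}) m) (kernel_variety F m T k) \<le> enat (m l)"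
proof -
  let ?I = "coords (F - {k}) m" and ?J = "coords (F - {k} - {l}) m"
  have fin: "finite ?I" using F(1) by (simp add: finite_coords)
  have JI: "?J \<subseteq> ?I" by (auto simp: coords_def)
  have "alg_indep ?J (kernel_variety F m T k)"
  proof (rule alg_indepI)
    fix p and x :: "nat \<times> nat \<Rightarrow> complex" assume p: "p \<in> poly_functions ?J" "\<And>z. z \<in> kernel_variety F m T k \<Longrightarrow> p z = 0"
    let ?y = "\<lambda>i\<in>?I. if i \<in> ?J then x i else 0"
    have "?y \<in> kernel_variety F m T k"
      by (rule kernel_variety_zero_factor[OF F]) (use F in \<open>auto simp: affine_space_def coords_def\<close>)
    then have "p ?y = 0" by (rule p(2))
    moreover have "p ?y = p x" using p(1) by (rule poly_functions_cong) (use JI in auto)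
    ultimately show "p x = 0" by simp
  qed
  from alg_indep_krull_dim[OF fin JI closedin_kernel_variety this]
  have "enat (card ?J) \<le> krull_dim (subtopology (zariski ?I) (kernel_variety F m T k))" .
  moreover have "card ?I - m l \<le> card ?J"
  proof -
    have "?I = ?J \<union> coords {l} m" unfolding coords_Un[symmetric] using F
      by (intro arg_cong[where f = "\<lambda>F. coords F m"]) auto
    then have "card ?I \<le> card ?J + m l" using card_Un_le[of ?J "coords {l} m"] by (simp add: card_coords_single)
    then show ?thesis by simp
  qed
  ultimately show ?thesis unfolding codim_le_iff[OF fin kernel_variety_subset]
    by (meson enat_ord_simps(1) order_trans)
qed

lemma codim_affine_space: "finite I \<Longrightarrow> codim I (affine_space I) = 0"
proof -
  assume I: "finite I"
  have "alg_indep I (affine_space I)"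
  proof (rule alg_indepI)
    fix p x assume p: "p \<in> poly_functions I" "\<And>z. z \<in> affine_space I \<Longrightarrow> p z = 0"
    have "p (restrict x I) = p x" using p(1) by (rule poly_functions_cong) simp
    moreover have "p (restrict x I) = 0" by (rule p(2)) (simp add: affine_space_def)
    ultimately show "p x = 0" by simp
  qed
  moreover have "closedin (zariski I) (affine_space I)"
    using closedin_topspace[of "zariski I"] by (simp add: topspace_zariski)
  ultimately have "enat (card I) \<le> krull_dim (subtopology (zariski I) (affine_space I))"
    using alg_indep_krull_dim[OF I subset_refl] by simp
  then have "codim I (affine_space I) \<le> enat 0" unfolding codim_le_iff[OF I subset_refl] by simp
  then show ?thesis by (simp add: zero_enat_def[symmetric])
qed

section \<open>The minimum formula\<close>

lemma GR_sublevel_relabel: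
  assumes F: "finite F" "i \<in> F" and k: "k = Max (F - {i})"
  shows "codim {..<m i} (GR_sublevel F m T i j) =
    codim (coords {i} m) {a \<in> affine_space (coords {i} m). codim (coords (F - {i} - {k}) m)
      (kernel_variety (F - {i}) m (contract F m i T (curry a i)) k) \<le> enat j}"
proof -
  have bij: "bij_betw (\<lambda>b. (i, b)) {..<m i} (coords {i} m)"
    by (rule bij_betwI[of _ _ _ snd]) (auto simp: coords_def)
  have c: "contract F m i T (\<lambda>b\<in>{..<m i}. a (i, b)) = contract F m i T (curry a i)" for a :: "nat \<times> nat \<Rightarrow> complex"
    unfolding contract_def by (intro restrict_ext sum.cong refl) simp
  have sub: "GR_sublevel F m T i j \<subseteq> affine_space {..<m i}" by (auto simp: GR_sublevel_def)
  have "(\<lambda>b\<in>{..<m i}. a (i, b)) \<in> GR_sublevel F m T i j \<longleftrightarrow> codim (coords (F - {i} - {k}) m)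
      (kernel_variety (F - {i}) m (contract F m i T (curry a i)) k) \<le> enat j" for a :: "nat \<times> nat \<Rightarrow> complex"
    unfolding GR_sublevel_def mem_Collect_eq c GR_eq k[symmetric] by (simp add: affine_space_def)
  then show ?thesis unfolding codim_relabel[OF bij sub] by simp
qed

text \<open>The geometric rank of a contraction omits \<open>k = Max (F - {i})\<close>, so
  \<open>T\<close> is measured by the variety which omits the same \<open>k\<close>. Factor
  \<open>i\<close> is among its coordinates even if it is the last factor of
  \<open>F\<close>.\<close>

lemma GR_eq_codim_sublevel:
  assumes F: "finite F" "card F \<ge> 3" "i \<in> F"
  shows "GR F m T \<le> codim {..<m i} (GR_sublevel F m T i j) + enat j"
    and "\<exists>j. GR F m T = codim {..<m i} (GR_sublevel F m T i j) + enat j"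
proof -
  define k where "k = Max (F - {i})"
  have c: "card (F - {i}) \<ge> 2" using F by simp
  then have "F - {i} \<noteq> {}" by (metis card.empty not_numeral_le_zero)
  then have "k \<in> F - {i}" unfolding k_def using F(1) by (intro Max_in) auto
  then have k: "k \<in> F" "i \<noteq> k" by auto
  have "card (F - {i} - {k}) \<noteq> 0" using c k F(1) by simp
  then obtain l where "l \<in> F - {i} - {k}" by (metis card.empty ex_in_conv)
  then have l: "l \<in> F - {i}" "l \<noteq> k" by auto
  have "Max F \<in> F" using F(1,3) by (intro Max_in) auto
  then have GR: "GR F m T = codim (coords (F - {k}) m) (kernel_variety F m T k)"
    unfolding GR_eq using k(1) by (rule codim_kernel_variety_eq[OF F(1,2)])
  let ?A = "coords {i} m" and ?B = "coords (F - {i} - {k}) m"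
  have U: "?A \<union> ?B = coords (F - {k}) m"
    unfolding coords_Un[symmetric] using F(3) k by (intro arg_cong[where f = "\<lambda>F. coords F m"]) auto
  have fin: "finite ?A" "finite ?B" using F(1) by (simp_all add: finite_coords)
  have disj: "?A \<inter> ?B = {}" by (auto simp: coords_def)
  let ?S = "\<lambda>j. {a \<in> affine_space ?A. codim ?B (fibre ?A ?B (kernel_variety F m T k) a) \<le> enat j}"
  have sub: "codim {..<m i} (GR_sublevel F m T i j) = codim ?A (?S j)" for j
    unfolding GR_sublevel_relabel[OF F(1,3) k_def]
    by (intro arg_cong[where f = "codim ?A"] Collect_cong conj_cong refl)
      (simp add: fibre_kernel_variety[OF F(1,3) k(2)])
  have ne: "fibre ?A ?B (kernel_variety F m T k) a \<noteq> {}" if "a \<in> affine_space ?A" for a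
    unfolding fibre_kernel_variety[OF F(1,3) k(2) that]
    by (rule kernel_variety_nonempty[OF _ l]) (use F(1) in simp)
  have cl: "closedin (zariski (?A \<union> ?B)) (kernel_variety F m T k)"
    unfolding U by (rule closedin_kernel_variety)
  \<comment> \<open>The zero covector lies in every sublevel set: the fibre over it is the whole
    affine space, of codimension 0.\<close>
  have S: "?S j \<noteq> {}" for j
  proof -
    let ?o = "\<lambda>_\<in>?A. 0 :: complex"
    have o: "?o \<in> affine_space ?A" by (simp add: affine_space_def)
    have "override_on y ?o ?A \<in> kernel_variety F m T k" if y: "y \<in> affine_space ?B" for y
      by (rule kernel_variety_zero_factor[OF F(1,3) k(2)])
        (use override_on_affine_space[OF o y] U in \<open>auto simp: override_on_def coords_def\<close>)
    then have "fibre ?A ?B (kernel_variety F m T k) ?o = affine_space ?B" by (auto simp: fibre_def)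
    then have "?o \<in> ?S j" using o codim_affine_space[OF fin(2)] by simp
    then show ?thesis by (metis empty_iff)
  qed
  have le: "GR F m T \<le> codim {..<m i} (GR_sublevel F m T i j) + enat j" for j
    unfolding GR sub using codim_le_fibre[OF fin disj cl ne S] unfolding U .
  show "GR F m T \<le> codim {..<m i} (GR_sublevel F m T i j) + enat j" by (rule le)
  have "kernel_variety F m T k \<noteq> {}" using kernel_variety_nonempty[OF F(1,3) k(2)] .
  from codim_fibre_attained[OF fin disj cl this] obtain j where
    "codim ?A (?S j) + enat j \<le> codim (?A \<union> ?B) (kernel_variety F m T k)" by (elim exE conjE)
  then have "codim {..<m i} (GR_sublevel F m T i j) + enat j \<le> GR F m T" unfolding GR sub U .
  with le[of j] show "\<exists>j. GR F m T = codim {..<m i} (GR_sublevel F m T i j) + enat j" by (intro exI[of _ j] antisym)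
qed

lemma GR_le_dim:
  assumes F: "finite F" "card F \<ge> 3" "l \<in> F"
  shows "GR F m T \<le> enat (m l)"
proof -
  have "card (F - {l}) \<noteq> 0" using F by simp
  then obtain k where "k \<in> F - {l}" by (metis card.empty ex_in_conv)
  then have k: "k \<in> F" "l \<noteq> k" by auto
  have "Max F \<in> F" using F(1,3) by (intro Max_in) auto
  then have "GR F m T = codim (coords (F - {k}) m) (kernel_variety F m T k)"
    unfolding GR_eq using k(1) by (rule codim_kernel_variety_eq[OF F(1,2)])
  then show ?thesis using codim_kernel_variety_le_dim[OF F(1,3) k(2), of m T] by simp
qed

section \<open>Permutations of the factors\<close>

lemma tensor_eval_permute_factors:
  assumes \<pi>: "\<pi> permutes F"
  shows "tensor_eval F (m \<circ> \<pi>) (permute_factors F m \<pi> T) x = tensor_eval F m T (x \<circ> inv \<pi>)"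
proof -
  have inv: "inv \<pi> permutes F" using \<pi> by (rule permutes_inv)
  \<comment> \<open>Position \<open>l\<close> of the permuted tensor is factor
    \<open>\<pi> l\<close> of \<open>T\<close>, so factor \<open>l\<close> of \<open>T\<close>
    receives the covector \<open>x (inv \<pi> l)\<close>.\<close>
  have "(\<Sum>j\<in>multi_indices F (m \<circ> \<pi>). permute_factors F m \<pi> T j * (\<Prod>l\<in>F. x l (j l)))
      = (\<Sum>j\<in>multi_indices F m. T j * (\<Prod>l\<in>F. (x \<circ> inv \<pi>) l (j l)))"
  proof (rule sum.reindex_bij_witness[of _ "\<lambda>j. j \<circ> \<pi>" "\<lambda>j. j \<circ> inv \<pi>"])
    fix j assume j: "j \<in> multi_indices F (m \<circ> \<pi>)"
    show "(j \<circ> inv \<pi>) \<circ> \<pi> = j" using permutes_inverses[OF \<pi>] by (simp add: fun_eq_iff)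
    have "(j \<circ> inv \<pi>) l < m l" if "l \<in> F" for l
    proof -
      have "inv \<pi> l \<in> F" using permutes_in_image[OF inv] that by simp
      then have "j (inv \<pi> l) < (m \<circ> \<pi>) (inv \<pi> l)" using j by (auto simp: multi_indices_def PiE_iff)
      then show ?thesis using permutes_inverses(1)[OF \<pi>] by simp
    qed
    moreover have "(j \<circ> inv \<pi>) l = undefined" if "l \<notin> F" for l
      using permutes_not_in[OF inv that] j that by (auto simp: multi_indices_def PiE_iff extensional_def)
    ultimately show "j \<circ> inv \<pi> \<in> multi_indices F m" by (auto simp: multi_indices_def PiE_iff extensional_def)
    have "(\<Prod>l\<in>F. x l (j l)) = (\<Prod>l\<in>F. (x \<circ> inv \<pi>) l ((j \<circ> inv \<pi>) l))"
      using prod.permute[OF inv, of "\<lambda>l. x l (j l)"] by (simp add: comp_def)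
    then show "T (j \<circ> inv \<pi>) * (\<Prod>l\<in>F. (x \<circ> inv \<pi>) l ((j \<circ> inv \<pi>) l)) = permute_factors F m \<pi> T j * (\<Prod>l\<in>F. x l (j l))"
      using j by (simp add: permute_factors_def)
  next
    fix j assume j: "j \<in> multi_indices F m"
    show "(j \<circ> \<pi>) \<circ> inv \<pi> = j" using permutes_inverses[OF \<pi>] by (simp add: fun_eq_iff)
    have "(j \<circ> \<pi>) l < (m \<circ> \<pi>) l" if "l \<in> F" for l
      using j permutes_in_image[OF \<pi>] that by (auto simp: multi_indices_def PiE_iff)
    moreover have "(j \<circ> \<pi>) l = undefined" if "l \<notin> F" for l
      using permutes_not_in[OF \<pi> that] j that by (auto simp: multi_indices_def PiE_iff extensional_def)
    ultimately show "j \<circ> \<pi> \<in> multi_indices F (m \<circ> \<pi>)" by (auto simp: multi_indices_def PiE_iff extensional_def)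
  qed
  then show ?thesis by (simp add: tensor_eval_def)
qed

text \<open>Omitting position \<open>k\<close> of the permuted tensor means omitting factor
  \<open>\<pi> k\<close> of \<open>T\<close>. Invariance under permutations is thereby reduced to
  the irrelevance of the omitted factor.\<close>

lemma codim_kernel_variety_permute:
  assumes \<pi>: "\<pi> permutes F"
  shows "codim (coords (F - {k}) (m \<circ> \<pi>)) (kernel_variety F (m \<circ> \<pi>) (permute_factors F m \<pi> T) k)
    = codim (coords (F - {\<pi> k}) m) (kernel_variety F m T (\<pi> k))"
proof -
  let ?I = "coords (F - {k}) (m \<circ> \<pi>)" and ?I' = "coords (F - {\<pi> k}) m"
  let ?h = "\<lambda>(l, a). (\<pi> l, a :: nat)"
  let ?\<phi> = "\<lambda>x. \<lambda>i\<in>?I. x (?h i) :: complex"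
  have inv: "inv \<pi> permutes F" using \<pi> by (rule permutes_inv)
  have i1: "\<pi> (inv \<pi> l) = l" and i2: "inv \<pi> (\<pi> l) = l" for l using permutes_inverses[OF \<pi>] by simp_all
  have iF: "inv \<pi> l \<in> F \<longleftrightarrow> l \<in> F" and pF: "\<pi> l \<in> F \<longleftrightarrow> l \<in> F" for l
    using permutes_in_image[OF inv] permutes_in_image[OF \<pi>] by simp_all
  have i1': "l = \<pi> j" if "inv \<pi> l = j" for l j using that i1 by auto
  have i2': "l = j" if "\<pi> l = \<pi> j" for l j using that i2 by metis
  have bij: "bij_betw ?h ?I ?I'"
    by (rule bij_betwI[of _ _ _ "\<lambda>(l, a). (inv \<pi> l, a)"])
      (auto simp: coords_def i1 i2 iF pF dest: i1' i2')
  have "?\<phi> x \<in> kernel_variety F (m \<circ> \<pi>) (permute_factors F m \<pi> T) k \<longleftrightarrow> x \<in> kernel_variety F m T (\<pi> k)"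
    if x: "x \<in> affine_space ?I'" for x
  proof -
    have "tensor_eval F m T (((curry (?\<phi> x))(k := y)) \<circ> inv \<pi>) = tensor_eval F m T ((curry x)(\<pi> k := y))" for y
    proof (rule tensor_eval_cong)
      fix l a assume l: "l \<in> F" "a < m l"
      show "(((curry (?\<phi> x))(k := y)) \<circ> inv \<pi>) l a = ((curry x)(\<pi> k := y)) l a"
      proof (cases "l = \<pi> k")
        case True
        then show ?thesis by (simp add: i2)
      next
        case False
        then have "inv \<pi> l \<noteq> k" using i1 by metis
        then show ?thesis using False l by (simp add: coords_def i1 iF)
      qed
    qed
    then show ?thesis using x
      by (simp add: kernel_variety_def tensor_eval_permute_factors[OF \<pi>]) (simp add: affine_space_def)
  qed
  then have "{x \<in> affine_space ?I'. ?\<phi> x \<in> kernel_variety F (m \<circ> \<pi>) (permute_factors F m \<pi> T) k} = kernel_variety F m T (\<pi> k)"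
    using kernel_variety_subset by blast
  then show ?thesis using codim_relabel[OF bij kernel_variety_subset] by simp
qed

theorem proposition20:
  fixes n :: nat and m :: "nat \<Rightarrow> nat" and T :: "(nat \<Rightarrow> nat) \<Rightarrow> complex"
  assumes "n \<ge> 3"
    and "T \<in> tensors {1..n} m"
  shows "(\<forall>\<pi>. \<pi> permutes {1..n} \<longrightarrow>
            GR {1..n} (m \<circ> \<pi>) (permute_factors {1..n} m \<pi> T) = GR {1..n} m T) \<and>
         (\<forall>i\<in>{1..n}. GR {1..n} m T =
            Min {codim {..<m i} (GR_sublevel {1..n} m T i j) + enat j |j.
                 j \<le> Min (m ` ({1..n} - {i}))})"
proof (intro conjI allI ballI impI)
  have F: "finite {1..n}" "card {1..n} \<ge> 3" using assms(1) by simp_all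
  {
    fix \<pi> assume \<pi>: "\<pi> permutes {1..n}"
    have "Max {1..n} \<in> {1..n}" using assms(1) by (intro Max_in) auto
    moreover from this have "\<pi> (Max {1..n}) \<in> {1..n}" using permutes_in_image[OF \<pi>] by blast
    ultimately show "GR {1..n} (m \<circ> \<pi>) (permute_factors {1..n} m \<pi> T) = GR {1..n} m T"
      unfolding GR_eq codim_kernel_variety_permute[OF \<pi>] by (intro codim_kernel_variety_eq[OF F])
  next
    fix i assume i: "i \<in> {1..n}"
    let ?c = "\<lambda>j. codim {..<m i} (GR_sublevel {1..n} m T i j) + enat j"
    let ?M = "Min (m ` ({1..n} - {i}))"
    have "card ({1..n} - {i}) \<noteq> 0" using i assms(1) by simp
    then have "{1..n} - {i} \<noteq> {}" by (metis card.empty)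
    then have "?M \<in> m ` ({1..n} - {i})" by (intro Min_in) auto
    then obtain l where M: "?M = m l" and "l \<in> {1..n} - {i}" by (rule imageE)
    then have l: "l \<in> {1..n}" by blast
    obtain j where j: "GR {1..n} m T = ?c j" using GR_eq_codim_sublevel(2)[OF F i] by (rule exE)
    \<comment> \<open>The minimising \<open>j\<close> is at most \<open>GR\<close>, which is at most
      the dimension of every factor, so it lies in the range of the minimum.\<close>
    have "enat j \<le> ?c j" by simp
    also have "\<dots> \<le> enat ?M" using GR_le_dim[OF F l, of m T] unfolding j M .
    finally have "j \<le> ?M" by simp
    show "GR {1..n} m T = Min {?c j |j. j \<le> ?M}"
    proof (rule Min_eqI[symmetric])
      show "finite {?c j |j. j \<le> ?M}" by simp
      show "GR {1..n} m T \<in> {?c j |j. j \<le> ?M}" using j \<open>j \<le> ?M\<close> by auto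
      show "GR {1..n} m T \<le> y" if "y \<in> {?c j |j. j \<le> ?M}" for y
        using that GR_eq_codim_sublevel(1)[OF F i, of m T] by auto
    qed
  }
qed

end
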